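(* Consider the stabilized steady discrete problem: find $u_h\in V_h$ such that $$\tilde K_h(u_h,\bar u_h;u_h,v_h)=G_h(v_h)+\tilde B_h(u_h,\bar u_h,\bar u_h;v_h)\qquad\forall v_h\in V_h,$$ with the stabilized forms $\tilde K_h$, $\tilde B_h$ defined in the context. For $g=0$ this problem is DMP-preserving, i.e. its solutions satisfy the discrete maximum principle for steady problems: for every $a\in\mathcal N_h$, $u_a^{\min}\le u_a\le u_a^{\max}$.
   Context: Mesh and space. $\Omega\subset\mathbb R^d$ is open, bounded, connected with Lipschitz boundary; $\mathcal T_h$ is a partition of $\overline\Omega$ into simplices (resp. quadrilaterals/hexahedra), conforming with the inflow and outflow boundaries below. $V_h$ is the space of functions $v_h$ with $v_h|_K\in\mathbb P_1(K)$ (resp. $\mathbb Q_1(K)$) for all $K\in\mathcal T_h$, with no inter-element continuity; $V_h|_{\partial\Omega}$ is its space of traces on $\partial\Omega$. The set of nodes $\mathcal N_h$ consists of all pairs $a=(i,K)$ with $K\in\mathcal T_h$ and $i$ a vertex of $K$; $\boldsymbol x_a$ is the position of the vertex (several nodes may share a position). $\varphi_a$ is the function that vanishes outside $K$ and on $K$ is the (multi)linear shape function equal to $1$ at $\boldsymbol x_a$ and $0$ at the other vertices of $K$; $v_h=\sum_a v_a\varphi_a$. $\Omega_a$ is the union of all elements $K\in\mathcal T_h$ (closed) with $\boldsymbol x_a\in K$; $\mathcal N_h(a)=\{b\in\mathcal N_h:\boldsymbol x_b\in\Omega_a\}$ (it contains $a$); $\mathcal N_h^\partial=\{a\in\mathcal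 N_h:\boldsymbol x_a\in\partial\Omega\}$; $\mathcal N_h^\partial(a)=\mathcal N_h(a)\cap\mathcal N_h^\partial$. Underlying dG scheme. The continuous steady problem is $\nabla\cdot(\boldsymbol\beta u)-\nabla\cdot(\mu\nabla u)=g$ in $\Omega$, $u=\bar u$ on $\partial\Omega_D=\partial\Omega$, with $\boldsymbol\beta=\boldsymbol\beta(\boldsymbol x)$ divergence-free and $\mu\ge0$ constant. $\partial\Omega^-=\{\boldsymbol x\in\partial\Omega:\boldsymbol\beta\cdot\boldsymbol n_{\partial\Omega}<0\}$, $\partial\Omega^+=\partial\Omega\setminus\partial\Omega^-$; $\mathcal E_h^0,\mathcal E_h^-,\mathcal E_h^+$ are the interior, inflow and outflow facets, $\mathcal E_h$ their union, $h_F$ a characteristic length of $F$. On interior facets $F=\partial K^+\cap\partial K^-$: $\{\!\{v\}\!\}=\frac12(v^{K^+}+v^{K^-})$, $[\![v]\!]=v^{K^+}\boldsymbol n_F^++v^{K^-}\boldsymbol n_F^-$ ($\boldsymbol n_F^\pm$ outward to $K^\pm$); on boundary facets $\{\!\{v\}\!\}=v$, $[\![v]\!]=v\,\boldsymbol n_{\partial\Omega}$. Put $$K_h(u,v)=\sum_{K}\int_K(\mu\nabla u\cdot\nabla v-u\,\boldsymbol\beta\cdot\nabla v)+\sum_{F\in\mathcal E_h}\int_F\mu\big(-[\![u]\!]\cdot\{\!\{\nabla v\}\!\}-\{\!\{\nabla u\}\!\}\cdot[\![v]\!]+c^{\rm ip}h_F^{-1}[\![u]\!]\cdot[\![v]\!]\big)+\sum_{F\in\mathcal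 E_h^+\cup\mathcal E_h^0}\int_F\{\!\{\boldsymbol\beta u\}\!\}\cdot[\![v]\!]+\sum_{F\in\mathcal E_h^0}\int_F\tfrac{|\boldsymbol\beta\cdot\boldsymbol n_F|}{2}[\![u]\!]\cdot[\![v]\!],$$ $$B_h(w;v)=-\sum_{F\in\mathcal E_h^-}\int_F\boldsymbol\beta\cdot\boldsymbol n_{\partial\Omega}\,w\,v-\sum_{F\in\mathcal E_h^-\cup\mathcal E_h^+}\int_F\mu\,w\,\nabla v\cdot\boldsymbol n_{\partial\Omega}+\sum_{F\in\mathcal E_h^-\cup\mathcal E_h^+}\int_F c^{\rm ip}\mu h_F^{-1}w\,v,$$ with $c^{\rm ip}=10$, and $G_h(v)=\int_\Omega g\,v$. $\bar u_h=\sum_{a\in\mathcal N_h^\partial}\bar u(\boldsymbol x_a)\varphi_a\in V_h|_{\partial\Omega}$ is the interpolation of the Dirichlet data $\bar u$, with nodal values $\bar u_b$. Local discrete extremum. $u_h$ has a local discrete maximum (resp. minimum) at node $a$ if $u_a\ge u_h(\boldsymbol x)$ (resp. $\le$) for all $\boldsymbol x\in\Omega_a$ and $u_a\ge\bar u(\boldsymbol x)$ (resp. $\le$) for all $\boldsymbol x\in\partial\Omega_a\cap\partial\Omega$. Stabilization. For each $a\in\mathcal N_h$, $\alpha_a=\alpha_a(u_h,\bar u_h)$ is a parameter with the shock detector property: $\alpha_a(u_h,\bar u_h)\in[0,1]$ for all $u_h\in V_h$ and $\alpha_a(u_h,\bar u_h)=1$ if $u_h$ has a local discrete extremum at $\boldsymbol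 x_a$. The graph-viscosities (functions of $(u_h,\bar u_h)$ through $\alpha$) are $$\nu^\partial_{ab}=\max\{-\alpha_aB_h(\varphi_b;\varphi_a),0\}\quad(a\in\mathcal N_h,\ b\in\mathcal N_h^\partial(a)),$$ $$\nu_{ab}=\max\{\alpha_aK_h(\varphi_b,\varphi_a),\,0,\,\alpha_bK_h(\varphi_a,\varphi_b)\}\quad(b\in\mathcal N_h(a),\ b\ne a),\qquad \nu_{aa}=\sum_{b\in\mathcal N_h(a)\setminus\{a\}}\nu_{ab}+\sum_{b\in\mathcal N_h^\partial(a)}\nu^\partial_{ab}.$$ With $\ell(a,b)=2\delta_{ab}-1$, the stabilized forms are $$\tilde K_h(w_h,\bar w_h;u_h,v_h)=K_h(u_h,v_h)+\sum_{a\in\mathcal N_h}\sum_{b\in\mathcal N_h(a)}\nu_{ab}(w_h,\bar w_h)\,v_a u_b\,\ell(a,b),$$ $$\tilde B_h(w_h,\bar w_h,\bar u_h;v_h)=B_h(\bar u_h;v_h)+\sum_{a\in\mathcal N_h}\sum_{b\in\mathcal N_h^\partial(a)}\nu^\partial_{ab}(w_h,\bar w_h)\,v_a\bar u_b .$$ DMP (steady problems). $u_a^{\max}=\max\{\max_{b\in\mathcal N_h(a)\setminus\{a\}}u_b,\ \max_{\boldsymbol x\in\partial\Omega_a\cap\partial\Omega_D}\bar u_h(\boldsymbol x)\}$ and $u_a^{\min}=\min\{\min_{b\in\mathcal N_h(a)\setminus\{a\}}u_b,\ \min_{\boldsymbol x\in\partial\Omega_a\cap\partial\Omega_D}\bar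 u_h(\boldsymbol x)\}$ (the boundary term being absent if $\partial\Omega_a\cap\partial\Omega_D=\emptyset$).
   Formalization: For μ=0 it is assumed that for each node a some K_h(φ_b,φ_a)≠0 (if μ=0, β=0 every u_h is a solution). Read: face-to-face mesh, flat-faced hexahedra, β C¹ in Ω and continuous up to ∂Ω, shock detector property for every datum ū with interpolant ū_h. *)

theory Defs
  imports "HOL-Analysis.Analysis"
begin

type_synonym 'n cell = "(real^'n) set"

text \<open>A node is a pair (vertex position, element).\<close>
type_synonym 'n node = "(real^'n) \<times> 'n cell"

text \<open>A discontinuous function is given by one branch per element, \<open>u K\<close> being its restriction to the
  closed element \<open>K\<close>; on a facet the branches are the one-sided traces.  Values of \<open>u K\<close> outside \<open>K\<close>
  are irrelevant.\<close>
type_synonym 'n broken = "'n cell \<Rightarrow> real^'n \<Rightarrow> real"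

section \<open>Domain and velocity field\<close>

definition lipschitz_boundary :: "(real^'n) set \<Rightarrow> bool" where
  "lipschitz_boundary \<Omega> \<longleftrightarrow>
     (\<forall>x\<in>frontier \<Omega>. \<exists>r>0. \<exists>e \<gamma> L. norm e = 1 \<and> L-lipschitz_on {z. z \<bullet> e = 0} \<gamma> \<and>
        \<Omega> \<inter> ball x r = {y \<in> ball x r. \<gamma> (y - (y \<bullet> e) *\<^sub>R e) < y \<bullet> e})"

definition lipschitz_domain :: "(real^'n) set \<Rightarrow> bool" where
  "lipschitz_domain \<Omega> \<longleftrightarrow> open \<Omega> \<and> bounded \<Omega> \<and> connected \<Omega> \<and> lipschitz_boundary \<Omega>"

definition divergence :: "(real^'n \<Rightarrow> real^'n) \<Rightarrow> real^'n \<Rightarrow> real" where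
  "divergence \<beta> x = (\<Sum>i\<in>UNIV. frechet_derivative \<beta> (at x) (axis i 1) $ i)"

text \<open>\<open>C\<^sup>1\<close> in the domain, continuous up to the boundary, and divergence-free.\<close>
definition solenoidal_on :: "(real^'n) set \<Rightarrow> (real^'n \<Rightarrow> real^'n) \<Rightarrow> bool" where
  "solenoidal_on \<Omega> \<beta> \<longleftrightarrow>
     continuous_on (closure \<Omega>) \<beta> \<and>
     (\<forall>x\<in>\<Omega>. \<beta> differentiable (at x)) \<and>
     (\<forall>i. continuous_on \<Omega> (\<lambda>x. frechet_derivative \<beta> (at x) (axis i 1))) \<and>
     (\<forall>x\<in>\<Omega>. divergence \<beta> x = 0)"

section \<open>Elements, meshes, local spaces\<close>

definition vertices :: "'n cell \<Rightarrow> (real^'n) set" where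
  "vertices K = {x. x extreme_point_of K}"

definition P1 :: "'n cell \<Rightarrow> (real^'n \<Rightarrow> real) set" where
  "P1 K = {f. \<exists>c w. \<forall>x\<in>K. f x = c + w \<bullet> x}"

text \<open>Polynomials of degree at most one in each variable.\<close>
definition multilinear :: "(real^'n \<Rightarrow> real) set" where
  "multilinear = {q. \<exists>c :: 'n set \<Rightarrow> real. \<forall>x. q x = (\<Sum>S\<in>UNIV. c S * (\<Prod>i\<in>S. x $ i))}"

text \<open>\<open>\<Phi>\<close> is the nondegenerate multilinear map from the reference cube onto the (quadrilateral,
  hexahedral, ...) element \<open>K\<close>.  Elements have flat faces, so \<open>K\<close> is a polytope whose faces are the
  images of the faces of the cube.\<close>
definition cube_map :: "(real^'n \<Rightarrow> real^'n) \<Rightarrow> 'n cell \<Rightarrow> bool" where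
  "cube_map \<Phi> K \<longleftrightarrow>
     (\<forall>j. (\<lambda>z. \<Phi> z $ j) \<in> multilinear) \<and>
     inj_on \<Phi> (cbox 0 1) \<and>
     (\<forall>z\<in>cbox 0 1. det (matrix (frechet_derivative \<Phi> (at z))) \<noteq> 0) \<and>
     polytope K \<and> K = \<Phi> ` cbox 0 1 \<and>
     (\<lambda>F. \<Phi> ` F) ` {F. F face_of cbox 0 1} = {F. F face_of K}"

definition Q1 :: "(real^'n \<Rightarrow> real^'n) \<Rightarrow> (real^'n \<Rightarrow> real) set" where
  "Q1 \<Phi> = {f. \<exists>q\<in>multilinear. \<forall>z\<in>cbox 0 1. f (\<Phi> z) = q z}"

text \<open>\<open>P K\<close> is the local space on \<open>K\<close>.  The partition is face-to-face.\<close>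
definition fe_mesh :: "(real^'n) set \<Rightarrow> 'n cell set \<Rightarrow> ('n cell \<Rightarrow> (real^'n \<Rightarrow> real) set) \<Rightarrow> bool" where
  "fe_mesh \<Omega> T P \<longleftrightarrow>
     finite T \<and> \<Union>T = closure \<Omega> \<and>
     (\<forall>K\<in>T. \<forall>K'\<in>T. K \<noteq> K' \<longrightarrow> interior K \<inter> interior K' = {} \<and> (K \<inter> K') face_of K) \<and>
     ((\<forall>K\<in>T. int CARD('n) simplex K \<and> P K = P1 K) \<or>
      (\<forall>K\<in>T. \<exists>\<Phi>. cube_map \<Phi> K \<and> P K = Q1 \<Phi>))"

section \<open>Traces and integrals on facets\<close>

text \<open>Gradient of a function on a full-dimensional convex element, including its boundary points,
  where the derivative relative to \<open>K\<close> is still unique.\<close>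
definition grad :: "'n cell \<Rightarrow> (real^'n \<Rightarrow> real) \<Rightarrow> real^'n \<Rightarrow> real^'n" where
  "grad K f x = (\<chi> i. frechet_derivative f (at x within K) (axis i 1))"

definition outward_normal :: "'n cell \<Rightarrow> (real^'n) set \<Rightarrow> real^'n" where
  "outward_normal K F =
     (THE n. norm n = 1 \<and> (\<exists>c. K \<subseteq> {x. n \<bullet> x \<le> c} \<and> F = K \<inter> {x. n \<bullet> x = c}))"

text \<open>The \<open>(d-1)\<close>-dimensional Lebesgue measure on the hyperplane \<open>n \<bullet> x = c\<close>, where \<open>n\<close> is a unit
  vector: the \<open>d\<close>-dimensional one on the adjacent slab of thickness one, projected orthogonally.\<close>
definition hyperplane_measure :: "real^'n \<Rightarrow> real \<Rightarrow> (real^'n) measure" where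
  "hyperplane_measure n c =
     distr (restrict_space lborel {z. c \<le> n \<bullet> z \<and> n \<bullet> z \<le> c + 1}) borel
       (\<lambda>z. z - (n \<bullet> z - c) *\<^sub>R n)"

context
  fixes T :: "'n::finite cell set"
begin

definition adjacent :: "(real^'n) set \<Rightarrow> 'n cell set" where
  "adjacent F = {K\<in>T. F facet_of K}"

text \<open>On a boundary facet this is the outward normal of the domain.  On an interior facet its sign
  is arbitrary.\<close>
definition facet_normal :: "(real^'n) set \<Rightarrow> real^'n" where
  "facet_normal F = outward_normal (SOME K. K \<in> adjacent F) F"

definition facet_integral :: "(real^'n) set \<Rightarrow> (real^'n \<Rightarrow> real) \<Rightarrow> real" where
  "facet_integral F f =
     (LINT x:F|hyperplane_measure (facet_normal F) (facet_normal F \<bullet> (SOME y. y \<in> F)). f x)"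

text \<open>Interior facets have two adjacent elements and boundary facets have one, so the next two
  formulas cover both cases.\<close>
definition jump :: "(real^'n) set \<Rightarrow> 'n broken \<Rightarrow> real^'n \<Rightarrow> real^'n" where
  "jump F v x = (\<Sum>K\<in>adjacent F. v K x *\<^sub>R outward_normal K F)"

definition avg :: "(real^'n) set \<Rightarrow> ('n cell \<Rightarrow> real^'n \<Rightarrow> 'v::real_vector) \<Rightarrow> real^'n \<Rightarrow> 'v" where
  "avg F v x = (1 / real (card (adjacent F))) *\<^sub>R (\<Sum>K\<in>adjacent F. v K x)"

definition interior_facets :: "(real^'n) set set" where
  "interior_facets = {F. \<exists>K\<in>T. \<exists>K'\<in>T. K \<noteq> K' \<and> F facet_of K \<and> F facet_of K'}"

definition boundary_facets :: "(real^'n) set \<Rightarrow> (real^'n) set set" where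
  "boundary_facets \<Omega> = {F. F \<subseteq> frontier \<Omega> \<and> (\<exists>K\<in>T. F facet_of K)}"

text \<open>The inflow condition is imposed on the relative interior of the facet: the normal of the
  domain is undefined, and \<open>\<beta>\<close> may become tangential, where two facets meet.\<close>
definition inflow_facets :: "(real^'n) set \<Rightarrow> (real^'n \<Rightarrow> real^'n) \<Rightarrow> (real^'n) set set" where
  "inflow_facets \<Omega> \<beta> =
     {F \<in> boundary_facets \<Omega>. \<forall>x\<in>rel_interior F. \<beta> x \<bullet> facet_normal F < 0}"

definition outflow_facets :: "(real^'n) set \<Rightarrow> (real^'n \<Rightarrow> real^'n) \<Rightarrow> (real^'n) set set" where
  "outflow_facets \<Omega> \<beta> =
     {F \<in> boundary_facets \<Omega>. \<forall>x\<in>rel_interior F. \<beta> x \<bullet> facet_normal F \<ge> 0}"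

definition conforming_boundary :: "(real^'n) set \<Rightarrow> (real^'n \<Rightarrow> real^'n) \<Rightarrow> bool" where
  "conforming_boundary \<Omega> \<beta> \<longleftrightarrow>
     boundary_facets \<Omega> = inflow_facets \<Omega> \<beta> \<union> outflow_facets \<Omega> \<beta>"

section \<open>Nodes and patches\<close>

definition nodes :: "'n node set" where
  "nodes = {(x, K). K \<in> T \<and> x \<in> vertices K}"

definition patch :: "'n node \<Rightarrow> (real^'n) set" where
  "patch a = \<Union>{K\<in>T. fst a \<in> K}"

definition nbrs :: "'n node \<Rightarrow> 'n node set" where
  "nbrs a = {b\<in>nodes. fst b \<in> patch a}"

definition bdry_nodes :: "(real^'n) set \<Rightarrow> 'n node set" where
  "bdry_nodes \<Omega> = {a\<in>nodes. fst a \<in> frontier \<Omega>}"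

definition bdry_nbrs :: "(real^'n) set \<Rightarrow> 'n node \<Rightarrow> 'n node set" where
  "bdry_nbrs \<Omega> a = nbrs a \<inter> bdry_nodes \<Omega>"

end

definition node_val :: "'n broken \<Rightarrow> 'n node \<Rightarrow> real" where
  "node_val u a = u (snd a) (fst a)"

section \<open>The scheme\<close>

definition c_ip :: real where
  "c_ip = 10"

text \<open>\<open>h F\<close> is the characteristic length of the facet \<open>F\<close>.\<close>
context
  fixes \<Omega> :: "(real^'n::finite) set" and T :: "'n cell set"
    and \<beta> :: "real^'n \<Rightarrow> real^'n" and \<mu> :: real and h :: "(real^'n) set \<Rightarrow> real"
begin

definition K_form :: "'n broken \<Rightarrow> 'n broken \<Rightarrow> real" where
  "K_form u v =
     (\<Sum>K\<in>T. LINT x:K|lborel.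
        \<mu> * (grad K (u K) x \<bullet> grad K (v K) x) - u K x * (\<beta> x \<bullet> grad K (v K) x))
   + (\<Sum>F\<in>interior_facets T \<union> inflow_facets T \<Omega> \<beta> \<union> outflow_facets T \<Omega> \<beta>.
        facet_integral T F (\<lambda>x. \<mu> *
          (- (jump T F u x \<bullet> avg T F (\<lambda>K. grad K (v K)) x)
           - avg T F (\<lambda>K. grad K (u K)) x \<bullet> jump T F v x
           + c_ip / h F * (jump T F u x \<bullet> jump T F v x))))
   + (\<Sum>F\<in>outflow_facets T \<Omega> \<beta> \<union> interior_facets T.
        facet_integral T F (\<lambda>x. avg T F (\<lambda>K y. u K y *\<^sub>R \<beta> y) x \<bullet> jump T F v x))
   + (\<Sum>F\<in>interior_facets T.
        facet_integral T F (\<lambda>x. \<bar>\<beta> x \<bullet> facet_normal T F\<bar> / 2 * (jump T F u x \<bullet> jump T F v x)))"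

text \<open>Only the traces of \<open>w\<close> on the boundary facets enter.  There \<open>avg\<close> is the one-sided trace.\<close>
definition B_form :: "'n broken \<Rightarrow> 'n broken \<Rightarrow> real" where
  "B_form w v =
   - (\<Sum>F\<in>inflow_facets T \<Omega> \<beta>.
        facet_integral T F (\<lambda>x. (\<beta> x \<bullet> facet_normal T F) * avg T F w x * avg T F v x))
   - (\<Sum>F\<in>inflow_facets T \<Omega> \<beta> \<union> outflow_facets T \<Omega> \<beta>.
        facet_integral T F (\<lambda>x. \<mu> * avg T F w x *
          (avg T F (\<lambda>K. grad K (v K)) x \<bullet> facet_normal T F)))
   + (\<Sum>F\<in>inflow_facets T \<Omega> \<beta> \<union> outflow_facets T \<Omega> \<beta>.
        facet_integral T F (\<lambda>x. c_ip * \<mu> / h F * avg T F w x * avg T F v x))"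

end

definition G_form :: "'n cell set \<Rightarrow> (real^'n \<Rightarrow> real) \<Rightarrow> 'n broken \<Rightarrow> real" where
  "G_form T g v = (\<Sum>K\<in>T. LINT x:K|lborel. g x * v K x)"

context
  fixes \<Omega> :: "(real^'n::finite) set" and T :: "'n cell set"
    and P :: "'n cell \<Rightarrow> (real^'n \<Rightarrow> real) set"
begin

definition V_space :: "'n broken set" where
  "V_space = {u. \<forall>K\<in>T. u K \<in> P K}"

definition shape :: "'n cell \<Rightarrow> real^'n \<Rightarrow> real^'n \<Rightarrow> real" where
  "shape K i = (THE f. f \<in> P K \<and> (\<forall>j\<in>vertices K. f j = (if j = i then 1 else 0)) \<and>
                       (\<forall>x. x \<notin> K \<longrightarrow> f x = 0))"

definition basis :: "'n node \<Rightarrow> 'n broken" where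
  "basis a = (\<lambda>K x. if K = snd a then shape K (fst a) x else 0)"

definition bdry_interp :: "(real^'n \<Rightarrow> real) \<Rightarrow> 'n broken" where
  "bdry_interp ubar = (\<lambda>K x. \<Sum>b\<in>bdry_nodes T \<Omega>. ubar (fst b) * basis b K x)"

definition local_discrete_max :: "'n broken \<Rightarrow> (real^'n \<Rightarrow> real) \<Rightarrow> 'n node \<Rightarrow> bool" where
  "local_discrete_max u ubar a \<longleftrightarrow>
     (\<forall>K\<in>T. fst a \<in> K \<longrightarrow> (\<forall>x\<in>K. node_val u a \<ge> u K x)) \<and>
     (\<forall>x\<in>frontier (patch T a) \<inter> frontier \<Omega>. node_val u a \<ge> ubar x)"

definition local_discrete_min :: "'n broken \<Rightarrow> (real^'n \<Rightarrow> real) \<Rightarrow> 'n node \<Rightarrow> bool" where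
  "local_discrete_min u ubar a \<longleftrightarrow>
     (\<forall>K\<in>T. fst a \<in> K \<longrightarrow> (\<forall>x\<in>K. node_val u a \<le> u K x)) \<and>
     (\<forall>x\<in>frontier (patch T a) \<inter> frontier \<Omega>. node_val u a \<le> ubar x)"

text \<open>The detector sees the boundary datum through its interpolant only; the property is required
  for every datum \<open>ubar\<close>.\<close>
definition shock_detector :: "('n node \<Rightarrow> 'n broken \<Rightarrow> 'n broken \<Rightarrow> real) \<Rightarrow> bool" where
  "shock_detector \<alpha> \<longleftrightarrow>
     (\<forall>a\<in>nodes T. \<forall>u\<in>V_space. \<forall>ubar.
        0 \<le> \<alpha> a u (bdry_interp ubar) \<and> \<alpha> a u (bdry_interp ubar) \<le> 1 \<and>
        (local_discrete_max u ubar a \<or> local_discrete_min u ubar a \<longrightarrow>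
           \<alpha> a u (bdry_interp ubar) = 1))"

text \<open>The value of a broken \<open>w\<close> at a boundary point is taken from every element containing the
  point; for \<open>w = bdry_interp ubar\<close> these values coincide.  The suprema over the (compact) boundary
  parts are attained.\<close>
definition patch_vals :: "'n broken \<Rightarrow> 'n broken \<Rightarrow> 'n node \<Rightarrow> real set" where
  "patch_vals u w a = node_val u ` (nbrs T a - {a}) \<union>
     {w K x | K x. K \<in> T \<and> x \<in> K \<and> x \<in> frontier (patch T a) \<inter> frontier \<Omega>}"

definition u_max :: "'n broken \<Rightarrow> 'n broken \<Rightarrow> 'n node \<Rightarrow> real" where
  "u_max u w a = Sup (patch_vals u w a)"

definition u_min :: "'n broken \<Rightarrow> 'n broken \<Rightarrow> 'n node \<Rightarrow> real" where
  "u_min u w a = Inf (patch_vals u w a)"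

definition satisfies_DMP :: "(real^'n \<Rightarrow> real) \<Rightarrow> 'n broken \<Rightarrow> bool" where
  "satisfies_DMP ubar u \<longleftrightarrow>
     (\<forall>a\<in>nodes T. u_min u (bdry_interp ubar) a \<le> node_val u a \<and>
                  node_val u a \<le> u_max u (bdry_interp ubar) a)"

end

context
  fixes \<Omega> :: "(real^'n::finite) set" and T :: "'n cell set"
    and P :: "'n cell \<Rightarrow> (real^'n \<Rightarrow> real) set"
    and \<beta> :: "real^'n \<Rightarrow> real^'n" and \<mu> :: real and h :: "(real^'n) set \<Rightarrow> real"
    and \<alpha> :: "'n node \<Rightarrow> 'n broken \<Rightarrow> 'n broken \<Rightarrow> real"
begin

definition nu_bdry :: "'n broken \<Rightarrow> 'n broken \<Rightarrow> 'n node \<Rightarrow> 'n node \<Rightarrow> real" where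
  "nu_bdry w wbar a b = max (- \<alpha> a w wbar * B_form \<Omega> T \<beta> \<mu> h (basis P b) (basis P a)) 0"

definition nu_off :: "'n broken \<Rightarrow> 'n broken \<Rightarrow> 'n node \<Rightarrow> 'n node \<Rightarrow> real" where
  "nu_off w wbar a b =
     max (\<alpha> a w wbar * K_form \<Omega> T \<beta> \<mu> h (basis P b) (basis P a))
       (max 0 (\<alpha> b w wbar * K_form \<Omega> T \<beta> \<mu> h (basis P a) (basis P b)))"

definition nu :: "'n broken \<Rightarrow> 'n broken \<Rightarrow> 'n node \<Rightarrow> 'n node \<Rightarrow> real" where
  "nu w wbar a b =
     (if b = a then (\<Sum>c\<in>nbrs T a - {a}. nu_off w wbar a c) +
                    (\<Sum>c\<in>bdry_nbrs T \<Omega> a. nu_bdry w wbar a c)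
      else nu_off w wbar a b)"

definition ell :: "'n node \<Rightarrow> 'n node \<Rightarrow> real" where
  "ell a b = 2 * (if a = b then 1 else 0) - 1"

definition K_stab :: "'n broken \<Rightarrow> 'n broken \<Rightarrow> 'n broken \<Rightarrow> 'n broken \<Rightarrow> real" where
  "K_stab w wbar u v = K_form \<Omega> T \<beta> \<mu> h u v +
     (\<Sum>a\<in>nodes T. \<Sum>b\<in>nbrs T a. nu w wbar a b * node_val v a * node_val u b * ell a b)"

definition B_stab :: "'n broken \<Rightarrow> 'n broken \<Rightarrow> 'n broken \<Rightarrow> 'n broken \<Rightarrow> real" where
  "B_stab w wbar ubar v = B_form \<Omega> T \<beta> \<mu> h ubar v +
     (\<Sum>a\<in>nodes T. \<Sum>b\<in>bdry_nbrs T \<Omega> a. nu_bdry w wbar a b * node_val v a * node_val ubar b)"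

definition stabilized_solution ::
  "(real^'n \<Rightarrow> real) \<Rightarrow> (real^'n \<Rightarrow> real) \<Rightarrow> 'n broken \<Rightarrow> bool" where
  "stabilized_solution g ubar u \<longleftrightarrow>
     (let ubar_h = bdry_interp \<Omega> T P ubar in
      u \<in> V_space T P \<and>
      (\<forall>v\<in>V_space T P. K_stab u ubar_h u v = G_form T g v + B_stab u ubar_h ubar_h v))"

end

end

theory Submission
  imports Defs
begin

text \<open>
  If \<open>u\<close> exceeded all its patch values at a node \<open>a\<close>, it would have a local discrete maximum there, so that
  \<open>\<alpha>\<^sub>a = 1\<close>.  The row of the scheme for \<open>\<phi>\<^sub>a\<close>, together with the consistency relation
  \<open>\<Sum>\<^sub>b K\<^sub>h(\<phi>\<^sub>b,\<phi>\<^sub>a) = \<Sum>\<^sub>b B\<^sub>h(\<phi>\<^sub>b;\<phi>\<^sub>a)\<close> (the divergence theorem), reads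
  \<open>\<Sum>\<^sub>b (\<nu>\<^sub>a\<^sub>b - K\<^sub>h(\<phi>\<^sub>b,\<phi>\<^sub>a)) (u\<^sub>a - u\<^sub>b) + \<Sum>\<^sub>b (\<nu>\<^sup>\<partial>\<^sub>a\<^sub>b + B\<^sub>h(\<phi>\<^sub>b;\<phi>\<^sub>a)) (u\<^sub>a - ubar\<^sub>b) = 0\<close>
  with nonnegative coefficients.  All of them vanish, hence every off-diagonal \<open>K\<^sub>h(\<phi>\<^sub>b,\<phi>\<^sub>a)\<close> is nonnegative
  and every \<open>B\<^sub>h(\<phi>\<^sub>b;\<phi>\<^sub>a)\<close> nonpositive.  For \<open>\<mu> > 0\<close> this contradicts the sign of one explicit entry: if the
  element of \<open>a\<close> has an interior facet, the diffusive flux through it couples \<open>a\<close> negatively to a vertex of the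
  neighbour; otherwise some boundary entry is positive.  No bound on the penalty enters, which matters because
  \<open>h\<close> is only assumed positive.  For \<open>\<mu> = 0\<close> the boundary entries and, by the divergence theorem for \<open>\<phi>\<^sub>a\<^sup>2\<close>, the
  diagonal entry are nonnegative, so the whole row vanishes, against nondegeneracy.\<close>

section \<open>The divergence theorem on polytopes\<close>

text \<open>A matrix entry mixes volume, flux, penalty and upwind integrals whose relative sizes are
  not controlled, so its sign is readable only where all but one kind of term drops out. This
  dictates the choice of entry. Across an interior facet, exactly one of the two vertices is taken
  on the facet: one trace vanishes, and with it the penalty and upwind terms, while the gradient of
  the vanishing function is a multiple of the normal. On an element without interior facets the
  choice depends on the element type. An affine shape function has constant gradient, whose flux
  over the closed boundary is zero, so the penalty decides the sum of the boundary entries. In a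
  cube image the opposite vertex shares no facet with the node, so penalty and inflow terms vanish
  and the flux decides. The divergence theorem has its present form because facet integrals are
  defined by projecting a slab, and because \<beta> is C1 only inside the domain, with derivatives
  possibly unbounded near boundary facets.\<close>

lemma lborel_integral_translation:
  fixes f :: "'a::euclidean_space \<Rightarrow> real"
  assumes "integrable lborel f"
  shows "integrable lborel (\<lambda>x. f (v + x))" "(\<integral>x. f (v + x) \<partial>lborel) = (\<integral>x. f x \<partial>lborel)"
proof -
  have d: "distr lborel borel ((+) v) = lborel" by (rule lborel_distr_plus)
  have [measurable]: "f \<in> borel_measurable borel" using assms by (auto dest: borel_measurable_integrable)
  have "integrable (distr lborel borel ((+) v)) f" using assms d by simp
  then show "integrable lborel (\<lambda>x. f (v + x))" by (subst (asm) integrable_distr_eq) auto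
  have "(\<integral>x. f x \<partial>distr lborel borel ((+) v)) = (\<integral>x. f (v + x) \<partial>lborel)"
    by (subst integral_distr) auto
  then show "(\<integral>x. f (v + x) \<partial>lborel) = (\<integral>x. f x \<partial>lborel)" using d by simp
qed

text \<open>Translation invariance makes the integral of every difference quotient zero; the
  Lipschitz bound and the compact support give an integrable majorant for the limit.
  Differentiability is asked only almost everywhere because the cutoffs used later have
  kinks.\<close>

lemma integral_directional_derivative_eq_0:
  fixes H :: "'a::euclidean_space \<Rightarrow> real"
  assumes lip: "L-lipschitz_on UNIV H"
    and supp: "\<And>x. x \<notin> cball 0 R \<Longrightarrow> H x = 0"
    and meas: "H' \<in> borel_measurable borel"
    and deriv: "AE x in lborel. ((\<lambda>t. H (x + t *\<^sub>R e)) has_real_derivative H' x) (at 0)"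
  shows "(\<integral>x. H' x \<partial>lborel) = 0"
proof -
  define s where "s k x = (H (x + (1 / real (Suc k)) *\<^sub>R e) - H x) * real (Suc k)" for k x
  have contH: "continuous_on UNIV H" using lip by (rule lipschitz_on_continuous_on)
  then have mH[measurable]: "H \<in> borel_measurable borel" by (rule borel_measurable_continuous_onI)
  have intH: "integrable lborel H"
  proof -
    have "integrable lborel (\<lambda>x. indicator (cball 0 R) x *\<^sub>R H x)"
      by (rule borel_integrable_compact) (auto intro: continuous_on_subset[OF contH])
    moreover have "(\<lambda>x. indicator (cball 0 R) x *\<^sub>R H x) = H"
      using supp by (force simp: indicator_def fun_eq_iff)
    ultimately show ?thesis by simp
  qed
  have tr: "integrable lborel (\<lambda>x. H (x + v)) \<and> (\<integral>x. H (x + v) \<partial>lborel) = (\<integral>x. H x \<partial>lborel)" for v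
    using lborel_integral_translation[OF intH, of v] by (simp add: add.commute)
  have int0: "(\<integral>x. s k x \<partial>lborel) = 0" for k
    unfolding s_def using tr[of "(1 / real (Suc k)) *\<^sub>R e"] intH by (simp del: of_nat_Suc)
  have "(\<lambda>k. \<integral>x. s k x \<partial>lborel) \<longlonglongrightarrow> (\<integral>x. H' x \<partial>lborel)"
  \<comment> \<open>The steps have length at most \<open>norm e\<close>, so outside the ball of
    radius \<open>R + norm e\<close> both points of the quotient lie off the support.\<close>
  proof (rule integral_dominated_convergence[where w="\<lambda>x. indicator (cball 0 (R + norm e)) x *\<^sub>R (L * norm e)"])
    show "H' \<in> borel_measurable lborel" using meas by simp
    show "s k \<in> borel_measurable lborel" for k unfolding s_def by measurable
    show "integrable lborel (\<lambda>x. indicator (cball 0 (R + norm e)) x *\<^sub>R (L * norm e))"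
      by (rule borel_integrable_compact) auto
    show "AE x in lborel. (\<lambda>k. s k x) \<longlonglongrightarrow> H' x"
      using deriv
    proof eventually_elim
      case (elim x)
      then have "((\<lambda>h. (H (x + h *\<^sub>R e) - H x) / h) \<longlongrightarrow> H' x) (at 0)"
        by (simp add: has_field_derivative_iff)
      then have "(\<lambda>k. (H (x + inverse (real (Suc k)) *\<^sub>R e) - H x) / inverse (real (Suc k))) \<longlonglongrightarrow> H' x"
        by (rule filterlim_compose)
           (simp add: filterlim_at LIMSEQ_inverse_real_of_nat del: of_nat_Suc)
      then show ?case unfolding s_def by (simp add: divide_simps mult.commute del: of_nat_Suc)
    qed
    show "AE x in lborel. norm (s k x) \<le> indicator (cball 0 (R + norm e)) x *\<^sub>R (L * norm e)" for k
    proof (rule AE_I2)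
      fix x
      have L: "\<bar>H (x + (1 / real (Suc k)) *\<^sub>R e) - H x\<bar> \<le> L * (norm e / real (Suc k))"
        using lipschitz_onD[OF lip, of "x + (1 / real (Suc k)) *\<^sub>R e" x] by (simp add: dist_norm)
      show "norm (s k x) \<le> indicator (cball 0 (R + norm e)) x *\<^sub>R (L * norm e)"
      proof (cases "x \<in> cball 0 (R + norm e)")
        case True
        have "\<bar>s k x\<bar> = \<bar>H (x + (1 / real (Suc k)) *\<^sub>R e) - H x\<bar> * real (Suc k)"
          by (simp add: s_def abs_mult del: of_nat_Suc)
        also have "\<dots> \<le> L * (norm e / real (Suc k)) * real (Suc k)"
          by (rule mult_right_mono[OF L]) simp
        finally show ?thesis using True by (simp del: of_nat_Suc)
      next
        case False
        then have n: "norm x > R + norm e" by simp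
        have "norm ((1 / real (Suc k)) *\<^sub>R e) \<le> norm e" by (simp add: divide_le_eq mult_le_cancel_left1)
        moreover have "norm x \<le> norm (x + (1 / real (Suc k)) *\<^sub>R e) + norm ((1 / real (Suc k)) *\<^sub>R e)"
          by (metis add_diff_cancel norm_triangle_sub norm_triangle_ineq4 add.commute)
        ultimately have "norm (x + (1 / real (Suc k)) *\<^sub>R e) > R" using n by linarith
        moreover have "norm x > R" using n norm_ge_zero[of e] by linarith
        ultimately show ?thesis using False by (simp add: s_def supp)
      qed
    qed
  qed
  then show ?thesis using int0 by (simp add: LIMSEQ_const_iff)
qed

text \<open>The unit slab consists of \<open>N\<close> translates of the slab of thickness \<open>1/N\<close>, so translation invariance suffices
  to blow up thin layers along a facet.\<close>
lemma fold_slab_integral: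
  fixes f :: "'a::euclidean_space \<Rightarrow> real" and n :: 'a
  assumes n: "norm n = 1" and N: "0 < (N::nat)" and f: "integrable lborel f"
  shows "real N * (\<integral>x. indicator {x. c - 1 / real N \<le> n \<bullet> x \<and> n \<bullet> x < c} x * f x \<partial>lborel)
       = (\<integral>z. indicator {z. c \<le> n \<bullet> z \<and> n \<bullet> z < c + 1} z *
           f (z - ((of_int \<lfloor>real N * (n \<bullet> z - c)\<rfloor> + 1) / real N) *\<^sub>R n) \<partial>lborel)"
    (is "_ = integral\<^sup>L lborel ?g")
proof -
  have [measurable]: "f \<in> borel_measurable borel" using f by (auto dest: borel_measurable_integrable)
  define S where "S = {x. c - 1 / real N \<le> n \<bullet> x \<and> n \<bullet> x < c}"
  define q where "q x = indicator S x * f x" for x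
  have [measurable]: "S \<in> sets borel" unfolding S_def by measurable
  have q: "integrable lborel q"
    unfolding q_def using integrable_real_mult_indicator[of S lborel f] f by (simp add: mult.commute)
  have eq: "?g z = (\<Sum>k<N. q (- (((real k + 1) / real N) *\<^sub>R n) + z))" for z
  proof -
    \<comment> \<open>\<open>s\<close> is the signed height of \<open>z\<close> above the
      hyperplane, in units of the layer thickness. Lowering \<open>z\<close> by
      \<open>(k + 1) / N\<close> lands in the layer exactly when \<open>k\<close> is the floor of
      \<open>s\<close>, so at most one summand survives.\<close>
    define s where "s = real N * (n \<bullet> z - c)"
    have nn: "n \<bullet> n = 1" using n by (simp add: norm_eq_1)
    have ink: "- (((real k + 1) / real N) *\<^sub>R n) + z \<in> S \<longleftrightarrow> real k \<le> s \<and> s < real k + 1" for k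
    proof -
      have "n \<bullet> (- (((real k + 1) / real N) *\<^sub>R n) + z) = c + (s - (real k + 1)) / real N"
        using N by (simp add: s_def inner_diff_right inner_add_right nn field_simps)
      moreover have "(s - (real k + 1)) / real N < 0 \<longleftrightarrow> s < real k + 1"
        using N by (simp add: divide_less_0_iff)
      moreover have "- 1 / real N \<le> (s - (real k + 1)) / real N \<longleftrightarrow> real k \<le> s"
        using N by (subst divide_le_cancel) auto
      ultimately show ?thesis unfolding S_def by simp
    qed
    have sl: "c \<le> n \<bullet> z \<and> n \<bullet> z < c + 1 \<longleftrightarrow> 0 \<le> s \<and> s < real N"
    proof -
      have "s < real N \<longleftrightarrow> real N * (n \<bullet> z - c) < real N * 1" by (simp add: s_def)
      also have "\<dots> \<longleftrightarrow> n \<bullet> z - c < 1" using N by (subst mult_less_cancel_left_pos) auto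
      finally show ?thesis using N by (auto simp: s_def zero_le_mult_iff)
    qed
    show ?thesis
    proof (cases "0 \<le> s \<and> s < real N")
      case True
      define k0 where "k0 = nat \<lfloor>s\<rfloor>"
      have k0: "real k0 = of_int \<lfloor>s\<rfloor>" "k0 < N" "real k0 \<le> s" "s < real k0 + 1"
        using True by (auto simp: k0_def) linarith+
      have "(\<Sum>k<N. q (- (((real k + 1) / real N) *\<^sub>R n) + z)) = (\<Sum>k<N. if k = k0 then f (- (((real k0 + 1) / real N) *\<^sub>R n) + z) else 0)"
      proof (rule sum.cong[OF refl])
        fix k
        have "(real k \<le> s \<and> s < real k + 1) \<longleftrightarrow> k = k0"
        proof
          assume "real k \<le> s \<and> s < real k + 1"
          then have "real k < real k0 + 1" "real k0 < real k + 1" using k0 by linarith+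
          then show "k = k0" by linarith
        qed (use k0 in auto)
        then show "q (- (((real k + 1) / real N) *\<^sub>R n) + z) = (if k = k0 then f (- (((real k0 + 1) / real N) *\<^sub>R n) + z) else 0)"
          unfolding q_def indicator_def ink by auto
      qed
      also have "\<dots> = f (- (((real k0 + 1) / real N) *\<^sub>R n) + z)" using k0 by simp
      finally have sum: "(\<Sum>k<N. q (- (((real k + 1) / real N) *\<^sub>R n) + z)) = f (z - ((of_int \<lfloor>s\<rfloor> + 1) / real N) *\<^sub>R n)"
        using k0(1) by simp
      have "indicator {z. c \<le> n \<bullet> z \<and> n \<bullet> z < c + 1} z = (1::real)" using sl True by simp
      then show ?thesis unfolding sum by (simp add: s_def)
    next
      case False
      have "q (- (((real k + 1) / real N) *\<^sub>R n) + z) = 0" if "k < N" for k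
      proof -
        have "\<not> (real k \<le> s \<and> s < real k + 1)" using False that by auto
        then show ?thesis unfolding q_def indicator_def ink by auto
      qed
      then show ?thesis using sl False by simp
    qed
  qed
  show "real N * (\<integral>x. indicator {x. c - 1 / real N \<le> n \<bullet> x \<and> n \<bullet> x < c} x * f x \<partial>lborel) = (\<integral>z. ?g z \<partial>lborel)"
    unfolding eq
  proof (subst Bochner_Integration.integral_sum)
    show "integrable lborel (\<lambda>z. q (- (((real k + 1) / real N) *\<^sub>R n) + z))" for k
      by (rule lborel_integral_translation(1)[OF q])
    show "real N * (\<integral>x. indicator {x. c - 1 / real N \<le> n \<bullet> x \<and> n \<bullet> x < c} x * f x \<partial>lborel) =
      (\<Sum>k<N. \<integral>z. q (- (((real k + 1) / real N) *\<^sub>R n) + z) \<partial>lborel)"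
      by (simp only: lborel_integral_translation(2)[OF q]) (simp add: q_def S_def)
  qed
qed

lemma hyperplane_measure_integral:
  fixes n :: "real^'n" and f :: "real^'n \<Rightarrow> real"
  assumes f: "f \<in> borel_measurable borel"
  shows "integral\<^sup>L (hyperplane_measure n c) f =
    (\<integral>z. indicator {z. c \<le> n \<bullet> z \<and> n \<bullet> z \<le> c + 1} z * f (z - (n \<bullet> z - c) *\<^sub>R n) \<partial>lborel)"
    and "integrable (hyperplane_measure n c) f \<longleftrightarrow>
    integrable lborel (\<lambda>z. indicator {z. c \<le> n \<bullet> z \<and> n \<bullet> z \<le> c + 1} z * f (z - (n \<bullet> z - c) *\<^sub>R n))"
proof -
  have [measurable]: "{z. c \<le> n \<bullet> z \<and> n \<bullet> z \<le> c + 1} \<in> sets (borel :: (real^'n) measure)" by measurable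
  have m[measurable]: "(\<lambda>z. z - (n \<bullet> z - c) *\<^sub>R n) \<in> restrict_space lborel {z. c \<le> n \<bullet> z \<and> n \<bullet> z \<le> c + 1} \<rightarrow>\<^sub>M borel"
    by (rule measurable_restrict_space1) measurable
  show "integral\<^sup>L (hyperplane_measure n c) f =
    (\<integral>z. indicator {z. c \<le> n \<bullet> z \<and> n \<bullet> z \<le> c + 1} z * f (z - (n \<bullet> z - c) *\<^sub>R n) \<partial>lborel)"
    unfolding hyperplane_measure_def
    by (subst integral_distr[OF m f]) (simp add: integral_restrict_space)
  show "integrable (hyperplane_measure n c) f \<longleftrightarrow>
    integrable lborel (\<lambda>z. indicator {z. c \<le> n \<bullet> z \<and> n \<bullet> z \<le> c + 1} z * f (z - (n \<bullet> z - c) *\<^sub>R n))"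
    unfolding hyperplane_measure_def
    by (subst integrable_distr_eq[OF m f]) (simp add: integrable_restrict_space)
qed

lemma lborel_hyperplane_null:
  fixes a :: "'a::euclidean_space"
  assumes "a \<noteq> 0 \<or> b \<noteq> 0"
  shows "AE x in lborel. a \<bullet> x \<noteq> b"
proof -
  have "{x. a \<bullet> x = b} \<in> null_sets lebesgue"
    using negligible_hyperplane[OF assms] by (simp add: negligible_iff_null_sets)
  then have "{x. a \<bullet> x = b} \<in> null_sets lborel"
    by (simp add: null_sets_completion_iff)
  then show ?thesis by (rule AE_I'[of _ lborel]) auto
qed

definition clamp01 :: "real \<Rightarrow> real" where
  "clamp01 t = max 0 (min 1 t)"

lemma clamp01_bounds: "0 \<le> clamp01 t" "clamp01 t \<le> 1"
  by (auto simp: clamp01_def)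

lemma clamp01_measurable[measurable]: "clamp01 \<in> borel_measurable borel"
  unfolding clamp01_def[abs_def] by measurable

lemma clamp01_lipschitz: "\<bar>clamp01 s - clamp01 t\<bar> \<le> \<bar>s - t\<bar>"
  by (auto simp: clamp01_def max_def min_def)

text \<open>The half-open condition is chosen for the later substitution
  \<open>s = N * (c - n \<bullet> x)\<close>, which turns it into the layer
  \<open>c - 1 / N \<le> n \<bullet> x < c\<close> of \<open>fold_slab_integral\<close>. The two
  kinks are null hyperplanes there.\<close>

lemma clamp01_deriv:
  assumes "s \<noteq> 0" "s \<noteq> 1"
  shows "(clamp01 has_real_derivative (if 0 < s \<and> s \<le> 1 then 1 else 0)) (at s)"
proof -
  consider "s < 0" | "0 < s" "s < 1" | "1 < s" using assms by linarith
  then show ?thesis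
  proof cases
    case 1
    have "((\<lambda>_. 0) has_real_derivative 0) (at s)" by simp
    then have "(clamp01 has_real_derivative 0) (at s)"
      by (rule has_field_derivative_transform_within_open[where S="{..<0}"]) (use 1 in \<open>auto simp: clamp01_def\<close>)
    then show ?thesis using 1 by simp
  next
    case 2
    have "((\<lambda>t. t) has_real_derivative 1) (at s)" by simp
    then have "(clamp01 has_real_derivative 1) (at s)"
      by (rule has_field_derivative_transform_within_open[where S="{0<..<1}"]) (use 2 in \<open>auto simp: clamp01_def\<close>)
    then show ?thesis using 2 by simp
  next
    case 3
    have "((\<lambda>_. 1) has_real_derivative 0) (at s)" by simp
    then have "(clamp01 has_real_derivative 0) (at s)"
      by (rule has_field_derivative_transform_within_open[where S="{1<..}"]) (use 3 in \<open>auto simp: clamp01_def\<close>)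
    then show ?thesis using 3 by simp
  qed
qed

text \<open>Replace the factors one at a time: the factors left in place lie between 0 and 1 and
  only shrink the difference.\<close>

lemma prod_bounded_lipschitz:
  fixes f g :: "'i \<Rightarrow> real"
  assumes "finite I" "\<And>i. i \<in> I \<Longrightarrow> 0 \<le> f i \<and> f i \<le> 1" "\<And>i. i \<in> I \<Longrightarrow> 0 \<le> g i \<and> g i \<le> 1"
  shows "\<bar>prod f I - prod g I\<bar> \<le> (\<Sum>i\<in>I. \<bar>f i - g i\<bar>)"
  using assms
proof (induction I)
  case empty
  then show ?case by simp
next
  case (insert a I)
  have "prod f I \<le> 1" "0 \<le> prod f I" using insert by (auto intro: prod_le_1 prod_nonneg)
  have "f a * prod f I - g a * prod g I = (f a - g a) * prod f I + g a * (prod f I - prod g I)"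
    by (simp add: algebra_simps)
  then have "\<bar>f a * prod f I - g a * prod g I\<bar> \<le> \<bar>(f a - g a) * prod f I\<bar> + \<bar>g a * (prod f I - prod g I)\<bar>"
    by (metis abs_triangle_ineq)
  also have "\<dots> \<le> \<bar>f a - g a\<bar> + \<bar>prod f I - prod g I\<bar>"
    unfolding abs_mult
    by (intro add_mono mult_right_le_one_le mult_left_le_one_le) (use insert \<open>prod f I \<le> 1\<close> \<open>0 \<le> prod f I\<close> in auto)
  also have "\<dots> \<le> \<bar>f a - g a\<bar> + (\<Sum>i\<in>I. \<bar>f i - g i\<bar>)" using insert by simp
  finally show ?case using insert by simp
qed


text \<open>Rounding the height to the next multiple of \<open>1 / N\<close> costs at most
  \<open>1 / N\<close>, so the folded points approach the orthogonal projection onto the hyperplane,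
  which is the map used in \<open>hyperplane_measure\<close>.\<close>

lemma fold_point_tendsto:
  fixes z n :: "'a::real_inner"
  assumes n: "norm n = 1"
  shows "(\<lambda>N. z - ((of_int \<lfloor>real (Suc N) * (n \<bullet> z - c)\<rfloor> + 1) / real (Suc N)) *\<^sub>R n) \<longlonglongrightarrow> z - (n \<bullet> z - c) *\<^sub>R n"
proof -
  define s where "s = n \<bullet> z - c"
  have "(\<lambda>N. (of_int \<lfloor>real (Suc N) * s\<rfloor> + 1) / real (Suc N) - s) \<longlonglongrightarrow> 0"
  proof (rule Lim_null_comparison)
    show "\<forall>\<^sub>F N in sequentially. norm ((of_int \<lfloor>real (Suc N) * s\<rfloor> + 1) / real (Suc N) - s) \<le> inverse (real (Suc N))"
    proof (rule always_eventually, rule allI)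
      fix N
      define m where "m = real (Suc N)"
      have m: "m > 0" by (simp add: m_def)
      have "(of_int \<lfloor>m * s\<rfloor> + 1) / m - s = (of_int \<lfloor>m * s\<rfloor> + 1 - m * s) / m" using m by (simp add: field_simps)
      moreover have "0 \<le> of_int \<lfloor>m * s\<rfloor> + 1 - m * s" "of_int \<lfloor>m * s\<rfloor> + 1 - m * s \<le> 1" by linarith+
      ultimately have "\<bar>(of_int \<lfloor>m * s\<rfloor> + 1) / m - s\<bar> \<le> inverse m"
        using m by (simp add: field_simps)
      then show "norm ((of_int \<lfloor>real (Suc N) * s\<rfloor> + 1) / real (Suc N) - s) \<le> inverse (real (Suc N))"
        by (simp add: m_def)
    qed
    show "(\<lambda>N. inverse (real (Suc N))) \<longlonglongrightarrow> 0" by (rule LIMSEQ_inverse_real_of_nat)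
  qed
  then have "(\<lambda>N. (of_int \<lfloor>real (Suc N) * s\<rfloor> + 1) / real (Suc N)) \<longlonglongrightarrow> s"
    by (rule LIM_zero_cancel)
  then show ?thesis unfolding s_def[symmetric] by (intro tendsto_intros)
qed

text \<open>Adding one to the floor makes the shift exceed the height. Thus folded points satisfy
  the constraint of their own facet strictly, and only the other constraints need a limit
  argument.\<close>

lemma fold_point_below:
  fixes z n :: "'a::real_inner"
  assumes n: "norm n = 1"
  shows "n \<bullet> (z - ((of_int \<lfloor>real (Suc N) * (n \<bullet> z - c)\<rfloor> + 1) / real (Suc N)) *\<^sub>R n) < c"
proof -
  define m where "m = real (Suc N)"
  have m: "m > 0" by (simp add: m_def)
  have "m * (n \<bullet> z - c) < of_int \<lfloor>m * (n \<bullet> z - c)\<rfloor> + 1" by linarith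
  then have "n \<bullet> z - c < (of_int \<lfloor>m * (n \<bullet> z - c)\<rfloor> + 1) / m" using m by (simp add: field_simps)
  moreover have "n \<bullet> n = 1" using n by (simp add: norm_eq_1)
  ultimately show ?thesis unfolding m_def[symmetric] by (simp add: inner_diff_right)
qed

text \<open>The component of \<open>m\<close> orthogonal to \<open>n\<close> gives a null hyperplane
  of exceptional \<open>z\<close>. It is zero only for \<open>m = - n\<close>, and then the
  projected value is constantly \<open>- c\<close>. This makes the edges of a facet
  negligible.\<close>

lemma AE_projection_off_hyperplane:
  fixes n m :: "'a::euclidean_space"
  assumes n: "norm n = 1" and m: "norm m = 1" and ne: "m \<noteq> n" and opp: "m = - n \<Longrightarrow> d \<noteq> - c"
  shows "AE z in lborel. m \<bullet> (z - (n \<bullet> z - c) *\<^sub>R n) \<noteq> d"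
proof -
  define a where "a = m - (m \<bullet> n) *\<^sub>R n"
  have eq: "m \<bullet> (z - (n \<bullet> z - c) *\<^sub>R n) = a \<bullet> z + c * (m \<bullet> n)" for z
    by (simp add: a_def inner_diff_left inner_diff_right algebra_simps)
  show ?thesis
  proof (cases "a = 0")
    case True
    then have mn: "m = (m \<bullet> n) *\<^sub>R n" by (simp add: a_def)
    then have "norm m = \<bar>m \<bullet> n\<bar> * norm n" by (metis norm_scaleR)
    then have "\<bar>m \<bullet> n\<bar> = 1" using n m by simp
    then have "m \<bullet> n = 1 \<or> m \<bullet> n = -1" by linarith
    then have mn': "m = - n" "m \<bullet> n = -1" using mn ne by auto
    show ?thesis unfolding eq mn'(2) using opp[OF mn'(1)] True by simp
  next
    case False
    show ?thesis unfolding eq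
      using lborel_hyperplane_null[of a "d - c * (m \<bullet> n)"] False
      by (simp add: algebra_simps)
  qed
qed

text \<open>The product \<open>\<theta> N\<close> of the clamped rescaled distances to the bounding hyperplanes is a Lipschitz cutoff that
  vanishes off \<open>K\<close>.  The integral of the derivative of \<open>\<theta> N * g\<close> is zero; as \<open>N\<close> grows, the derivative of
  the \<open>i\<close>-th factor concentrates on the \<open>i\<close>-th facet.\<close>
lemma divergence_lipschitz:
  fixes n :: "'i \<Rightarrow> real^'n" and c :: "'i \<Rightarrow> real" and g D :: "real^'n \<Rightarrow> real"
  assumes I: "finite I" and n: "\<And>i. i \<in> I \<Longrightarrow> norm (n i) = 1"
    and dist: "\<And>i j. i \<in> I \<Longrightarrow> j \<in> I \<Longrightarrow> i \<noteq> j \<Longrightarrow> n i \<noteq> n j"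
    and opp: "\<And>i j. i \<in> I \<Longrightarrow> j \<in> I \<Longrightarrow> n j = - n i \<Longrightarrow> c j \<noteq> - c i"
    and K: "K = {x. \<forall>i\<in>I. n i \<bullet> x \<le> c i}" and bdd: "bounded K"
    and g: "L-lipschitz_on K g"
    and deriv: "\<And>x. x \<in> interior K \<Longrightarrow> ((\<lambda>t. g (x + t *\<^sub>R e)) has_real_derivative D x) (at 0)"
    and D[measurable]: "D \<in> borel_measurable borel" and DM: "\<And>x. x \<in> K \<Longrightarrow> \<bar>D x\<bar> \<le> M"
  shows "(\<integral>x. indicator K x * D x \<partial>lborel) =
    (\<Sum>i\<in>I. (n i \<bullet> e) * (\<integral>x. indicator (K \<inter> {x. n i \<bullet> x = c i}) x * g x \<partial>hyperplane_measure (n i) (c i)))"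
proof -
  have closedK: "closed K"
  proof -
    have "K = (\<Inter>i\<in>I. {x. n i \<bullet> x \<le> c i})" using K by auto
    then show ?thesis by (auto intro: closed_halfspace_le)
  qed
  then have compK: "compact K" using bdd by (simp add: compact_eq_bounded_closed)
  have [measurable]: "K \<in> sets borel" using closedK by simp
  have contg: "continuous_on K g" using g by (rule lipschitz_on_continuous_on)
  define g0 where "g0 x = indicator K x * g x" for x
  have g0m[measurable]: "g0 \<in> borel_measurable borel"
    using borel_measurable_continuous_on_indicator[OF _ contg] unfolding g0_def[abs_def] by simp
  obtain G where G: "0 \<le> G" "\<And>x. x \<in> K \<Longrightarrow> \<bar>g x\<bar> \<le> G"
  proof -
    have "bounded (g ` K)" using compact_continuous_image[OF contg compK] compact_imp_bounded by blast
    then obtain G where "\<And>x. x \<in> K \<Longrightarrow> norm (g x) \<le> G" by (auto simp: bounded_iff)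
    then show ?thesis using that[of "\<bar>G\<bar>"] by force
  qed
  have g0G: "\<bar>g0 x\<bar> \<le> G" for x using G by (auto simp: g0_def indicator_def)
  define cl where "cl N i x = clamp01 (real (Suc N) * (c i - n i \<bullet> x))" for N :: nat and i x
  have [measurable]: "cl N i \<in> borel_measurable borel" for N i unfolding cl_def[abs_def] by measurable
  define \<theta> where "\<theta> N x = (\<Prod>i\<in>I. cl N i x)" for N x
  have \<theta>m[measurable]: "\<theta> N \<in> borel_measurable borel" for N unfolding \<theta>_def[abs_def] by measurable
  have cl01: "0 \<le> cl N i x" "cl N i x \<le> 1" for N i x by (simp_all add: cl_def clamp01_bounds)
  have \<theta>01: "0 \<le> \<theta> N x" "\<theta> N x \<le> 1" for N x unfolding \<theta>_def using cl01 by (auto intro: prod_nonneg prod_le_1)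
  have \<theta>0: "\<theta> N x = 0" if "x \<notin> K" for N x
  proof -
    have "\<exists>i\<in>I. n i \<bullet> x > c i" using that K by (auto simp: not_le)
    then obtain i where i: "i \<in> I" "n i \<bullet> x > c i" by blast
    then have "real (Suc N) * (c i - n i \<bullet> x) \<le> 0" by (simp add: mult_le_0_iff)
    then have "cl N i x = 0" by (simp add: cl_def clamp01_def)
    then show ?thesis using i I by (auto simp: \<theta>_def)
  qed
  define \<rho> where "\<rho> N i x = (indicator {x. c i - 1 / real (Suc N) \<le> n i \<bullet> x \<and> n i \<bullet> x < c i} x :: real)" for N :: nat and i x
  have \<rho>m[measurable]: "\<rho> N i \<in> borel_measurable borel" for N i unfolding \<rho>_def[abs_def] by measurable
  \<comment> \<open>What multiplies the derivative of the \<open>i\<close>-th clamp in the product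
    rule for \<open>\<theta> N * g\<close>.\<close>
  define q where "q N i x = g0 x * (\<Prod>j\<in>I-{i}. cl N j x)" for N i x
  have qm[measurable]: "q N i \<in> borel_measurable borel" for N i unfolding q_def[abs_def] by measurable
  have prodle: "\<bar>\<Prod>j\<in>J. cl N j x\<bar> \<le> 1" for J N x
    by (simp add: abs_prod cl01 prod_le_1)
  have qG: "\<bar>q N i x\<bar> \<le> G" for N i x
    unfolding q_def abs_mult using mult_mono[OF g0G prodle] G(1) by simp
  have q0: "q N i x = 0" if "x \<notin> K" for N i x using that by (simp add: q_def g0_def)
  obtain R where "\<forall>x\<in>K. norm x \<le> R" using bdd bounded_iff by blast
  then have R: "K \<subseteq> cball 0 R" by auto
  have intK: "integrable lborel f" if m: "f \<in> borel_measurable borel" and b: "\<And>x. \<bar>f x\<bar> \<le> B * indicator K x" for f :: "real^'n \<Rightarrow> real" and B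
  proof (rule Bochner_Integration.integrable_bound[where f="\<lambda>x. indicator K x *\<^sub>R B"])
    show "integrable lborel (\<lambda>x. indicator K x *\<^sub>R B)" by (rule borel_integrable_compact[OF compK]) auto
    show "f \<in> borel_measurable lborel" using m by simp
    show "AE x in lborel. norm (f x) \<le> norm (indicator K x *\<^sub>R B)"
    proof (rule AE_I2)
      fix x
      have "B * indicator K x \<le> \<bar>indicator K x * B\<bar>" by (simp add: mult.commute)
      then show "norm (f x) \<le> norm (indicator K x *\<^sub>R B)" using b[of x] by simp
    qed
  qed
  have intq: "integrable lborel (q N i)" for N i
    by (rule intK[where B=G]) (auto simp: indicator_def qG q0)
  have ident: "(\<integral>x. indicator K x * (\<theta> N x * D x) \<partial>lborel) = (\<Sum>i\<in>I. (n i \<bullet> e) * (real (Suc N) * (\<integral>x. \<rho> N i x * q N i x \<partial>lborel)))" for N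
  proof -
    define H where "H x = \<theta> N x * g0 x" for x
    define H' where "H' x = indicator K x * (\<theta> N x * D x) - (\<Sum>i\<in>I. (n i \<bullet> e) * (real (Suc N) * (\<rho> N i x * q N i x)))" for x
    have \<theta>lip: "\<bar>\<theta> N x - \<theta> N y\<bar> \<le> real (card I) * real (Suc N) * dist x y" for x y
    proof -
      have "\<bar>\<theta> N x - \<theta> N y\<bar> \<le> (\<Sum>i\<in>I. \<bar>cl N i x - cl N i y\<bar>)"
        unfolding \<theta>_def by (rule prod_bounded_lipschitz[OF I]) (simp_all add: cl01)
      also have "\<dots> \<le> (\<Sum>i\<in>I. real (Suc N) * dist x y)"
      proof (rule sum_mono)
        fix i assume i: "i \<in> I"
        have "\<bar>cl N i x - cl N i y\<bar> \<le> \<bar>real (Suc N) * (c i - n i \<bullet> x) - real (Suc N) * (c i - n i \<bullet> y)\<bar>"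
          unfolding cl_def by (rule clamp01_lipschitz)
        also have "\<dots> = real (Suc N) * \<bar>n i \<bullet> (y - x)\<bar>"
          by (simp add: inner_diff_right abs_mult right_diff_distrib[symmetric] del: of_nat_Suc)
        also have "\<dots> \<le> real (Suc N) * (norm (n i) * norm (y - x))"
          by (intro mult_left_mono Cauchy_Schwarz_ineq2) simp
        also have "\<dots> = real (Suc N) * dist x y" using n[OF i] by (simp add: dist_norm norm_minus_commute)
        finally show "\<bar>cl N i x - cl N i y\<bar> \<le> real (Suc N) * dist x y" .
      qed
      also have "\<dots> = real (card I) * real (Suc N) * dist x y" by simp
      finally show ?thesis .
    qed
    define A where "A = real (card I) * real (Suc N)"
    have A0: "0 \<le> A" by (simp add: A_def)
    have L0: "0 \<le> L" using g by (rule lipschitz_on_nonneg)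
    have lipH: "(A * G + L)-lipschitz_on UNIV H"
    proof (rule lipschitz_onI)
      have one: "\<bar>H x - H y\<bar> \<le> (A * G + L) * dist x y" if "x \<in> K" for x y
      proof (cases "y \<in> K")
        case True
        have "H x - H y = (\<theta> N x - \<theta> N y) * g x + \<theta> N y * (g x - g y)"
          using that True by (simp add: H_def g0_def algebra_simps)
        then have "\<bar>H x - H y\<bar> \<le> \<bar>\<theta> N x - \<theta> N y\<bar> * \<bar>g x\<bar> + \<bar>\<theta> N y\<bar> * \<bar>g x - g y\<bar>"
          by (metis abs_triangle_ineq abs_mult)
        also have "\<dots> \<le> (A * dist x y) * G + 1 * (L * dist x y)"
          using \<theta>lip[of x y] G(2)[OF that] lipschitz_onD[OF g that True] \<theta>01 A0
          by (intro add_mono mult_mono) (auto simp: A_def dist_real_def)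
        finally show ?thesis by (simp add: algebra_simps)
      next
        \<comment> \<open>\<open>g0\<close> may jump across the boundary of \<open>K\<close>, but
          the cutoff is already zero at \<open>y\<close>, so the difference of cutoffs alone
          controls \<open>H\<close>.\<close>
        case False
        have "\<bar>H x - H y\<bar> = \<bar>\<theta> N x - \<theta> N y\<bar> * \<bar>g x\<bar>"
          using that False \<theta>0[OF False] by (simp add: H_def g0_def abs_mult)
        also have "\<dots> \<le> (A * dist x y) * G"
          using \<theta>lip[of x y] G(2)[OF that] A0 by (intro mult_mono) (auto simp: A_def)
        also have "\<dots> \<le> (A * G + L) * dist x y" using L0 by (simp add: algebra_simps)
        finally show ?thesis .
      qed
      fix x y
      show "dist (H x) (H y) \<le> (A * G + L) * dist x y"
      proof (cases "x \<in> K \<or> y \<in> K")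
        case True
        then show ?thesis using one[of x y] one[of y x] by (auto simp: dist_real_def abs_minus_commute dist_commute)
      next
        case False
        then show ?thesis using \<theta>0 A0 G(1) L0 by (simp add: H_def)
      qed
    qed (use A0 G(1) L0 in simp)
    have "(\<integral>x. H' x \<partial>lborel) = 0"
    proof (rule integral_directional_derivative_eq_0[OF lipH])
      show "H x = 0" if "x \<notin> cball 0 R" for x
      proof -
        have "x \<notin> K" using that R by blast
        then show ?thesis using \<theta>0 by (simp add: H_def)
      qed
      show "H' \<in> borel_measurable borel" unfolding H'_def[abs_def] by measurable
      \<comment> \<open>The kinks of the clamps lie on these hyperplanes, the two faces of each
        layer.\<close>
      have "AE x in lborel. \<forall>i\<in>I. n i \<bullet> x \<noteq> c i \<and> n i \<bullet> x \<noteq> c i - 1 / real (Suc N)"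
      proof (rule AE_finite_allI[OF I])
        fix i assume i: "i \<in> I"
        have "n i \<noteq> 0" using n[OF i] by auto
        then have "AE x in lborel. n i \<bullet> x \<noteq> c i" "AE x in lborel. n i \<bullet> x \<noteq> c i - 1 / real (Suc N)"
          by (auto intro: lborel_hyperplane_null)
        then show "AE x in lborel. n i \<bullet> x \<noteq> c i \<and> n i \<bullet> x \<noteq> c i - 1 / real (Suc N)" by eventually_elim simp
      qed
      then show "AE x in lborel. ((\<lambda>t. H (x + t *\<^sub>R e)) has_real_derivative H' x) (at 0)"
      proof eventually_elim
        case (elim x)
        show ?case
        proof (cases "x \<in> K")
          case True
          have "open (\<Inter>i\<in>I. {x. n i \<bullet> x < c i})" using I by (auto intro: open_halfspace_lt)
          moreover have "(\<Inter>i\<in>I. {x. n i \<bullet> x < c i}) \<subseteq> K" using K by (auto intro: less_imp_le)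
          moreover have "x \<in> (\<Inter>i\<in>I. {x. n i \<bullet> x < c i})" using True elim K by (auto simp: less_le)
          ultimately have xi: "x \<in> interior K" by (meson interiorI)
          have dcl: "((\<lambda>t. cl N i (x + t *\<^sub>R e)) has_real_derivative - ((n i \<bullet> e) * (real (Suc N) * \<rho> N i x))) (at 0)" if i: "i \<in> I" for i
          proof -
            define s where "s = real (Suc N) * (c i - n i \<bullet> x)"
            have "n i \<bullet> x < c i" using True elim i K by (auto simp: less_le)
            have "s \<noteq> 1" using elim i by (auto simp: s_def field_simps)
            have "s > 0" using \<open>n i \<bullet> x < c i\<close> by (simp add: s_def)
            have "(if 0 < s \<and> s \<le> 1 then 1 else 0) = \<rho> N i x"
              using \<open>s > 0\<close> \<open>n i \<bullet> x < c i\<close> by (simp add: \<rho>_def indicator_def s_def field_simps)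
            then have c: "(clamp01 has_real_derivative \<rho> N i x) (at s)"
              using clamp01_deriv[of s] \<open>s > 0\<close> \<open>s \<noteq> 1\<close> by simp
            have l: "((\<lambda>t. real (Suc N) * (c i - n i \<bullet> (x + t *\<^sub>R e))) has_real_derivative (- (real (Suc N) * (n i \<bullet> e)))) (at 0)"
              unfolding inner_add_right inner_scaleR_right by (auto intro!: derivative_eq_intros)
            show ?thesis
              unfolding cl_def
              using DERIV_chain2[where f=clamp01 and g="\<lambda>t. real (Suc N) * (c i - n i \<bullet> (x + t *\<^sub>R e))" and x=0 and s=UNIV, OF _ l, of "\<rho> N i x"] c
              by (simp add: s_def algebra_simps)
          qed
          have dth: "((\<lambda>t. \<theta> N (x + t *\<^sub>R e)) has_real_derivative (\<Sum>i\<in>I. - ((n i \<bullet> e) * (real (Suc N) * \<rho> N i x)) * (\<Prod>j\<in>I-{i}. cl N j x))) (at 0)"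
          proof -
            show ?thesis unfolding \<theta>_def
              using has_field_derivative_prod[where A=I and f="\<lambda>i t. cl N i (x + t *\<^sub>R e)", OF dcl] by simp
          qed
          have "((\<lambda>t. \<theta> N (x + t *\<^sub>R e) * g (x + t *\<^sub>R e)) has_real_derivative
             (\<Sum>i\<in>I. - ((n i \<bullet> e) * (real (Suc N) * \<rho> N i x)) * (\<Prod>j\<in>I-{i}. cl N j x)) * g (x + 0 *\<^sub>R e) + D x * \<theta> N (x + 0 *\<^sub>R e)) (at 0)"
            by (rule DERIV_mult[OF dth deriv[OF xi]])
          also have "(\<Sum>i\<in>I. - ((n i \<bullet> e) * (real (Suc N) * \<rho> N i x)) * (\<Prod>j\<in>I-{i}. cl N j x)) * g (x + 0 *\<^sub>R e) + D x * \<theta> N (x + 0 *\<^sub>R e) = H' x"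
            using True by (simp add: H'_def q_def g0_def sum_distrib_right flip: sum_negf) (rule sum.cong, simp_all add: algebra_simps)
          finally have d: "((\<lambda>t. \<theta> N (x + t *\<^sub>R e) * g (x + t *\<^sub>R e)) has_real_derivative H' x) (at 0)" .
          have op: "open ((\<lambda>t. x + t *\<^sub>R e) -` interior K)"
            by (rule open_vimage) (auto intro!: continuous_intros)
          show ?thesis
            by (rule has_field_derivative_transform_within_open[OF d op])
               (use xi interior_subset[of K] in \<open>auto simp: H_def g0_def\<close>)
        next
          case False
          have op: "open ((\<lambda>t. x + t *\<^sub>R e) -` (- K))"
            by (rule open_vimage) (use closedK in \<open>auto intro!: continuous_intros\<close>)
          have "((\<lambda>t. 0) has_real_derivative 0) (at (0::real))" by simp
          then have "((\<lambda>t. H (x + t *\<^sub>R e)) has_real_derivative 0) (at 0)"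
            by (rule has_field_derivative_transform_within_open[OF _ op])
               (use False \<theta>0 in \<open>auto simp: H_def\<close>)
          moreover have "H' x = 0" using False by (simp add: H'_def q0)
          ultimately show ?thesis by simp
        qed
      qed
    qed
    moreover have "(\<integral>x. H' x \<partial>lborel) = (\<integral>x. indicator K x * (\<theta> N x * D x) \<partial>lborel) - (\<Sum>i\<in>I. (n i \<bullet> e) * (real (Suc N) * (\<integral>x. \<rho> N i x * q N i x \<partial>lborel)))"
    proof -
      have i1: "integrable lborel (\<lambda>x. indicator K x * (\<theta> N x * D x))"
      proof (rule intK[where B=M])
        fix x show "\<bar>indicator K x * (\<theta> N x * D x)\<bar> \<le> M * indicator K x"
          using mult_mono[OF \<theta>01(2)[of N x] DM[of x]] \<theta>01[of N x] by (auto simp: indicator_def abs_mult)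
      qed measurable
      have i2: "integrable lborel (\<lambda>x. \<rho> N i x * q N i x)" for i
        by (rule intK[where B=G]) (use qG q0 G(1) in \<open>auto simp: indicator_def \<rho>_def\<close>)
      show ?thesis unfolding H'_def using i1 i2 by simp
    qed
    ultimately show ?thesis by simp
  qed
  have lim1: "(\<lambda>N. \<integral>x. indicator K x * (\<theta> N x * D x) \<partial>lborel) \<longlonglongrightarrow> (\<integral>x. indicator K x * D x \<partial>lborel)"
  proof (rule integral_dominated_convergence[where w="\<lambda>x. indicator K x *\<^sub>R M"])
    show "integrable lborel (\<lambda>x. indicator K x *\<^sub>R M)" by (rule borel_integrable_compact[OF compK]) auto
    show "AE x in lborel. (\<lambda>N. indicator K x * (\<theta> N x * D x)) \<longlonglongrightarrow> indicator K x * D x"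
    proof -
      have "AE x in lborel. \<forall>i\<in>I. n i \<bullet> x \<noteq> c i"
      proof (rule AE_finite_allI[OF I])
        fix i assume i: "i \<in> I"
        have "n i \<noteq> 0" using n[OF i] by auto
        then show "AE x in lborel. n i \<bullet> x \<noteq> c i" by (auto intro: lborel_hyperplane_null)
      qed
      then show ?thesis
      proof eventually_elim
        case (elim x)
        show ?case
        proof (cases "x \<in> K")
          case True
          have "(\<lambda>N. cl N i x) \<longlonglongrightarrow> 1" if i: "i \<in> I" for i
          proof (rule tendsto_eventually)
            have "c i - n i \<bullet> x > 0" using elim True K i by (auto simp: less_le)
            then have "\<forall>\<^sub>F N in sequentially. inverse (real (Suc N)) < c i - n i \<bullet> x"
              using order_tendstoD(2)[OF LIMSEQ_inverse_real_of_nat] by blast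
            then show "\<forall>\<^sub>F N in sequentially. cl N i x = 1"
            proof eventually_elim
              case (elim N)
              then have "1 < real (Suc N) * (c i - n i \<bullet> x)" by (simp add: field_simps)
              then show ?case by (simp add: cl_def clamp01_def)
            qed
          qed
          then have "(\<lambda>N. \<theta> N x) \<longlonglongrightarrow> (\<Prod>i\<in>I. 1)" unfolding \<theta>_def by (rule tendsto_prod)
          then have "(\<lambda>N. \<theta> N x) \<longlonglongrightarrow> 1" by simp
          then have "(\<lambda>N. indicator K x * (\<theta> N x * D x)) \<longlonglongrightarrow> indicator K x * (1 * D x)"
            by (intro tendsto_mult tendsto_const)
          then show ?thesis by simp
        qed simp
      qed
    qed
    show "AE x in lborel. norm (indicator K x * (\<theta> N x * D x)) \<le> indicator K x *\<^sub>R M" for N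
    proof (rule AE_I2)
      fix x show "norm (indicator K x * (\<theta> N x * D x)) \<le> indicator K x *\<^sub>R M"
        using mult_mono[OF \<theta>01(2)[of N x] DM[of x]] \<theta>01[of N x] by (auto simp: indicator_def abs_mult)
    qed
  qed measurable
  have lim2: "(\<lambda>N. real (Suc N) * (\<integral>x. \<rho> N i x * q N i x \<partial>lborel)) \<longlonglongrightarrow>
      (\<integral>x. indicator (K \<inter> {x. n i \<bullet> x = c i}) x * g x \<partial>hyperplane_measure (n i) (c i))" if i: "i \<in> I" for i
  proof -
    define S where "S = {z. c i \<le> n i \<bullet> z \<and> n i \<bullet> z < c i + 1}"
    define \<phi> where "\<phi> N z = z - ((of_int \<lfloor>real (Suc N) * (n i \<bullet> z - c i)\<rfloor> + 1) / real (Suc N)) *\<^sub>R n i" for N :: nat and z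
    define \<pi> where "\<pi> z = z - (n i \<bullet> z - c i) *\<^sub>R n i" for z
    define F where "F = K \<inter> {x. n i \<bullet> x = c i}"
    have [measurable]: "S \<in> sets borel" unfolding S_def by measurable
    have [measurable]: "\<phi> N \<in> borel_measurable borel" for N unfolding \<phi>_def[abs_def] by measurable
    have [measurable]: "\<pi> \<in> borel_measurable borel" unfolding \<pi>_def[abs_def] by measurable
    have nn: "n i \<bullet> n i = 1" using n[OF i] by (simp add: norm_eq_1)
    have \<pi>n: "n i \<bullet> \<pi> z = c i" for z by (simp add: \<pi>_def inner_diff_right nn)
    have fold: "real (Suc N) * (\<integral>x. \<rho> N i x * q N i x \<partial>lborel) = (\<integral>z. indicator S z * q N i (\<phi> N z) \<partial>lborel)" for N
      using fold_slab_integral[OF n[OF i] _ intq[of N i], of "Suc N" "c i"] by (simp add: \<rho>_def S_def \<phi>_def)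
    have F: "(\<lambda>x. indicator F x * g x) = (\<lambda>x. indicator {x. n i \<bullet> x = c i} x * g0 x)"
      by (auto simp: F_def g0_def indicator_def fun_eq_iff)
    have Fm: "(\<lambda>x. indicator F x * g x) \<in> borel_measurable borel"
      unfolding F by measurable
    have rhs: "(\<integral>x. indicator F x * g x \<partial>hyperplane_measure (n i) (c i)) = (\<integral>z. indicator S z * g0 (\<pi> z) \<partial>lborel)"
    proof -
      have "(\<integral>x. indicator F x * g x \<partial>hyperplane_measure (n i) (c i)) =
        (\<integral>z. indicator {z. c i \<le> n i \<bullet> z \<and> n i \<bullet> z \<le> c i + 1} z * (indicator F (\<pi> z) * g (\<pi> z)) \<partial>lborel)"
        unfolding \<pi>_def by (rule hyperplane_measure_integral(1)[OF Fm])
      \<comment> \<open>\<open>hyperplane_measure\<close> uses the closed slab and the folding the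
        half-open one; they differ by a null hyperplane.\<close>
      also have "\<dots> = (\<integral>z. indicator S z * g0 (\<pi> z) \<partial>lborel)"
      proof (rule integral_cong_AE)
        have "(\<lambda>z. indicator F (\<pi> z) * g (\<pi> z)) \<in> borel_measurable borel"
          using measurable_compose[OF _ Fm, of \<pi>] by simp
        then show "(\<lambda>z. indicator {z. c i \<le> n i \<bullet> z \<and> n i \<bullet> z \<le> c i + 1} z * (indicator F (\<pi> z) * g (\<pi> z))) \<in> borel_measurable lborel"
          by simp
        show "(\<lambda>z. indicator S z * g0 (\<pi> z)) \<in> borel_measurable lborel" by measurable
        have "n i \<noteq> 0" using n[OF i] by auto
        then have "AE z in lborel. n i \<bullet> z \<noteq> c i + 1" by (auto intro: lborel_hyperplane_null)
        then show "AE z in lborel. indicator {z. c i \<le> n i \<bullet> z \<and> n i \<bullet> z \<le> c i + 1} z * (indicator F (\<pi> z) * g (\<pi> z)) = indicator S z * g0 (\<pi> z)"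
          by eventually_elim (auto simp: S_def F_def g0_def indicator_def \<pi>n)
      qed
      finally show ?thesis .
    qed
    have "(\<lambda>N. \<integral>z. indicator S z * q N i (\<phi> N z) \<partial>lborel) \<longlonglongrightarrow> (\<integral>z. indicator S z * g0 (\<pi> z) \<partial>lborel)"
    \<comment> \<open>Folding moves a point of the slab by at most 2, so a point outside the ball of
      radius \<open>R + 3\<close> is not carried into \<open>K\<close>.\<close>
    proof (rule integral_dominated_convergence[where w="\<lambda>x. indicator (cball 0 (R + 3)) x *\<^sub>R G"])
      show "integrable lborel (\<lambda>x. indicator (cball 0 (R + 3) :: (real^'n) set) x *\<^sub>R G)" by (rule borel_integrable_compact) auto
      show "(\<lambda>z. indicator S z * g0 (\<pi> z)) \<in> borel_measurable lborel" by measurable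
      show "(\<lambda>z. indicator S z * q N i (\<phi> N z)) \<in> borel_measurable lborel" for N by measurable
      show "AE z in lborel. norm (indicator S z * q N i (\<phi> N z)) \<le> indicator (cball 0 (R + 3)) z *\<^sub>R G" for N
      proof (rule AE_I2)
        fix z
        show "norm (indicator S z * q N i (\<phi> N z)) \<le> indicator (cball 0 (R + 3)) z *\<^sub>R G"
        proof (cases "z \<in> S \<and> \<phi> N z \<in> K")
          case True
          define m where "m = real (Suc N)"
          define s where "s = n i \<bullet> z - c i"
          have m: "m \<ge> 1" by (simp add: m_def)
          have s: "0 \<le> s" "s < 1" using True by (auto simp: S_def s_def)
          have "of_int \<lfloor>m * s\<rfloor> \<le> m * s" by linarith
          also have "m * s \<le> m" using s m by (simp add: mult_left_le)
          finally have "of_int \<lfloor>m * s\<rfloor> + 1 \<le> 2 * m" using m by linarith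
          then have "(of_int \<lfloor>m * s\<rfloor> + 1) / m \<le> 2" using m by (simp add: field_simps)
          moreover have "0 \<le> (of_int \<lfloor>m * s\<rfloor> + 1) / m" using m s by simp
          ultimately have "\<bar>(of_int \<lfloor>m * s\<rfloor> + 1) / m\<bar> \<le> 2" by (metis abs_of_nonneg)
          then have t: "norm (((of_int \<lfloor>m * s\<rfloor> + 1) / m) *\<^sub>R n i) \<le> 2"
            unfolding norm_scaleR n[OF i] by (metis mult_1_right)
          have "z - \<phi> N z = ((of_int \<lfloor>m * s\<rfloor> + 1) / m) *\<^sub>R n i" by (simp add: \<phi>_def m_def s_def)
          then have "norm (z - \<phi> N z) \<le> 2" using t by simp
          moreover have "norm (\<phi> N z) \<le> R" using True R by auto
          ultimately have "norm z \<le> R + 2" using norm_triangle_sub[of z "\<phi> N z"] by linarith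
          then show ?thesis using qG G(1) by (simp add: indicator_def)
        next
          case False
          then show ?thesis using q0 G(1) by (auto simp: indicator_def)
        qed
      qed
      have "AE z in lborel. \<forall>j\<in>I-{i}. n j \<bullet> \<pi> z \<noteq> c j"
        unfolding \<pi>_def
        by (rule AE_finite_allI)
           (use I i n dist opp in \<open>auto intro!: AE_projection_off_hyperplane\<close>)
      then show "AE z in lborel. (\<lambda>N. indicator S z * q N i (\<phi> N z)) \<longlonglongrightarrow> indicator S z * g0 (\<pi> z)"
      proof eventually_elim
        case (elim z)
        have lim: "(\<lambda>N. \<phi> N z) \<longlonglongrightarrow> \<pi> z" unfolding \<phi>_def \<pi>_def by (rule fold_point_tendsto[OF n[OF i]])
        have below: "n i \<bullet> \<phi> N z < c i" for N unfolding \<phi>_def by (rule fold_point_below[OF n[OF i]])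
        have "(\<lambda>N. q N i (\<phi> N z)) \<longlonglongrightarrow> g0 (\<pi> z)"
        proof (cases "\<pi> z \<in> K")
          case False
          then have "\<forall>\<^sub>F N in sequentially. \<phi> N z \<in> - K"
            using topological_tendstoD[OF lim, of "- K"] closedK by auto
          then have "\<forall>\<^sub>F N in sequentially. q N i (\<phi> N z) = 0"
            by eventually_elim (simp add: q0)
          then have "(\<lambda>N. q N i (\<phi> N z)) \<longlonglongrightarrow> 0" by (rule tendsto_eventually)
          then show ?thesis using False by (simp add: g0_def)
        next
          case True
          \<comment> \<open>Almost every projected point of the facet satisfies the remaining
            constraints with room to spare. The folded points inherit half of that room, which for
            large \<open>N\<close> saturates the other clamps.\<close>
          have ev: "\<forall>\<^sub>F N in sequentially. cl N j (\<phi> N z) = 1 \<and> n j \<bullet> \<phi> N z < c j" if j: "j \<in> I - {i}" for j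
          proof -
            define d where "d = (c j - n j \<bullet> \<pi> z) / 2"
            have "n j \<bullet> \<pi> z < c j" using elim j True K by (auto simp: less_le)
            then have "d > 0" by (simp add: d_def)
            have "(\<lambda>N. c j - n j \<bullet> \<phi> N z) \<longlonglongrightarrow> c j - n j \<bullet> \<pi> z" by (intro tendsto_intros lim)
            then have e1: "\<forall>\<^sub>F N in sequentially. d < c j - n j \<bullet> \<phi> N z"
              by (rule order_tendstoD) (use \<open>d > 0\<close> in \<open>simp add: d_def\<close>)
            have e2: "\<forall>\<^sub>F N in sequentially. inverse (real (Suc N)) < d"
              using order_tendstoD(2)[OF LIMSEQ_inverse_real_of_nat \<open>d > 0\<close>] .
            from e1 e2 show ?thesis
            proof eventually_elim
              case (elim N)
              then have "1 < real (Suc N) * d" by (simp add: field_simps)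
              also have "\<dots> \<le> real (Suc N) * (c j - n j \<bullet> \<phi> N z)" using elim by (intro mult_left_mono) auto
              finally show ?case using elim \<open>d > 0\<close> by (simp add: cl_def clamp01_def)
            qed
          qed
          have "\<forall>\<^sub>F N in sequentially. \<forall>j\<in>I-{i}. cl N j (\<phi> N z) = 1 \<and> n j \<bullet> \<phi> N z < c j"
            by (rule eventually_ball_finite) (use ev I in auto)
          then have ev2: "\<forall>\<^sub>F N in sequentially. \<phi> N z \<in> K \<and> q N i (\<phi> N z) = g (\<phi> N z)"
          proof eventually_elim
            case (elim N)
            have "\<phi> N z \<in> K" unfolding K using elim below[of N] by (auto intro: less_imp_le)
            then show ?case using elim by (simp add: q_def g0_def)
          qed
          have "(\<lambda>N. g (\<phi> N z)) \<longlonglongrightarrow> g (\<pi> z)"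
            by (rule continuous_on_tendsto_compose[OF contg lim True]) (use ev2 in eventually_elim, simp)
          then have "(\<lambda>N. q N i (\<phi> N z)) \<longlonglongrightarrow> g (\<pi> z)"
            by (rule Lim_transform_eventually) (use ev2 in eventually_elim, simp)
          then show ?thesis using True by (simp add: g0_def)
        qed
        then show ?case by (intro tendsto_mult tendsto_const)
      qed
    qed
    then show ?thesis unfolding fold using rhs by (simp add: F_def)
  qed
  have "(\<lambda>N. \<Sum>i\<in>I. (n i \<bullet> e) * (real (Suc N) * (\<integral>x. \<rho> N i x * q N i x \<partial>lborel))) \<longlonglongrightarrow>
      (\<Sum>i\<in>I. (n i \<bullet> e) * (\<integral>x. indicator (K \<inter> {x. n i \<bullet> x = c i}) x * g x \<partial>hyperplane_measure (n i) (c i)))"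
    by (intro tendsto_intros lim2)
  then show ?thesis using lim1 by (simp add: ident LIMSEQ_unique)
qed


section \<open>Facets, supporting hyperplanes and outward normals\<close>

lemma facet_hyperplane:
  fixes K :: "(real^'n) set"
  assumes int: "interior K \<noteq> {}" and F: "F facet_of K" and n: "n \<noteq> 0" "F \<subseteq> {x. n \<bullet> x = c}"
  shows "affine hull F = {x. n \<bullet> x = c}"
proof (rule affine_dim_equal)
  show "affine {x. n \<bullet> x = c}" by (rule affine_hyperplane)
  show "affine hull F \<noteq> {}" using F by (simp add: facet_of_def)
  show "affine hull F \<subseteq> {x. n \<bullet> x = c}" using n(2) by (simp add: hull_minimal affine_hyperplane)
  have "aff_dim K = int DIM(real^'n)" using int low_dim_interior by metis
  then show "aff_dim (affine hull F) = aff_dim {x. n \<bullet> x = c}" using F n(1) by (simp add: facet_of_def)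
qed simp

text \<open>The part of \<open>m\<close> orthogonal to \<open>n\<close> is a direction of the common
  hyperplane, so \<open>m\<close> is orthogonal to it too. It is then orthogonal to itself and
  vanishes.\<close>

lemma unit_normals_eq_or_opposite:
  fixes n m :: "'a::real_inner"
  assumes n: "norm n = 1" and m: "norm m = 1" and x: "n \<bullet> x = c" "m \<bullet> x = d"
    and eq: "{y. n \<bullet> y = c} = {y. m \<bullet> y = d}"
  shows "m = n \<or> m = - n"
proof -
  have nn: "n \<bullet> n = 1" using n by (simp add: norm_eq_1)
  define v where "v = m - (m \<bullet> n) *\<^sub>R n"
  have nv: "n \<bullet> v = 0" by (simp add: v_def inner_diff_right nn inner_commute)
  then have "x + v \<in> {y. n \<bullet> y = c}" using x by (simp add: inner_add_right)
  then have "m \<bullet> v = 0" unfolding eq using x by (simp add: inner_add_right)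
  then have "v \<bullet> v = 0" using nv by (simp add: v_def inner_diff_left)
  then have mn: "m = (m \<bullet> n) *\<^sub>R n" by (simp add: v_def)
  then have "norm m = \<bar>m \<bullet> n\<bar> * norm n" by (metis norm_scaleR)
  then have "\<bar>m \<bullet> n\<bar> = 1" using n m by simp
  then have "m \<bullet> n = 1 \<or> m \<bullet> n = -1" by linarith
  then show ?thesis using mn by (metis scaleR_one scaleR_minus1_left)
qed

text \<open>Dimension drops strictly at every proper face, and a facet has codimension one, so
  nothing fits strictly between a facet and the polytope.\<close>

lemma facet_of_maximal:
  fixes K :: "'a::euclidean_space set"
  assumes K: "convex K" and F: "F facet_of K" and G: "G face_of K" "G \<noteq> K" "F \<subseteq> G"
  shows "F = G"
proof (rule ccontr)
  assume "F \<noteq> G"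
  have "F face_of G" by (rule face_of_subset[OF facet_of_imp_face_of[OF F] G(3) face_of_imp_subset[OF G(1)]])
  then have "aff_dim F < aff_dim G" using face_of_aff_dim_lt[OF face_of_imp_convex[OF G(1)]] \<open>F \<noteq> G\<close> by blast
  moreover have "aff_dim G < aff_dim K" by (rule face_of_aff_dim_lt[OF K G(1,2)])
  ultimately show False using F by (simp add: facet_of_def)
qed

text \<open>Justifies the definite description in \<open>outward_normal\<close>. Two unit normals of
  the same facet agree up to sign, and the opposite sign would squeeze \<open>K\<close> into the
  hyperplane of the facet.\<close>

lemma outward_normal_ex1:
  fixes K :: "(real^'n) set"
  assumes K: "polyhedron K" and int: "interior K \<noteq> {}" and F: "F facet_of K"
  shows "\<exists>!n. norm n = 1 \<and> (\<exists>c. K \<subseteq> {x. n \<bullet> x \<le> c} \<and> F = K \<inter> {x. n \<bullet> x = c})"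
proof -
  obtain a b where a: "a \<noteq> 0" and sub: "K \<subseteq> {x. a \<bullet> x \<le> b}" and eq: "F = K \<inter> {x. a \<bullet> x = b}"
    using facet_of_polyhedron[OF K F] by metis
  define m where "m = (1 / norm a) *\<^sub>R a"
  define c where "c = b / norm a"
  have na: "norm a > 0" using a by simp
  have m1: "norm m = 1" using a by (simp add: m_def)
  have mx: "m \<bullet> x \<le> c \<longleftrightarrow> a \<bullet> x \<le> b" "m \<bullet> x = c \<longleftrightarrow> a \<bullet> x = b" for x
    using na by (auto simp: m_def c_def field_simps)
  have m: "K \<subseteq> {x. m \<bullet> x \<le> c}" "F = K \<inter> {x. m \<bullet> x = c}"
    using sub eq by (auto simp: mx)
  show ?thesis
  proof (rule ex1I[of _ m])
    show "norm m = 1 \<and> (\<exists>c. K \<subseteq> {x. m \<bullet> x \<le> c} \<and> F = K \<inter> {x. m \<bullet> x = c})" using m1 m by blast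
    fix n assume n: "norm n = 1 \<and> (\<exists>c. K \<subseteq> {x. n \<bullet> x \<le> c} \<and> F = K \<inter> {x. n \<bullet> x = c})"
    then obtain d where d: "K \<subseteq> {x. n \<bullet> x \<le> d}" "F = K \<inter> {x. n \<bullet> x = d}" by blast
    have n1: "norm n = 1" using n by blast
    have "m \<noteq> 0" "n \<noteq> 0" using m1 n1 by auto
    then have hp: "{x. m \<bullet> x = c} = {x. n \<bullet> x = d}"
      using facet_hyperplane[OF int F, of m c] facet_hyperplane[OF int F, of n d] m(2) d(2) by blast
    obtain y where "y \<in> F" using F by (auto simp: facet_of_def)
    then have yc: "m \<bullet> y = c" "n \<bullet> y = d" using m d by auto
    from unit_normals_eq_or_opposite[OF m1 n1 yc hp] show "n = m"
    proof
      assume "n = - m"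
      then have "d = - c" using yc by simp
      then have "K \<subseteq> {x. m \<bullet> x = c}" using m(1) d(1) \<open>n = - m\<close> by force
      then have "K = F" using m(2) by blast
      then show ?thesis using F facet_of_irrefl by blast
    qed
  qed
qed

lemma outward_normal_props:
  fixes K :: "(real^'n) set"
  assumes K: "polyhedron K" and int: "interior K \<noteq> {}" and F: "F facet_of K" and y: "y \<in> F"
  shows "norm (outward_normal K F) = 1"
    and "x \<in> K \<Longrightarrow> outward_normal K F \<bullet> x \<le> outward_normal K F \<bullet> y"
    and "F = K \<inter> {x. outward_normal K F \<bullet> x = outward_normal K F \<bullet> y}"
proof -
  have *: "norm (outward_normal K F) = 1 \<and>
     (\<exists>c. K \<subseteq> {x. outward_normal K F \<bullet> x \<le> c} \<and> F = K \<inter> {x. outward_normal K F \<bullet> x = c})"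
    unfolding outward_normal_def by (rule theI'[OF outward_normal_ex1[OF K int F]])
  then show "norm (outward_normal K F) = 1" by blast
  from * obtain c where c: "K \<subseteq> {x. outward_normal K F \<bullet> x \<le> c}" "F = K \<inter> {x. outward_normal K F \<bullet> x = c}" by blast
  then have "outward_normal K F \<bullet> y = c" using y by blast
  then show "x \<in> K \<Longrightarrow> outward_normal K F \<bullet> x \<le> outward_normal K F \<bullet> y"
    "F = K \<inter> {x. outward_normal K F \<bullet> x = outward_normal K F \<bullet> y}" using c by auto
qed

lemma facet_nonempty: "F facet_of K \<Longrightarrow> F \<noteq> {}"
  by (simp add: facet_of_def)

text \<open>The measure underlying \<open>facet_integral\<close>, oriented by a given element
  instead of an arbitrarily chosen adjacent one. The two are compared in
  \<open>facet_integral_eq\<close>.\<close>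

definition facet_measure :: "(real^'n) set \<Rightarrow> (real^'n) set \<Rightarrow> (real^'n) measure" where
  "facet_measure K F = hyperplane_measure (outward_normal K F) (outward_normal K F \<bullet> (SOME y. y \<in> F))"

text \<open>Walk from an interior point to a point outside: the segment crosses the boundary at some
  \<open>z\<close> in a facet. The functional of that facet increases strictly up to
  \<open>z\<close>, being affine it continues to increase, and the constraint fails at the end
  point.\<close>

lemma polytope_halfspaces:
  fixes K :: "(real^'n) set"
  assumes K: "polytope K" and int: "interior K \<noteq> {}"
  shows "K = {x. \<forall>F\<in>{F. F facet_of K}. outward_normal K F \<bullet> x \<le> outward_normal K F \<bullet> (SOME y. y \<in> F)}" (is "_ = ?R")
proof
  have ph: "polyhedron K" using K by (rule polytope_imp_polyhedron)
  have some: "(SOME y. y \<in> F) \<in> F" if "F facet_of K" for F using facet_nonempty[OF that] by (simp add: some_in_eq)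
  show "K \<subseteq> ?R" using outward_normal_props(2)[OF ph int _ some] by blast
  show "?R \<subseteq> K"
  proof (rule ccontr)
    assume "\<not> ?R \<subseteq> K"
    then obtain y where y: "y \<in> ?R" "y \<notin> K" by blast
    obtain x0 where x0: "x0 \<in> interior K" using int by blast
    have "closed_segment x0 y \<inter> frontier K \<noteq> {}"
    proof (rule connected_Int_frontier)
      show "closed_segment x0 y \<inter> K \<noteq> {}" using x0 interior_subset by fastforce
      show "closed_segment x0 y - K \<noteq> {}" using y by fastforce
    qed simp
    then obtain z where z: "z \<in> closed_segment x0 y" "z \<in> frontier K" by blast
    have "frontier K = K - rel_interior K"
      using polytope_imp_closed[OF K] rel_interior_nonempty_interior[OF int] by (simp add: frontier_def)
    then have "z \<in> \<Union>{F. F facet_of K}" using z(2) rel_boundary_of_polyhedron[OF ph] by blast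
    then obtain F where F: "F facet_of K" "z \<in> F" by blast
    define n where "n = outward_normal K F"
    have p: "norm n = 1" "\<And>x. x \<in> K \<Longrightarrow> n \<bullet> x \<le> n \<bullet> z" "F = K \<inter> {x. n \<bullet> x = n \<bullet> z}"
      using outward_normal_props[OF ph int F] by (auto simp: n_def)
    have "n \<bullet> (SOME y. y \<in> F) = n \<bullet> z" using p(3) some[OF F(1)] by auto
    then have le: "n \<bullet> y \<le> n \<bullet> z" using y(1) F(1) by (auto simp: n_def)
    have "n \<bullet> x0 < n \<bullet> z"
    proof -
      have "x0 \<notin> F"
      proof
        assume "x0 \<in> F"
        have "F \<noteq> K" using F facet_of_irrefl by blast
        have "F \<inter> interior K = {}"
          by (rule face_of_disjoint_interior[OF facet_of_imp_face_of[OF F(1)] \<open>F \<noteq> K\<close>])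
        then show False using \<open>x0 \<in> F\<close> x0 by blast
      qed
      then show ?thesis using p(2)[of x0] p(3) x0 interior_subset by force
    qed
    obtain t where t: "0 \<le> t" "t \<le> 1" "z = (1 - t) *\<^sub>R x0 + t *\<^sub>R y" using z(1) by (auto simp: closed_segment_def)
    have "t \<noteq> 1" using t y z(2) polytope_imp_closed[OF K] by (auto simp: frontier_def)
    then have "(1 - t) * (n \<bullet> x0) < (1 - t) * (n \<bullet> z)" using t \<open>n \<bullet> x0 < n \<bullet> z\<close> by simp
    moreover have "t * (n \<bullet> y) \<le> t * (n \<bullet> z)" using t le by (simp add: mult_left_mono)
    moreover have "n \<bullet> z = (1 - t) * (n \<bullet> x0) + t * (n \<bullet> y)" using t by (simp add: inner_add_right)
    ultimately show False by (simp add: algebra_simps)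
  qed
qed

section \<open>Integrability and limits for the facet measure\<close>

lemma hyperplane_measure_sets[measurable_cong, simp]: "sets (hyperplane_measure n c) = sets borel"
  by (simp add: hyperplane_measure_def)

lemma hyperplane_measure_bounded_finite:
  fixes F :: "(real^'n) set"
  assumes n: "norm n = 1" and F: "bounded F" "F \<in> sets borel"
  shows "emeasure (hyperplane_measure n c) F < \<infinity>"
proof -
  obtain R where R: "\<forall>x\<in>F. norm x \<le> R" using F(1) bounded_iff by blast
  define \<pi> where "\<pi> z = z - (n \<bullet> z - c) *\<^sub>R n" for z
  have [measurable]: "F \<in> sets borel" by fact
  have [measurable]: "\<pi> \<in> borel_measurable borel" unfolding \<pi>_def[abs_def] by measurable
  have "integrable lborel (\<lambda>z. indicator {z. c \<le> n \<bullet> z \<and> n \<bullet> z \<le> c + 1} z * (indicator F (\<pi> z) :: real))"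
  proof (rule Bochner_Integration.integrable_bound[where f="\<lambda>z. indicator (cball 0 (R + 1)) z *\<^sub>R (1::real)"])
    show "integrable lborel (\<lambda>z. indicator (cball 0 (R + 1)) z *\<^sub>R (1::real) :: real)"
      by (rule borel_integrable_compact) auto
    show "(\<lambda>z. indicator {z. c \<le> n \<bullet> z \<and> n \<bullet> z \<le> c + 1} z * (indicator F (\<pi> z) :: real)) \<in> borel_measurable lborel"
      by measurable
    show "AE z in lborel. norm (indicator {z. c \<le> n \<bullet> z \<and> n \<bullet> z \<le> c + 1} z * (indicator F (\<pi> z) :: real)) \<le> norm (indicator (cball 0 (R + 1)) z *\<^sub>R (1::real))"
    proof (rule AE_I2)
      fix z
      have "norm z \<le> R + 1" if "c \<le> n \<bullet> z" "n \<bullet> z \<le> c + 1" "\<pi> z \<in> F"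
      proof -
        have "norm (\<pi> z) \<le> R" using R that by blast
        moreover have "norm (z - \<pi> z) \<le> 1" using that n by (simp add: \<pi>_def)
        ultimately show ?thesis using norm_triangle_sub[of z "\<pi> z"] by linarith
      qed
      then show "norm (indicator {z. c \<le> n \<bullet> z \<and> n \<bullet> z \<le> c + 1} z * (indicator F (\<pi> z) :: real)) \<le> norm (indicator (cball 0 (R + 1)) z *\<^sub>R (1::real))"
        by (auto simp: indicator_def)
    qed
  qed
  then have "integrable (hyperplane_measure n c) (indicator F :: _ \<Rightarrow> real)"
    unfolding \<pi>_def by (subst hyperplane_measure_integral(2)) auto
  then show ?thesis by (simp add: integrable_indicator_iff)
qed

lemma set_integrable_continuous:
  fixes f :: "'a::topological_space \<Rightarrow> real"
  assumes M: "sets M = sets borel" "emeasure M S < \<infinity>" and S: "S \<in> sets borel" "compact S" and f: "continuous_on S f"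
  shows "set_integrable M S f"
proof -
  have "bounded (f ` S)" using compact_continuous_image[OF f S(2)] compact_imp_bounded by blast
  then obtain B where B: "\<And>x. x \<in> S \<Longrightarrow> norm (f x) \<le> B" by (auto simp: bounded_iff)
  have "integrable M (\<lambda>x. indicator S x *\<^sub>R (indicator S x *\<^sub>R f x))"
  proof (rule integrableI_bounded_set_indicator[where B=B])
    show "S \<in> sets M" using M S by simp
    show "(\<lambda>x. indicator S x *\<^sub>R f x) \<in> borel_measurable M"
      using borel_measurable_continuous_on_indicator[OF S(1) f] M(1) measurable_cong_sets by blast
    show "emeasure M S < \<infinity>" by fact
    show "AE x in M. x \<in> S \<longrightarrow> norm (indicator S x *\<^sub>R f x) \<le> B" using B by (auto intro!: AE_I2)
  qed
  moreover have "(\<lambda>x. indicator S x *\<^sub>R (indicator S x *\<^sub>R f x)) = (\<lambda>x. indicator S x *\<^sub>R f x)"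
    by (auto simp: indicator_def fun_eq_iff)
  ultimately show ?thesis by (simp add: set_integrable_def)
qed

text \<open>Meant for the dilations \<open>\<phi> k\<close> of a polytope: they keep the argument
  inside the compact \<open>K\<close>, where \<open>f\<close> is bounded, so dominated convergence
  applies both on \<open>K\<close> and on its facets.\<close>

lemma set_integral_compose_tendsto:
  fixes f :: "'a::metric_space \<Rightarrow> real"
  assumes M: "sets M = sets borel" "emeasure M S < \<infinity>" and S: "S \<in> sets borel" and SK: "S \<subseteq> K" and K: "compact K" and f: "continuous_on K f"
    and \<phi>: "\<And>k. continuous_on S (\<phi> k)" "\<And>k x. x \<in> S \<Longrightarrow> \<phi> k x \<in> K" "\<And>x. x \<in> S \<Longrightarrow> (\<lambda>k. \<phi> k x) \<longlonglongrightarrow> x"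
  shows "(\<lambda>k. LINT x:S|M. f (\<phi> k x)) \<longlonglongrightarrow> (LINT x:S|M. f x)"
proof -
  have "bounded (f ` K)" using compact_continuous_image[OF f K] compact_imp_bounded by blast
  then obtain B where B: "\<And>x. x \<in> K \<Longrightarrow> norm (f x) \<le> B" by (auto simp: bounded_iff)
  have mb: "(\<lambda>x. indicator S x *\<^sub>R h x) \<in> borel_measurable M" if "continuous_on S h" for h :: "'a \<Rightarrow> real"
    using borel_measurable_continuous_on_indicator[OF S that] M(1) measurable_cong_sets by blast
  show ?thesis unfolding set_lebesgue_integral_def
  proof (rule integral_dominated_convergence[where w="\<lambda>x. indicator S x *\<^sub>R B"])
    show "(\<lambda>x. indicator S x *\<^sub>R f x) \<in> borel_measurable M"
      by (rule mb) (rule continuous_on_subset[OF f SK])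
    show "(\<lambda>x. indicator S x *\<^sub>R f (\<phi> k x)) \<in> borel_measurable M" for k
      by (rule mb) (rule continuous_on_compose2[OF f \<phi>(1)], use \<phi>(2) in auto)
    show "integrable M (\<lambda>x. indicator S x *\<^sub>R B)"
      using M S by (auto intro!: integrable_scaleR_left simp: integrable_indicator_iff)
    show "AE x in M. (\<lambda>k. indicator S x *\<^sub>R f (\<phi> k x)) \<longlonglongrightarrow> indicator S x *\<^sub>R f x"
    proof (rule AE_I2)
      fix x show "(\<lambda>k. indicator S x *\<^sub>R f (\<phi> k x)) \<longlonglongrightarrow> indicator S x *\<^sub>R f x"
      proof (cases "x \<in> S")
        case True
        have "(\<lambda>k. f (\<phi> k x)) \<longlonglongrightarrow> f x"
          by (rule continuous_on_tendsto_compose[OF f \<phi>(3)[OF True]]) (use True SK \<phi>(2) in auto)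
        then show ?thesis using True by simp
      qed simp
    qed
    show "AE x in M. norm (indicator S x *\<^sub>R f (\<phi> k x)) \<le> indicator S x *\<^sub>R B" for k
      using B \<phi>(2) by (auto intro!: AE_I2 simp: indicator_def)
  qed
qed

lemma polytope_divergence_lipschitz:
  fixes K :: "(real^'n) set" and g D :: "real^'n \<Rightarrow> real"
  assumes K: "polytope K" and int: "interior K \<noteq> {}" and g: "L-lipschitz_on K g"
    and deriv: "\<And>x. x \<in> interior K \<Longrightarrow> ((\<lambda>t. g (x + t *\<^sub>R e)) has_real_derivative D x) (at 0)"
    and D: "continuous_on K D"
  shows "(LINT x:K|lborel. D x) = (\<Sum>F\<in>{F. F facet_of K}. (outward_normal K F \<bullet> e) * (LINT x:F|facet_measure K F. g x))"
proof -
  have ph: "polyhedron K" using K by (rule polytope_imp_polyhedron)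
  have some: "(SOME y. y \<in> F) \<in> F" if "F facet_of K" for F using facet_nonempty[OF that] by (simp add: some_in_eq)
  \<comment> \<open>\<open>D\<close> is unconstrained off \<open>K\<close>; its extension by zero is
    Borel.\<close>
  define D0 where "D0 x = indicator K x *\<^sub>R D x" for x
  have cK: "compact K" using K by (rule polytope_imp_compact)
  have KB: "K \<in> sets borel" using cK by (simp add: compact_imp_closed)
  have "bounded (D ` K)" using compact_continuous_image[OF D cK] compact_imp_bounded by blast
  then obtain B where B: "\<And>x. x \<in> K \<Longrightarrow> norm (D x) \<le> B" by (auto simp: bounded_iff)
  have "(\<integral>x. indicator K x * D0 x \<partial>lborel) =
    (\<Sum>F\<in>{F. F facet_of K}. (outward_normal K F \<bullet> e) * (\<integral>x. indicator (K \<inter> {x. outward_normal K F \<bullet> x = outward_normal K F \<bullet> (SOME y. y \<in> F)}) x * g x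
      \<partial>hyperplane_measure (outward_normal K F) (outward_normal K F \<bullet> (SOME y. y \<in> F))))"
  proof (rule divergence_lipschitz[where M=B and L=L])
    show "finite {F. F facet_of K}" using K by (rule finite_polytope_facets)
    show "norm (outward_normal K F) = 1" if "F \<in> {F. F facet_of K}" for F
      using outward_normal_props(1)[OF ph int _ some] that by blast
    show "outward_normal K F \<noteq> outward_normal K F'" if F: "F \<in> {F. F facet_of K}" "F' \<in> {F. F facet_of K}" "F \<noteq> F'" for F F'
    proof
      assume eq: "outward_normal K F = outward_normal K F'"
      let ?y = "SOME y. y \<in> F" and ?y' = "SOME y. y \<in> F'"
      have y: "?y \<in> F" "?y' \<in> F'" using some F by auto
      then have yK: "?y \<in> K" "?y' \<in> K" using F facet_of_imp_subset by blast+
      have "outward_normal K F \<bullet> ?y = outward_normal K F \<bullet> ?y'"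
        using outward_normal_props(2)[OF ph int _ y(1) yK(2)] outward_normal_props(2)[OF ph int _ y(2) yK(1)] F eq by auto
      then have "F = F'" using outward_normal_props(3)[OF ph int _ y(1)] outward_normal_props(3)[OF ph int _ y(2)] F eq by auto
      then show False using F by blast
    qed
    show "outward_normal K F' \<bullet> (SOME y. y \<in> F') \<noteq> - (outward_normal K F \<bullet> (SOME y. y \<in> F))"
      if F: "F \<in> {F. F facet_of K}" "F' \<in> {F. F facet_of K}" "outward_normal K F' = - outward_normal K F" for F F'
    proof
      assume eq: "outward_normal K F' \<bullet> (SOME y. y \<in> F') = - (outward_normal K F \<bullet> (SOME y. y \<in> F))"
      \<comment> \<open>Two opposite halfspaces with the same boundary would confine
        \<open>K\<close> to that hyperplane, hence to a facet.\<close>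
      have "K \<subseteq> {x. outward_normal K F \<bullet> x = outward_normal K F \<bullet> (SOME y. y \<in> F)}"
      proof
        fix x assume x: "x \<in> K"
        show "x \<in> {x. outward_normal K F \<bullet> x = outward_normal K F \<bullet> (SOME y. y \<in> F)}"
          using outward_normal_props(2)[OF ph int _ some x, of F] outward_normal_props(2)[OF ph int _ some x, of F'] F eq by auto
      qed
      then have "K = F" using outward_normal_props(3)[OF ph int _ some, of F] F by blast
      then show False using F facet_of_irrefl by blast
    qed
    show "K = {x. \<forall>F\<in>{F. F facet_of K}. outward_normal K F \<bullet> x \<le> outward_normal K F \<bullet> (SOME y. y \<in> F)}"
      by (rule polytope_halfspaces[OF K int])
    show "bounded K" using K by (rule polytope_imp_bounded)
    show "L-lipschitz_on K g" by fact
    show "((\<lambda>t. g (x + t *\<^sub>R e)) has_real_derivative D0 x) (at 0)" if "x \<in> interior K" for x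
      using deriv[OF that] that interior_subset[of K] by (auto simp: D0_def)
    show "D0 \<in> borel_measurable borel" unfolding D0_def[abs_def]
      by (rule borel_measurable_continuous_on_indicator[OF KB D])
    show "\<bar>D0 x\<bar> \<le> B" if "x \<in> K" for x using B[OF that] that by (simp add: D0_def)
  qed
  moreover have "(\<integral>x. indicator K x * D0 x \<partial>lborel) = (LINT x:K|lborel. D x)"
    unfolding set_lebesgue_integral_def by (rule Bochner_Integration.integral_cong) (auto simp: D0_def indicator_def)
  moreover have "K \<inter> {x. outward_normal K F \<bullet> x = outward_normal K F \<bullet> (SOME y. y \<in> F)} = F" if "F facet_of K" for F
    using outward_normal_props(3)[OF ph int that some[OF that]] by simp
  ultimately show ?thesis by (simp add: set_lebesgue_integral_def facet_measure_def)
qed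

lemma facet_compact: "polytope K \<Longrightarrow> F facet_of K \<Longrightarrow> compact F"
  by (meson face_of_polytope_polytope facet_of_imp_face_of polytope_imp_compact)

lemma facet_measure_finite:
  fixes K :: "(real^'n) set"
  assumes K: "polytope K" and int: "interior K \<noteq> {}" and F: "F facet_of K"
  shows "emeasure (facet_measure K F) F < \<infinity>" "sets (facet_measure K F) = sets borel"
proof -
  have "(SOME y. y \<in> F) \<in> F" using facet_nonempty[OF F] by (simp add: some_in_eq)
  then have "norm (outward_normal K F) = 1" using outward_normal_props(1)[OF polytope_imp_polyhedron[OF K] int F] by blast
  then show "emeasure (facet_measure K F) F < \<infinity>" unfolding facet_measure_def
    using facet_compact[OF K F] by (intro hyperplane_measure_bounded_finite) (auto simp: compact_imp_bounded compact_imp_closed)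
  show "sets (facet_measure K F) = sets borel" by (simp add: facet_measure_def)
qed

lemma facet_set_integrable:
  fixes K :: "(real^'n) set"
  assumes "polytope K" "interior K \<noteq> {}" "F facet_of K" "continuous_on F f"
  shows "set_integrable (facet_measure K F) F (f :: _ \<Rightarrow> real)"
  using assms facet_measure_finite[OF assms(1-3)] facet_compact[OF assms(1,3)]
  by (intro set_integrable_continuous) (auto simp: compact_imp_closed)

text \<open>The derivative of \<open>G\<close> may blow up at the boundary, so the Lipschitz case is applied to the dilations
  \<open>G \<circ> \<phi> t\<close> about an interior point, with \<open>t\<close> tending to \<open>1\<close> from below.\<close>
theorem polytope_divergence:
  fixes K :: "(real^'n) set" and G :: "real^'n \<Rightarrow> real^'n" and d :: "real^'n \<Rightarrow> real"
  assumes K: "polytope K" and int: "interior K \<noteq> {}" and G: "continuous_on K G"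
    and deriv: "\<And>x. x \<in> interior K \<Longrightarrow> (G has_derivative G' x) (at x)"
    and G': "\<And>i. continuous_on (interior K) (\<lambda>x. G' x (axis i 1))"
    and d: "continuous_on K d" "\<And>x. x \<in> interior K \<Longrightarrow> d x = (\<Sum>i\<in>UNIV. G' x (axis i 1) $ i)"
  shows "(LINT x:K|lborel. d x) = (\<Sum>F\<in>{F. F facet_of K}. LINT x:F|facet_measure K F. G x \<bullet> outward_normal K F)"
proof -
  obtain x0 where x0: "x0 \<in> interior K" using int by blast
  have cK: "compact K" using K by (rule polytope_imp_compact)
  have KB: "K \<in> sets borel" using cK by (simp add: compact_imp_closed)
  have convK: "convex K" using K by (rule polytope_imp_convex)
  define \<phi> where "\<phi> t x = x0 + t *\<^sub>R (x - x0)" for t :: real and x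
  have \<phi>int: "\<phi> t x \<in> interior K" if "x \<in> K" "0 \<le> t" "t < 1" for t x
  proof -
    have "x - (1 - t) *\<^sub>R (x - x0) \<in> interior K"
      by (rule mem_interior_convex_shrink[OF convK x0 that(1)]) (use that in auto)
    then show ?thesis by (simp add: \<phi>_def algebra_simps)
  qed
  have \<phi>cont: "continuous_on S (\<phi> t)" for S t unfolding \<phi>_def by (intro continuous_intros)
  \<comment> \<open>The dilated field has bounded derivative, because the image \<open>Kt\<close> of
    \<open>K\<close> is compact inside the interior. The factor \<open>t\<close> comes from the
    chain rule.\<close>
  have id: "t * (LINT x:K|lborel. d (\<phi> t x)) = (\<Sum>F\<in>{F. F facet_of K}. LINT x:F|facet_measure K F. G (\<phi> t x) \<bullet> outward_normal K F)"
    if t: "0 \<le> t" "t < 1" for t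
  proof -
    define Kt where "Kt = \<phi> t ` K"
    have cKt: "compact Kt" unfolding Kt_def by (rule compact_continuous_image[OF \<phi>cont cK])
    have Kti: "Kt \<subseteq> interior K" using \<phi>int t by (auto simp: Kt_def)
    have convKt: "convex Kt"
    proof -
      have "Kt = (\<lambda>y. (x0 - t *\<^sub>R x0) + y) ` ((\<lambda>x. t *\<^sub>R x) ` K)"
        unfolding Kt_def \<phi>_def by (auto simp: image_image algebra_simps)
      then show ?thesis using convK by (metis convex_scaling convex_translation)
    qed
    define Di where "Di i x = t * (G' (\<phi> t x) (axis i 1) $ i)" for i x
    have contDi: "continuous_on K (Di i)" for i
    proof -
      have "continuous_on K (\<lambda>x. G' (\<phi> t x) (axis i 1))"
        by (rule continuous_on_compose2[OF G' \<phi>cont]) (use \<phi>int t in auto)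
      then show ?thesis unfolding Di_def by (intro continuous_intros)
    qed
    obtain B where B: "0 \<le> B" "\<And>y i. y \<in> Kt \<Longrightarrow> norm (G' y (axis i 1)) \<le> B"
    proof -
      have "\<exists>B. \<forall>y\<in>Kt. norm (G' y (axis i 1)) \<le> B" for i
      proof -
        have "bounded ((\<lambda>y. G' y (axis i 1)) ` Kt)"
          using compact_continuous_image[OF continuous_on_subset[OF G' Kti] cKt] compact_imp_bounded by blast
        then show ?thesis by (auto simp: bounded_iff)
      qed
      then obtain Bi where Bi: "\<And>i y. y \<in> Kt \<Longrightarrow> norm (G' y (axis i 1)) \<le> Bi i" by metis
      show ?thesis
      proof (rule that[of "\<Sum>i\<in>UNIV. \<bar>Bi i\<bar>"])
        show "norm (G' y (axis i 1)) \<le> (\<Sum>i\<in>UNIV. \<bar>Bi i\<bar>)" if "y \<in> Kt" for y i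
        proof -
          have "norm (G' y (axis i 1)) \<le> \<bar>Bi i\<bar>" using Bi[OF that, of i] by linarith
          also have "\<dots> \<le> (\<Sum>i\<in>UNIV. \<bar>Bi i\<bar>)" by (rule member_le_sum) auto
          finally show ?thesis .
        qed
      qed (simp add: sum_nonneg)
    qed
    \<comment> \<open>Each of the \<open>CARD('n)\<close> coordinates of \<open>v\<close>
      contributes at most \<open>norm v * B\<close> to the norm of \<open>G' z v\<close>.\<close>
    define C where "C = B * real CARD('n)"
    have GL: "norm (G x - G y) \<le> C * norm (x - y)" if "x \<in> Kt" "y \<in> Kt" for x y
    proof (rule differentiable_bound[OF convKt _ _ that])
      fix z assume z: "z \<in> Kt"
      show "(G has_derivative G' z) (at z within Kt)"
        using deriv[of z] z Kti has_derivative_at_withinI by blast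
      have lin: "linear (G' z)" using deriv[of z] z Kti has_derivative_linear by blast
      show "onorm (G' z) \<le> C"
      proof (rule onorm_le)
        fix v :: "real^'n"
        have "v = (\<Sum>i\<in>UNIV. v $ i *\<^sub>R axis i 1)" using basis_expansion[of v] by (simp add: scalar_mult_eq_scaleR)
        then have "G' z v = (\<Sum>i\<in>UNIV. v $ i *\<^sub>R G' z (axis i 1))"
          by (metis (no_types, lifting) lin linear_scale linear_sum sum.cong)
        then have "norm (G' z v) \<le> (\<Sum>i\<in>UNIV. norm (v $ i *\<^sub>R G' z (axis i 1)))" by (simp only: norm_sum)
        also have "\<dots> \<le> (\<Sum>i\<in>(UNIV::'n set). norm v * B)"
          unfolding norm_scaleR using B z by (intro sum_mono mult_mono) (auto simp: component_le_norm_cart)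
        finally show "norm (G' z v) \<le> C * norm v" by (simp add: C_def algebra_simps)
      qed
    qed
    have one: "(LINT x:K|lborel. Di i x) = (\<Sum>F\<in>{F. F facet_of K}. (outward_normal K F \<bullet> axis i 1) * (LINT x:F|facet_measure K F. G (\<phi> t x) $ i))" for i
    proof (rule polytope_divergence_lipschitz[OF K int _ _ contDi])
      show "(C * t)-lipschitz_on K (\<lambda>x. G (\<phi> t x) $ i)"
      proof (rule lipschitz_onI)
        fix x y assume xy: "x \<in> K" "y \<in> K"
        have "\<bar>G (\<phi> t x) $ i - G (\<phi> t y) $ i\<bar> \<le> norm (G (\<phi> t x) - G (\<phi> t y))"
          using component_le_norm_cart[of "G (\<phi> t x) - G (\<phi> t y)" i] by simp
        also have "\<dots> \<le> C * norm (\<phi> t x - \<phi> t y)" by (rule GL) (use xy in \<open>auto simp: Kt_def\<close>)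
        also have "\<phi> t x - \<phi> t y = t *\<^sub>R (x - y)" by (simp add: \<phi>_def algebra_simps)
        finally show "dist (G (\<phi> t x) $ i) (G (\<phi> t y) $ i) \<le> C * t * dist x y"
          using t by (simp add: dist_norm dist_real_def)
      qed (use B t in \<open>simp add: C_def\<close>)
      fix x assume x: "x \<in> interior K"
      then have "\<phi> t x \<in> interior K" using \<phi>int t interior_subset by blast
      then have dG: "(G has_derivative G' (\<phi> t x)) (at (\<phi> t (x + 0 *\<^sub>R axis i 1)))" using deriv by simp
      have "((\<lambda>s. \<phi> t (x + s *\<^sub>R axis i 1)) has_derivative (\<lambda>s. (s * t) *\<^sub>R axis i 1)) (at 0)"
        unfolding \<phi>_def by (auto intro!: derivative_eq_intros simp: mult.commute)
      then have "((\<lambda>s. G (\<phi> t (x + s *\<^sub>R axis i 1))) has_derivative (\<lambda>s. G' (\<phi> t x) ((s * t) *\<^sub>R axis i 1))) (at 0)"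
        using has_derivative_compose[where g=G and f="\<lambda>s. \<phi> t (x + s *\<^sub>R axis i 1)" and x=0] dG by blast
      then have "((\<lambda>s. G (\<phi> t (x + s *\<^sub>R axis i 1)) $ i) has_derivative (\<lambda>s. G' (\<phi> t x) ((s * t) *\<^sub>R axis i 1) $ i)) (at 0)"
        by (rule bounded_linear.has_derivative[OF bounded_linear_vec_nth])
      moreover have "(\<lambda>s. G' (\<phi> t x) ((s * t) *\<^sub>R axis i 1) $ i) = (*) (Di i x)"
        using has_derivative_linear[OF dG] by (auto simp: Di_def linear_scale fun_eq_iff)
      ultimately show "((\<lambda>s. G (\<phi> t (x + s *\<^sub>R axis i 1)) $ i) has_real_derivative Di i x) (at 0)"
        by (simp add: has_field_derivative_def)
    qed
    have intDi: "set_integrable lborel K (Di i)" for i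
      using contDi cK emeasure_compact_finite[OF cK] by (intro set_integrable_continuous) (auto simp: compact_imp_closed)
    have contG: "continuous_on F (\<lambda>x. G (\<phi> t x) $ i)" if "F facet_of K" for F i
    proof -
      have "F \<subseteq> K" using that by (rule facet_of_imp_subset)
      then have "continuous_on F (\<lambda>x. G (\<phi> t x))"
        by (intro continuous_on_compose2[OF G \<phi>cont]) (use \<phi>int t interior_subset in blast)
      then show ?thesis by (intro continuous_intros)
    qed
    have "t * (LINT x:K|lborel. d (\<phi> t x)) = (LINT x:K|lborel. t * d (\<phi> t x))" by simp
    also have "\<dots> = (LINT x:K|lborel. \<Sum>i\<in>UNIV. Di i x)"
      by (rule set_lebesgue_integral_cong) (use KB d(2) \<phi>int t in \<open>auto simp: Di_def sum_distrib_left\<close>)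
    also have "\<dots> = (\<Sum>i\<in>UNIV. LINT x:K|lborel. Di i x)"
      unfolding set_lebesgue_integral_def scaleR_sum_right
      by (rule Bochner_Integration.integral_sum) (use intDi in \<open>simp add: set_integrable_def\<close>)
    also have "\<dots> = (\<Sum>F\<in>{F. F facet_of K}. \<Sum>i\<in>UNIV. (outward_normal K F \<bullet> axis i 1) * (LINT x:F|facet_measure K F. G (\<phi> t x) $ i))"
      unfolding one by (rule sum.swap)
    also have "\<dots> = (\<Sum>F\<in>{F. F facet_of K}. LINT x:F|facet_measure K F. G (\<phi> t x) \<bullet> outward_normal K F)"
    proof (rule sum.cong[OF refl])
      fix F assume "F \<in> {F. F facet_of K}"
      then have F: "F facet_of K" by simp
      have i: "set_integrable (facet_measure K F) F (\<lambda>x. G (\<phi> t x) $ i)" for i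
        by (rule facet_set_integrable[OF K int F contG[OF F]])
      have "(LINT x:F|facet_measure K F. G (\<phi> t x) \<bullet> outward_normal K F) = (LINT x:F|facet_measure K F. \<Sum>i\<in>UNIV. (outward_normal K F $ i) * (G (\<phi> t x) $ i))"
        by (simp add: inner_vec_def mult.commute)
      also have "\<dots> = (\<Sum>i\<in>UNIV. LINT x:F|facet_measure K F. (outward_normal K F $ i) * (G (\<phi> t x) $ i))"
        unfolding set_lebesgue_integral_def scaleR_sum_right
        by (rule Bochner_Integration.integral_sum) (use i in \<open>auto simp: set_integrable_def mult.left_commute[of "indicator _ _ :: real"]\<close>)
      also have "\<dots> = (\<Sum>i\<in>UNIV. (outward_normal K F \<bullet> axis i 1) * (LINT x:F|facet_measure K F. G (\<phi> t x) $ i))"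
        by (simp add: inner_axis)
      finally show "(\<Sum>i\<in>UNIV. (outward_normal K F \<bullet> axis i 1) * (LINT x:F|facet_measure K F. G (\<phi> t x) $ i)) = (LINT x:F|facet_measure K F. G (\<phi> t x) \<bullet> outward_normal K F)"
        by simp
    qed
    finally show ?thesis .
  qed
  define t where "t k = 1 - inverse (real (Suc k))" for k
  have t: "0 \<le> t k" "t k < 1" for k by (auto simp: t_def field_simps)
  have tlim: "t \<longlonglongrightarrow> 1" unfolding t_def using tendsto_diff[OF tendsto_const LIMSEQ_inverse_real_of_nat, of 1] by simp
  have \<phi>lim: "(\<lambda>k. \<phi> (t k) x) \<longlonglongrightarrow> x" for x
  proof -
    have "(\<lambda>k. \<phi> (t k) x) \<longlonglongrightarrow> x0 + 1 *\<^sub>R (x - x0)" unfolding \<phi>_def by (intro tendsto_intros tlim)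
    then show ?thesis by simp
  qed
  have \<phi>K: "\<phi> (t k) x \<in> K" if "x \<in> K" for k x using \<phi>int[OF that t] interior_subset by blast
  have "(\<lambda>k. LINT x:K|lborel. d (\<phi> (t k) x)) \<longlonglongrightarrow> (LINT x:K|lborel. d x)"
    by (rule set_integral_compose_tendsto[OF _ _ KB order_refl cK d(1)])
       (use emeasure_compact_finite[OF cK] \<phi>cont \<phi>K \<phi>lim in auto)
  then have l: "(\<lambda>k. t k * (LINT x:K|lborel. d (\<phi> (t k) x))) \<longlonglongrightarrow> 1 * (LINT x:K|lborel. d x)"
    by (intro tendsto_mult tlim)
  have r: "(\<lambda>k. \<Sum>F\<in>{F. F facet_of K}. LINT x:F|facet_measure K F. G (\<phi> (t k) x) \<bullet> outward_normal K F) \<longlonglongrightarrow>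
     (\<Sum>F\<in>{F. F facet_of K}. LINT x:F|facet_measure K F. G x \<bullet> outward_normal K F)"
  proof (rule tendsto_sum)
    fix F assume "F \<in> {F. F facet_of K}"
    then have F: "F facet_of K" by simp
    have FK: "F \<subseteq> K" using F by (rule facet_of_imp_subset)
    have c: "continuous_on K (\<lambda>x. G x \<bullet> outward_normal K F)" using G by (intro continuous_intros)
    show "(\<lambda>k. LINT x:F|facet_measure K F. G (\<phi> (t k) x) \<bullet> outward_normal K F) \<longlonglongrightarrow> (LINT x:F|facet_measure K F. G x \<bullet> outward_normal K F)"
      by (rule set_integral_compose_tendsto[OF facet_measure_finite(2,1)[OF K int F] _ FK cK c])
         (use facet_compact[OF K F] \<phi>cont \<phi>K \<phi>lim FK in \<open>auto simp: compact_imp_closed\<close>)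
  qed
  have "(\<lambda>k. t k * (LINT x:K|lborel. d (\<phi> (t k) x))) = (\<lambda>k. \<Sum>F\<in>{F. F facet_of K}. LINT x:F|facet_measure K F. G (\<phi> (t k) x) \<bullet> outward_normal K F)"
    using id[OF t] by (rule ext)
  then show ?thesis using LIMSEQ_unique l r by fastforce
qed


section \<open>Nodal elements\<close>

text \<open>One-sided derivatives along segments fix a relative derivative on all vectors
  \<open>y - x\<close> with \<open>y\<close> in \<open>K\<close>. Because \<open>K\<close> has an
  interior point, every direction is a multiple of a difference of two such vectors. This makes
  gradients meaningful at boundary points of an element.\<close>

lemma has_derivative_within_convex_unique:
  fixes f :: "'a::euclidean_space \<Rightarrow> 'b::real_normed_vector"
  assumes conv: "convex K" and int: "interior K \<noteq> {}" and x: "x \<in> K"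
    and A: "(f has_derivative A) (at x within K)" and B: "(f has_derivative B) (at x within K)"
  shows "A = B"
proof -
  have linA: "linear A" and linB: "linear B" using A B has_derivative_linear by blast+
  have seg: "A (y - x) = B (y - x)" if y: "y \<in> K" for y
  proof -
    have sub: "(\<lambda>t::real. x + t *\<^sub>R (y - x)) ` {0..1} \<subseteq> K"
    proof
      fix z assume "z \<in> (\<lambda>t::real. x + t *\<^sub>R (y - x)) ` {0..1}"
      then obtain t where t: "0 \<le> t" "t \<le> 1" "z = x + t *\<^sub>R (y - x)" by auto
      then have "z = (1 - t) *\<^sub>R x + t *\<^sub>R y" by (simp add: algebra_simps)
      then show "z \<in> K" using conv x y t by (simp add: convexD)
    qed
    have d: "((\<lambda>t::real. x + t *\<^sub>R (y - x)) has_derivative (\<lambda>t. t *\<^sub>R (y - x))) (at 0 within {0..1})"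
      by (auto intro!: derivative_eq_intros)
    have c: "((\<lambda>t. f (x + t *\<^sub>R (y - x))) has_vector_derivative L (y - x)) (at 0 within {0..1})"
      if L: "(f has_derivative L) (at x within K)" for L
    proof -
      have "(f has_derivative L) (at (x + 0 *\<^sub>R (y - x)) within (\<lambda>t::real. x + t *\<^sub>R (y - x)) ` {0..1})"
        using has_derivative_subset[OF L sub] by simp
      then have "((\<lambda>t. f (x + t *\<^sub>R (y - x))) has_derivative (\<lambda>t. L (t *\<^sub>R (y - x)))) (at 0 within {0..1})"
        using diff_chain_within[OF d, of f L] by (simp add: o_def)
      then show ?thesis
        unfolding has_vector_derivative_def by (simp add: linear_scale[OF has_derivative_linear[OF L]])
    qed
    have nb: "at (0::real) within {0..1} \<noteq> bot"
      by (simp add: at_within_Icc_at_right)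
    show ?thesis using vector_derivative_unique_within[OF nb c[OF A] c[OF B]] .
  qed
  obtain x0 where "x0 \<in> interior K" using int by blast
  then obtain e where e: "e > 0" "ball x0 e \<subseteq> K" using mem_interior by blast
  have x0K: "x0 \<in> K" using e by auto
  show "A = B"
  proof
    fix v
    show "A v = B v"
    proof (cases "v = 0")
      case True
      then show ?thesis using linA linB by (simp add: linear_0)
    next
      case False
      define s where "s = e / (2 * norm v)"
      have s: "s > 0" using e False by (simp add: s_def)
      have "x0 + s *\<^sub>R v \<in> ball x0 e" using e False by (simp add: s_def dist_norm)
      then have yK: "x0 + s *\<^sub>R v \<in> K" using e by blast
      have "A (s *\<^sub>R v) = A ((x0 + s *\<^sub>R v - x) - (x0 - x))" by (simp add: algebra_simps)
      also have "\<dots> = A (x0 + s *\<^sub>R v - x) - A (x0 - x)" using linA by (rule linear_diff)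
      also have "\<dots> = B (x0 + s *\<^sub>R v - x) - B (x0 - x)" using seg[OF yK] seg[OF x0K] by simp
      also have "\<dots> = B ((x0 + s *\<^sub>R v - x) - (x0 - x))" by (rule linear_diff[OF linB, symmetric])
      also have "\<dots> = B (s *\<^sub>R v)" by (simp add: algebra_simps)
      finally show ?thesis using s linA linB by (simp add: linear_scale)
    qed
  qed
qed

lemma grad_eqI:
  fixes K :: "(real^'n) set"
  assumes "convex K" "interior K \<noteq> {}" "x \<in> K" and w: "(f has_derivative (\<lambda>v. w \<bullet> v)) (at x within K)"
  shows "grad K f x = w"
proof -
  have "(f has_derivative frechet_derivative f (at x within K)) (at x within K)"
    using w by (meson differentiable_def frechet_derivative_works)
  then have "frechet_derivative f (at x within K) = (\<lambda>v. w \<bullet> v)"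
    using has_derivative_within_convex_unique[OF assms(1-3)] w by blast
  then show ?thesis by (simp add: grad_def inner_axis vec_eq_iff)
qed

text \<open>Derivatives are taken relative to the closed set \<open>K\<close>, and the gradient is
  continuous up to its boundary, since the forms integrate gradient traces over facets.\<close>

definition C1_on :: "(real^'n) set \<Rightarrow> (real^'n \<Rightarrow> real) \<Rightarrow> bool" where
  "C1_on K f \<longleftrightarrow> (\<exists>g. continuous_on K g \<and> (\<forall>x\<in>K. (f has_derivative (\<lambda>v. g x \<bullet> v)) (at x within K)))"

lemma C1_onD:
  fixes K :: "(real^'n) set"
  assumes K: "convex K" "interior K \<noteq> {}" and f: "C1_on K f"
  shows "continuous_on K (grad K f)" "x \<in> K \<Longrightarrow> (f has_derivative (\<lambda>v. grad K f x \<bullet> v)) (at x within K)" "continuous_on K f"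
proof -
  obtain g where g: "continuous_on K g" "\<And>x. x \<in> K \<Longrightarrow> (f has_derivative (\<lambda>v. g x \<bullet> v)) (at x within K)"
    using f unfolding C1_on_def by blast
  have eq: "grad K f x = g x" if "x \<in> K" for x using grad_eqI[OF K that g(2)[OF that]] .
  show "continuous_on K (grad K f)" by (rule continuous_on_eq[OF g(1)]) (simp add: eq)
  show "x \<in> K \<Longrightarrow> (f has_derivative (\<lambda>v. grad K f x \<bullet> v)) (at x within K)" using g(2) eq by simp
  show "continuous_on K f" unfolding continuous_on_eq_continuous_within
    using has_derivative_continuous[OF g(2)] by blast
qed

lemma C1_on_const: "C1_on K (\<lambda>_. c)"
  unfolding C1_on_def
  by (intro exI[of _ "\<lambda>_. 0"] conjI ballI, simp)
     (rule has_derivative_eq_rhs[OF has_derivative_const], simp add: fun_eq_iff)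

lemma grad_linear:
  fixes K :: "(real^'n) set"
  assumes K: "convex K" "interior K \<noteq> {}" and w: "\<And>b. b \<in> S \<Longrightarrow> C1_on K (w b)"
    and eq: "\<And>x. x \<in> K \<Longrightarrow> u x = (\<Sum>b\<in>S. c b * w b x)" and x: "x \<in> K"
  shows "grad K u x = (\<Sum>b\<in>S. c b *\<^sub>R grad K (w b) x)"
proof (rule grad_eqI[OF K x])
  have "((\<lambda>x. \<Sum>b\<in>S. c b * w b x) has_derivative (\<lambda>v. \<Sum>b\<in>S. c b * (grad K (w b) x \<bullet> v))) (at x within K)"
    by (intro has_derivative_sum has_derivative_mult_right C1_onD(2)[OF K w x])
  then have "(u has_derivative (\<lambda>v. \<Sum>b\<in>S. c b * (grad K (w b) x \<bullet> v))) (at x within K)"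
    by (rule has_derivative_transform[OF x, rotated]) (simp add: eq)
  then show "(u has_derivative (\<lambda>v. (\<Sum>b\<in>S. c b *\<^sub>R grad K (w b) x) \<bullet> v)) (at x within K)"
    by (simp add: inner_sum_left)
qed

lemma C1_on_linear:
  fixes K :: "(real^'n) set"
  assumes K: "convex K" "interior K \<noteq> {}" and w: "\<And>b. b \<in> S \<Longrightarrow> C1_on K (w b)"
    and eq: "\<And>x. x \<in> K \<Longrightarrow> u x = (\<Sum>b\<in>S. c b * w b x)"
  shows "C1_on K u"
  unfolding C1_on_def
proof (intro exI conjI ballI)
  show "continuous_on K (\<lambda>x. \<Sum>b\<in>S. c b *\<^sub>R grad K (w b) x)"
    by (intro continuous_intros C1_onD(1)[OF K w])
  fix x assume x: "x \<in> K"
  have "((\<lambda>x. \<Sum>b\<in>S. c b * w b x) has_derivative (\<lambda>v. \<Sum>b\<in>S. c b * (grad K (w b) x \<bullet> v))) (at x within K)"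
    by (intro has_derivative_sum has_derivative_mult_right C1_onD(2)[OF K w x])
  then have "(u has_derivative (\<lambda>v. \<Sum>b\<in>S. c b * (grad K (w b) x \<bullet> v))) (at x within K)"
    by (rule has_derivative_transform[OF x, rotated]) (simp add: eq)
  then show "(u has_derivative (\<lambda>v. (\<Sum>b\<in>S. c b *\<^sub>R grad K (w b) x) \<bullet> v)) (at x within K)"
    by (simp add: inner_sum_left)
qed

text \<open>Prepares the identity \<open>f * (\<beta> \<bullet> grad f) = \<beta> \<bullet> grad (f
  * f) / 2\<close> behind the sign of the diagonal entry.\<close>

lemma C1_on_square:
  fixes K :: "(real^'n) set"
  assumes K: "convex K" "interior K \<noteq> {}" and f: "C1_on K f"
  shows "C1_on K (\<lambda>x. f x * f x)" "x \<in> K \<Longrightarrow> grad K (\<lambda>x. f x * f x) x = (2 * f x) *\<^sub>R grad K f x"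
proof -
  have d: "((\<lambda>x. f x * f x) has_derivative (\<lambda>v. ((2 * f x) *\<^sub>R grad K f x) \<bullet> v)) (at x within K)" if "x \<in> K" for x
    using has_derivative_mult[OF C1_onD(2)[OF K f that] C1_onD(2)[OF K f that]]
    by (simp add: algebra_simps)
  then show "C1_on K (\<lambda>x. f x * f x)"
    unfolding C1_on_def
    by (intro exI[of _ "\<lambda>x. (2 * f x) *\<^sub>R grad K f x"] conjI ballI d continuous_intros C1_onD[OF K f])
  show "x \<in> K \<Longrightarrow> grad K (\<lambda>x. f x * f x) x = (2 * f x) *\<^sub>R grad K f x" by (rule grad_eqI[OF K _ d])
qed

text \<open>A facet minimizes a nonnegative function vanishing on it, so the gradient there is a nonpositive multiple
  of the outward normal.\<close>
lemma normal_derivative_at_facet: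
  fixes K :: "(real^'n) set"
  assumes K: "polytope K" and int: "interior K \<noteq> {}" and F: "F facet_of K" and x: "x \<in> F"
    and f: "C1_on K f" and pos: "\<And>y. y \<in> K \<Longrightarrow> 0 \<le> f y" and zero: "\<And>y. y \<in> F \<Longrightarrow> f y = 0"
  shows "grad K f x \<bullet> outward_normal K F \<le> 0"
    and "grad K f x \<noteq> 0 \<Longrightarrow> grad K f x \<bullet> outward_normal K F < 0"
proof -
  define n where "n = outward_normal K F"
  define w where "w = grad K f x"
  have ph: "polyhedron K" using K by (rule polytope_imp_polyhedron)
  have conv: "convex K" using K by (rule polytope_imp_convex)
  note p = outward_normal_props[OF ph int F x, folded n_def]
  have xK: "x \<in> K" using F x facet_of_imp_subset by blast
  have der: "(f has_derivative (\<lambda>v. w \<bullet> v)) (at x within K)" unfolding w_def by (rule C1_onD(2)[OF conv int f xK])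
  have seg: "((\<lambda>t. f (x + t *\<^sub>R (y - x))) has_vector_derivative w \<bullet> (y - x)) (at 0 within {0..1})"
    and segK: "t \<in> {0..1} \<Longrightarrow> x + t *\<^sub>R (y - x) \<in> convex hull {x, y}" if y: "y \<in> K" for y t
  proof -
    have hull: "x + t *\<^sub>R (y - x) \<in> convex hull {x, y}" if "t \<in> {0..1}" for t :: real
    proof -
      have "x + t *\<^sub>R (y - x) = (1 - t) *\<^sub>R x + t *\<^sub>R y" by (simp add: algebra_simps)
      then show ?thesis using that unfolding segment_convex_hull[symmetric] by (auto simp: in_segment)
    qed
    then show "t \<in> {0..1} \<Longrightarrow> x + t *\<^sub>R (y - x) \<in> convex hull {x, y}" .
    have "convex hull {x, y} \<subseteq> K" using conv xK y by (simp add: subset_hull)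
    then have sub: "(\<lambda>t::real. x + t *\<^sub>R (y - x)) ` {0..1} \<subseteq> K" using hull by blast
    have d: "((\<lambda>t::real. x + t *\<^sub>R (y - x)) has_derivative (\<lambda>t. t *\<^sub>R (y - x))) (at 0 within {0..1})"
      by (auto intro!: derivative_eq_intros)
    have "(f has_derivative (\<lambda>v. w \<bullet> v)) (at (x + 0 *\<^sub>R (y - x)) within (\<lambda>t::real. x + t *\<^sub>R (y - x)) ` {0..1})"
      using has_derivative_subset[OF der sub] by simp
    then show "((\<lambda>t. f (x + t *\<^sub>R (y - x))) has_vector_derivative w \<bullet> (y - x)) (at 0 within {0..1})"
      using diff_chain_within[OF d, of f "\<lambda>v. w \<bullet> v"] by (simp add: o_def has_vector_derivative_def)
  qed
  have nb: "at (0::real) within {0..1} \<noteq> bot" by (simp add: at_within_Icc_at_right)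
  have convF: "convex F" using F by (meson conv face_of_imp_convex facet_of_imp_face_of)
  \<comment> \<open>Along a segment inside the facet \<open>f\<close> is constantly zero, so the
    gradient has no component in that direction.\<close>
  have tang: "w \<bullet> (y - x) = 0" if y: "y \<in> F" for y
  proof -
    have yK: "y \<in> K" using y F facet_of_imp_subset by blast
    have "convex hull {x, y} \<subseteq> F" using convF x y by (simp add: subset_hull)
    then have "((\<lambda>t. f (x + t *\<^sub>R (y - x))) has_vector_derivative 0) (at 0 within {0..1})"
      using segK[OF yK] zero
      by (intro has_vector_derivative_transform[OF _ _ has_vector_derivative_const[of 0]]) auto
    then show ?thesis using vector_derivative_unique_within[OF nb seg[OF yK]] by simp
  qed
  have inner: "0 \<le> w \<bullet> (y - x)" if y: "y \<in> K" for y
  proof -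
    have "((\<lambda>t. (f (x + t *\<^sub>R (y - x)) - f x) / t) \<longlongrightarrow> w \<bullet> (y - x)) (at 0 within {0..1})"
      using seg[OF y] unfolding has_real_derivative_iff_has_vector_derivative[symmetric] has_field_derivative_iff by simp
    moreover have "\<forall>\<^sub>F t in at (0::real) within {0..1}. 0 \<le> (f (x + t *\<^sub>R (y - x)) - f x) / t"
    proof -
      have "convex hull {x, y} \<subseteq> K" using conv xK y by (simp add: subset_hull)
      then have "0 \<le> f (x + t *\<^sub>R (y - x))" if "t \<in> {0..1}" for t using segK[OF y that] pos by blast
      then show ?thesis using zero[OF x] by (auto simp: eventually_at_filter intro!: always_eventually)
    qed
    ultimately show ?thesis using tendsto_lowerbound nb by blast
  qed
  have aff: "affine hull F = {y. n \<bullet> y = n \<bullet> x}"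
    by (rule facet_hyperplane[OF int F]) (use p(1,3) in auto)
  \<comment> \<open>The facet spans its hyperplane affinely, so orthogonality to differences of
    facet points extends to all tangential directions, and only a normal component remains.\<close>
  have tang': "w \<bullet> v = 0" if "n \<bullet> v = 0" for v
  proof -
    have "x + v \<in> affine hull F" using that by (simp add: aff inner_add_right)
    moreover have "affine hull F \<subseteq> {y. w \<bullet> y = w \<bullet> x}"
      by (rule hull_minimal) (use tang in \<open>auto simp: affine_hyperplane inner_diff_right\<close>)
    ultimately have "w \<bullet> (x + v) = w \<bullet> x" by blast
    then show ?thesis by (simp add: inner_add_right)
  qed
  have nn: "n \<bullet> n = 1" using p(1) by (simp add: norm_eq_1)
  have wn: "w = (w \<bullet> n) *\<^sub>R n"
  proof -
    define v where "v = w - (w \<bullet> n) *\<^sub>R n"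
    have nv: "n \<bullet> v = 0" by (simp add: v_def inner_diff_right nn inner_commute)
    then have "w \<bullet> v = 0" by (rule tang')
    then have "v \<bullet> v = 0" using nv by (simp add: v_def inner_diff_left)
    then show ?thesis by (simp add: v_def)
  qed
  \<comment> \<open>An interior point supplies an inward direction with strictly negative normal
    component; the nonnegative derivative in that direction fixes the sign of the normal
    component.\<close>
  obtain x0 where x0: "x0 \<in> interior K" using int by blast
  then have x0K: "x0 \<in> K" using interior_subset by blast
  have "F \<noteq> K" using F facet_of_irrefl by blast
  then have "F \<inter> interior K = {}" by (rule face_of_disjoint_interior[OF facet_of_imp_face_of[OF F]])
  then have "n \<bullet> x0 \<noteq> n \<bullet> x" using x0 x0K p(3) by blast
  then have lt: "n \<bullet> (x0 - x) < 0" using p(2)[OF x0K] by (simp add: inner_diff_right)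
  have "0 \<le> (w \<bullet> n) * (n \<bullet> (x0 - x))"
  proof -
    have "w \<bullet> (x0 - x) = ((w \<bullet> n) *\<^sub>R n) \<bullet> (x0 - x)" by (rule arg_cong[OF wn])
    then show ?thesis using inner[OF x0K] by simp
  qed
  then have le: "w \<bullet> n \<le> 0" using lt by (auto simp: zero_le_mult_iff)
  then show "grad K f x \<bullet> outward_normal K F \<le> 0" by (simp add: w_def n_def)
  show "grad K f x \<bullet> outward_normal K F < 0" if "grad K f x \<noteq> 0"
  proof -
    have "w \<bullet> n \<noteq> 0"
    proof
      assume "w \<bullet> n = 0"
      then have "w = 0" by (subst wn) simp
      then show False using that by (simp add: w_def)
    qed
    then show ?thesis using le by (simp add: w_def n_def)
  qed
qed

text \<open>The properties of the local nodal basis shared by \<open>P1\<close> on simplices and \<open>Q1\<close> on cubes.\<close>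
locale nodal_element =
  fixes K :: "(real^'n) set" and P :: "(real^'n \<Rightarrow> real) set" and \<phi> :: "real^'n \<Rightarrow> real^'n \<Rightarrow> real"
  assumes poly: "polytope K" and int: "interior K \<noteq> {}"
    and mem: "\<And>i. i \<in> vertices K \<Longrightarrow> \<phi> i \<in> P"
    and expand: "\<And>f x. f \<in> P \<Longrightarrow> x \<in> K \<Longrightarrow> f x = (\<Sum>j\<in>vertices K. f j * \<phi> j x)"
    and delta: "\<And>i j. i \<in> vertices K \<Longrightarrow> j \<in> vertices K \<Longrightarrow> \<phi> i j = (if j = i then 1 else 0)"
    and out: "\<And>i x. i \<in> vertices K \<Longrightarrow> x \<notin> K \<Longrightarrow> \<phi> i x = 0"
    and nonneg: "\<And>i x. i \<in> vertices K \<Longrightarrow> x \<in> K \<Longrightarrow> 0 \<le> \<phi> i x"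
    and sum1: "\<And>x. x \<in> K \<Longrightarrow> (\<Sum>j\<in>vertices K. \<phi> j x) = 1"
    and C1: "\<And>i. i \<in> vertices K \<Longrightarrow> C1_on K (\<phi> i)"
    and vanish: "\<And>F i x. F facet_of K \<Longrightarrow> i \<in> vertices K \<Longrightarrow> i \<notin> F \<Longrightarrow> x \<in> F \<Longrightarrow> \<phi> i x = 0"
    and pos: "\<And>F j x. F facet_of K \<Longrightarrow> j \<in> vertices K \<Longrightarrow> j \<in> F \<Longrightarrow> x \<in> rel_interior F \<Longrightarrow> 0 < \<phi> j x"
    and grad_nz: "\<And>F i x. F facet_of K \<Longrightarrow> i \<in> vertices K \<Longrightarrow> i \<notin> F \<Longrightarrow> x \<in> rel_interior F \<Longrightarrow> grad K (\<phi> i) x \<noteq> 0"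
    and flat_or_opposite: "\<And>i. i \<in> vertices K \<Longrightarrow> (\<exists>w. \<forall>x\<in>K. grad K (\<phi> i) x = w) \<or>
      (\<exists>j\<in>vertices K. \<forall>F. F facet_of K \<longrightarrow> \<not> (i \<in> F \<and> j \<in> F))"
begin

lemma finite_vertices: "finite (vertices K)"
  using poly finite_polyhedron_extreme_points polytope_imp_polyhedron by (auto simp: vertices_def)

lemma vertex_in: "i \<in> vertices K \<Longrightarrow> i \<in> K"
  by (auto simp: vertices_def extreme_point_of_def)


text \<open>On the element a member of \<open>P\<close> is determined by its vertex values through
  \<open>expand\<close>, and off the element the value zero is prescribed; this yields
  uniqueness.\<close>

lemma the_shape_eq:
  assumes i: "i \<in> vertices K"
  shows "(THE f. f \<in> P \<and> (\<forall>j\<in>vertices K. f j = (if j = i then 1 else 0)) \<and> (\<forall>x. x \<notin> K \<longrightarrow> f x = 0)) = \<phi> i"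
proof (rule the_equality)
  show "\<phi> i \<in> P \<and> (\<forall>j\<in>vertices K. \<phi> i j = (if j = i then 1 else 0)) \<and> (\<forall>x. x \<notin> K \<longrightarrow> \<phi> i x = 0)"
    using mem[OF i] delta[OF i] out[OF i] by auto
  fix f assume f: "f \<in> P \<and> (\<forall>j\<in>vertices K. f j = (if j = i then 1 else 0)) \<and> (\<forall>x. x \<notin> K \<longrightarrow> f x = 0)"
  show "f = \<phi> i"
  proof
    fix x
    show "f x = \<phi> i x"
    proof (cases "x \<in> K")
      case True
      have "f x = (\<Sum>j\<in>vertices K. f j * \<phi> j x)" using f True by (intro expand) auto
      also have "\<dots> = (\<Sum>j\<in>vertices K. (if j = i then \<phi> j x else 0))" using f by (intro sum.cong) auto
      also have "\<dots> = \<phi> i x" using i finite_vertices by simp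
      finally show ?thesis .
    qed (use f out[OF i] in auto)
  qed
qed

text \<open>Passes from the concrete functions to \<open>shape P K\<close>, which is known to agree
  with them only at indices that are vertices.\<close>

lemma cong:
  assumes eq: "\<And>i. i \<in> vertices K \<Longrightarrow> \<psi> i = \<phi> i"
  shows "nodal_element K P \<psi>"
proof
  show "f x = (\<Sum>j\<in>vertices K. f j * \<psi> j x)" if "f \<in> P" "x \<in> K" for f x
    using expand[OF that] eq by (simp cong: sum.cong)
  show "(\<Sum>j\<in>vertices K. \<psi> j x) = 1" if "x \<in> K" for x
    using sum1[OF that] eq by (simp cong: sum.cong)
  show "\<psi> i x = 0" if "F facet_of K" "i \<in> vertices K" "i \<notin> F" "x \<in> F" for F i x
    using vanish[OF that] eq[OF that(2)] by simp
  show "0 < \<psi> j x" if "F facet_of K" "j \<in> vertices K" "j \<in> F" "x \<in> rel_interior F" for F j x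
    using pos[OF that] eq[OF that(2)] by simp
  show "grad K (\<psi> i) x \<noteq> 0" if "F facet_of K" "i \<in> vertices K" "i \<notin> F" "x \<in> rel_interior F" for F i x
    using grad_nz[OF that] eq[OF that(2)] by simp
  show "(\<exists>w. \<forall>x\<in>K. grad K (\<psi> i) x = w) \<or> (\<exists>j\<in>vertices K. \<forall>F. F facet_of K \<longrightarrow> \<not> (i \<in> F \<and> j \<in> F))"
    if "i \<in> vertices K" for i
    using flat_or_opposite[OF that] eq[OF that] by simp
qed (use poly int mem delta out nonneg C1 eq in \<open>simp_all\<close>)

end


section \<open>Simplices\<close>

text \<open>Take the component of \<open>i - a\<close> orthogonal to the directions spanned by the
  other points. It is nonzero by independence and becomes the gradient of a barycentric coordinate
  after scaling.\<close>

lemma affine_independent_dual_functional: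
  fixes C :: "'a::euclidean_space set"
  assumes C: "\<not> affine_dependent C" and i: "i \<in> C" and a: "a \<in> C" "a \<noteq> i"
  obtains c w where "\<And>j. j \<in> C \<Longrightarrow> c + w \<bullet> j = (if j = i then 1 else 0)"
proof -
  define S where "S = (\<lambda>x. - a + x) ` (C - {i})"
  obtain y z where yz: "y \<in> span S" "\<And>v. v \<in> span S \<Longrightarrow> orthogonal z v" "i - a = y + z"
    using orthogonal_subspace_decomp_exists[of S "i - a"] by metis
  have "affine hull (C - {i}) = (+) a ` span S"
    unfolding S_def by (rule affine_hull_span_gen) (use a in \<open>auto intro: hull_inc\<close>)
  moreover have "i \<notin> affine hull (C - {i})" using C i by (auto simp: affine_dependent_def)
  ultimately have "i - a \<notin> span S" by (metis add.commute diff_add_cancel rev_image_eqI)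
  then have z0: "z \<noteq> 0" using yz by auto
  define w where "w = (1 / (z \<bullet> z)) *\<^sub>R z"
  show ?thesis
  proof (rule that[of "- (w \<bullet> a)" w])
    fix j assume j: "j \<in> C"
    show "- (w \<bullet> a) + w \<bullet> j = (if j = i then 1 else 0)"
    proof (cases "j = i")
      case True
      have "z \<bullet> y = 0" using yz(1,2) by (simp add: orthogonal_def)
      then have "z \<bullet> (i - a) = z \<bullet> z" by (simp add: yz(3) inner_add_right)
      then have "w \<bullet> (i - a) = 1" using z0 by (simp add: w_def)
      then show ?thesis using True by (simp add: inner_diff_right)
    next
      case False
      then have "- a + j \<in> span S" using j by (auto simp: S_def intro: span_base)
      then have "z \<bullet> (- a + j) = 0" using yz(2) by (simp add: orthogonal_def)
      then have "w \<bullet> (- a + j) = 0" by (simp add: w_def)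
      then show ?thesis using False by (simp add: inner_diff_right inner_add_right)
    qed
  qed
qed

text \<open>The shape functions are the barycentric coordinates: an affine function takes at a
  convex combination of the vertices the same combination of its vertex values. The properties
  required of a nodal element are then read off from the weights.\<close>

lemma P1_nodal_element:
  fixes K :: "(real^'n) set"
  assumes K: "int CARD('n) simplex K"
  shows "\<exists>\<phi>. nodal_element K (P1 K) \<phi>"
proof -
  obtain C where C: "finite C" "\<not> affine_dependent C" "int (card C) = int CARD('n) + 1" "K = convex hull C"
    using K by (auto simp: simplex)
  have V: "vertices K = C" using C extreme_point_of_convex_hull_affine_independent[OF C(2)] by (auto simp: vertices_def)
  have CK: "C \<subseteq> K" using C by (simp add: hull_subset)
  \<comment> \<open>The index type is nonempty, so the dimension is positive and each vertex has a
    companion to serve as base point of the dual functional.\<close>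
  have card2: "2 \<le> card C"
  proof -
    have "1 \<le> CARD('n)" using zero_less_card_finite[where 'a='n] by linarith
    then show ?thesis using C(3) by linarith
  qed
  have ex: "\<exists>c w. \<forall>j\<in>C. c + w \<bullet> j = (if j = i then 1 else 0)" if i: "i \<in> C" for i
  proof -
    have "C \<noteq> {i}" using card2 by auto
    then obtain a where "a \<in> C" "a \<noteq> i" using i by auto
    then show ?thesis using affine_independent_dual_functional[OF C(2) i, of a] by metis
  qed
  obtain c w where cw: "\<And>i j. i \<in> C \<Longrightarrow> j \<in> C \<Longrightarrow> c i + w i \<bullet> j = (if j = i then 1 else 0 :: real)"
    using ex by metis
  define \<phi> where "\<phi> i x = (if x \<in> K then c i + w i \<bullet> x else 0)" for i x
  have aff: "e + v \<bullet> (\<Sum>j\<in>C. u j *\<^sub>R j) = (\<Sum>j\<in>C. u j * (e + v \<bullet> j))" if "sum u C = 1" for e v and u :: "_ \<Rightarrow> real"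
    using that by (simp add: inner_sum_right distrib_left sum.distrib flip: sum_distrib_right)
  have bary: "\<exists>u. (\<forall>j\<in>C. 0 \<le> u j \<and> \<phi> j x = u j) \<and> sum u C = 1 \<and> (\<Sum>j\<in>C. u j *\<^sub>R j) = x" if x: "x \<in> K" for x
  proof -
    obtain u where u: "\<forall>j\<in>C. 0 \<le> u j" "sum u C = 1" "(\<Sum>j\<in>C. u j *\<^sub>R j) = x"
      using x C(4) convex_hull_finite[OF C(1)] by auto
    have "\<phi> i x = u i" if i: "i \<in> C" for i
    proof -
      have "\<phi> i x = c i + w i \<bullet> (\<Sum>j\<in>C. u j *\<^sub>R j)" using x u(3) by (simp add: \<phi>_def)
      also have "\<dots> = (\<Sum>j\<in>C. u j * (c i + w i \<bullet> j))" by (rule aff[OF u(2)])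
      also have "\<dots> = (\<Sum>j\<in>C. if j = i then u j else 0)" by (rule sum.cong) (use cw i in auto)
      also have "\<dots> = u i" using i C(1) by simp
      finally show ?thesis .
    qed
    then show ?thesis using u by blast
  qed
  have ph: "polytope K" using C by (auto simp: polytope_def)
  have int: "interior K \<noteq> {}"
  proof -
    have ad: "aff_dim K = int DIM(real^'n)" using aff_dim_simplex[OF K] by simp
    have "K \<noteq> {}" using card2 C by auto
    then have "rel_interior K \<noteq> {}" using rel_interior_eq_empty[of K] C(4) by (simp add: convex_convex_hull)
    then show ?thesis using interior_rel_interior[OF ad] by simp
  qed
  have conv: "convex K" using C by simp
  have der: "(\<phi> i has_derivative (\<lambda>v. w i \<bullet> v)) (at x within K)" if x: "x \<in> K" for i x
  proof (rule has_derivative_transform[OF x])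
    show "((\<lambda>x. c i + w i \<bullet> x) has_derivative (\<lambda>v. w i \<bullet> v)) (at x within K)"
      by (auto intro!: derivative_eq_intros)
  qed (simp add: \<phi>_def)
  have gr: "grad K (\<phi> i) x = w i" if "x \<in> K" for i x by (rule grad_eqI[OF conv int that der[OF that]])
  have face: "\<exists>C'. C' \<subseteq> C \<and> F = convex hull C'" if F: "F facet_of K" for F
  proof -
    have "F face_of convex hull C" using F C(4) facet_of_imp_face_of by blast
    then show ?thesis using face_of_convex_hull_subset[OF finite_imp_compact[OF C(1)]] by metis
  qed
  have zero: "c i + w i \<bullet> x = 0" if C': "C' \<subseteq> C" and i: "i \<in> C" "i \<notin> C'" and x: "x \<in> convex hull C'" for C' i x
  proof -
    have fC': "finite C'" using C' C(1) finite_subset by blast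
    obtain u where u: "\<forall>j\<in>C'. 0 \<le> u j" "sum u C' = 1" "(\<Sum>j\<in>C'. u j *\<^sub>R j) = x"
      using x convex_hull_finite[OF fC'] by auto
    have "c i + w i \<bullet> x = (\<Sum>j\<in>C'. u j * (c i + w i \<bullet> j))"
      using u(2) by (simp add: u(3)[symmetric] inner_sum_right distrib_left sum.distrib flip: sum_distrib_right)
    also have "\<dots> = 0"
    proof (rule sum.neutral, rule ballI)
      fix j assume "j \<in> C'"
      then have "j \<in> C" "j \<noteq> i" using C' i(2) by auto
      then show "u j * (c i + w i \<bullet> j) = 0" using cw[OF i(1), of j] by simp
    qed
    finally show ?thesis .
  qed
  have "nodal_element K (P1 K) \<phi>"
  proof (rule nodal_element.intro, unfold V)
    show "polytope K" "interior K \<noteq> {}" by fact+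
    show "\<phi> i \<in> P1 K" for i by (auto simp: P1_def \<phi>_def)
    show "f x = (\<Sum>j\<in>C. f j * \<phi> j x)" if f: "f \<in> P1 K" and x: "x \<in> K" for f x
    proof -
      obtain e v where ev: "\<And>x. x \<in> K \<Longrightarrow> f x = e + v \<bullet> x" using f by (auto simp: P1_def)
      obtain u where u: "\<forall>j\<in>C. 0 \<le> u j \<and> \<phi> j x = u j" "sum u C = 1" "(\<Sum>j\<in>C. u j *\<^sub>R j) = x" using bary[OF x] by blast
      have "f x = e + v \<bullet> (\<Sum>j\<in>C. u j *\<^sub>R j)" using ev[OF x] u(3) by simp
      also have "\<dots> = (\<Sum>j\<in>C. u j * (e + v \<bullet> j))" by (rule aff[OF u(2)])
      also have "\<dots> = (\<Sum>j\<in>C. f j * \<phi> j x)" by (rule sum.cong) (use u(1) ev CK in auto)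
      finally show ?thesis .
    qed
    show "\<phi> i j = (if j = i then 1 else 0)" if "i \<in> C" "j \<in> C" for i j using cw[OF that] that CK by (auto simp: \<phi>_def)
    show "\<phi> i x = 0" if "x \<notin> K" for i x using that by (simp add: \<phi>_def)
    show "0 \<le> \<phi> i x" if "i \<in> C" "x \<in> K" for i x using bary[OF that(2)] that(1) by force
    show "(\<Sum>j\<in>C. \<phi> j x) = 1" if x: "x \<in> K" for x
    proof -
      obtain u where u: "\<forall>j\<in>C. 0 \<le> u j \<and> \<phi> j x = u j" "sum u C = 1" using bary[OF x] by blast
      have "(\<Sum>j\<in>C. \<phi> j x) = sum u C" by (rule sum.cong) (use u(1) in auto)
      then show ?thesis using u(2) by simp
    qed
    show "C1_on K (\<phi> i)" for i unfolding C1_on_def using der by (intro exI[of _ "\<lambda>_. w i"]) auto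
    show "\<phi> i x = 0" if F: "F facet_of K" and i: "i \<in> C" "i \<notin> F" and x: "x \<in> F" for F i x
    proof -
      obtain C' where C': "C' \<subseteq> C" "F = convex hull C'" using face[OF F] by blast
      have "i \<notin> C'" using i C' hull_inc by fastforce
      then have "c i + w i \<bullet> x = 0" using zero[OF C'(1) i(1)] x C'(2) by blast
      then show ?thesis by (simp add: \<phi>_def)
    qed
    show "0 < \<phi> j x" if F: "F facet_of K" and j: "j \<in> C" "j \<in> F" and x: "x \<in> rel_interior F" for F j x
    proof -
      obtain C' where C': "C' \<subseteq> C" "F = convex hull C'"
        using face[OF F] by blast
      have "j \<in> C'"
      proof (rule ccontr)
        assume "j \<notin> C'"
        then have "c j + w j \<bullet> j = 0" using zero[OF C'(1) j(1)] j(2) C'(2) by blast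
        then show False using cw[OF j(1) j(1)] by simp
      qed
      have indep: "\<not> affine_dependent C'" using C(2) C'(1) affine_independent_subset by blast
      have fC': "finite C'" using C' C(1) finite_subset by blast
      obtain u where u: "\<forall>j\<in>C'. 0 < u j" "sum u C' = 1" "(\<Sum>j\<in>C'. u j *\<^sub>R j) = x"
        using x rel_interior_convex_hull_explicit[OF indep] C'(2) by auto
      have "c j + w j \<bullet> x = (\<Sum>l\<in>C'. u l * (c j + w j \<bullet> l))"
        using u(2) by (simp add: u(3)[symmetric] inner_sum_right distrib_left sum.distrib flip: sum_distrib_right)
      also have "\<dots> = (\<Sum>l\<in>C'. if l = j then u l else 0)"
        by (rule sum.cong) (use cw[OF j(1)] C'(1) in auto)
      also have "\<dots> = u j" using fC' \<open>j \<in> C'\<close> by simp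
      finally have "c j + w j \<bullet> x = u j" .
      moreover have "x \<in> K" using x rel_interior_subset F facet_of_imp_subset by blast
      ultimately show ?thesis using u(1) \<open>j \<in> C'\<close> by (simp add: \<phi>_def)
    qed
    show "grad K (\<phi> i) x \<noteq> 0" if F: "F facet_of K" and i: "i \<in> C" "i \<notin> F" and x: "x \<in> rel_interior F" for F i x
    proof -
      have "x \<in> K" using x rel_interior_subset F facet_of_imp_subset by blast
      obtain C' where C': "C' \<subseteq> C" "F = convex hull C'"
        using face[OF F] by blast
      then obtain j where "j \<in> C'" using facet_nonempty[OF F] by fastforce
      then have j: "j \<in> C" "j \<noteq> i" using C' i(2) hull_inc[of j C'] by auto
      have "w i \<noteq> 0" using cw[OF i(1) i(1)] cw[OF i(1) j(1)] j(2) by auto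
      then show ?thesis using gr[OF \<open>x \<in> K\<close>] by simp
    qed
    show "(\<exists>w. \<forall>x\<in>K. grad K (\<phi> i) x = w) \<or> (\<exists>j\<in>C. \<forall>F. F facet_of K \<longrightarrow> \<not> (i \<in> F \<and> j \<in> F))" for i
      using gr by blast
  qed
  then show ?thesis by blast
qed


section \<open>Images of the cube\<close>

lemma multilinear_C1:
  fixes q :: "real^'n \<Rightarrow> real"
  assumes q: "q \<in> multilinear"
  obtains Dq where "continuous_on UNIV Dq" "\<And>z. (q has_derivative (\<lambda>v. Dq z \<bullet> v)) (at z)"
proof -
  obtain c :: "'n set \<Rightarrow> real" where c: "\<And>x. q x = (\<Sum>S\<in>UNIV. c S * (\<Prod>i\<in>S. x $ i))"
    using q by (auto simp: multilinear_def)
  define Dq where "Dq z = (\<Sum>S\<in>UNIV. c S *\<^sub>R (\<Sum>i\<in>S. (\<Prod>j\<in>S-{i}. z $ j) *\<^sub>R axis i (1::real)))" for z :: "real^'n"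
  have "continuous_on UNIV Dq" unfolding Dq_def by (intro continuous_intros)
  moreover have "(q has_derivative (\<lambda>v. Dq z \<bullet> v)) (at z)" for z
  proof -
    have "((\<lambda>x. \<Sum>S\<in>UNIV. c S * (\<Prod>i\<in>S. x $ i)) has_derivative
      (\<lambda>v. \<Sum>S\<in>UNIV. c S * (\<Sum>i\<in>S. v $ i * (\<Prod>j\<in>S-{i}. z $ j)))) (at z)"
      by (intro has_derivative_sum has_derivative_mult_right has_derivative_prod bounded_linear.has_derivative[OF bounded_linear_vec_nth] has_derivative_ident)
    then show ?thesis
      unfolding c[abs_def] Dq_def by (simp add: inner_sum_left inner_axis' mult.commute)
  qed
  ultimately show ?thesis using that by blast
qed

definition cube_vertex :: "'n::finite set \<Rightarrow> real^'n" where
  "cube_vertex A = (\<chi> k. if k \<in> A then 1 else 0)"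

definition cube_shape :: "'n::finite set \<Rightarrow> real^'n \<Rightarrow> real" where
  "cube_shape A z = (\<Prod>k\<in>UNIV. if k \<in> A then z $ k else 1 - z $ k)"

text \<open>Expand the product over the set \<open>A\<close> of coordinates at which the first
  summand is chosen. Constant \<open>f\<close> gives the partition of unity, and suitable
  \<open>f\<close> gives the interpolation of monomials.\<close>

lemma cube_shape_sum:
  fixes z :: "real^'n"
  shows "(\<Sum>A\<in>UNIV. (\<Prod>k\<in>UNIV. f k (k \<in> A)) * cube_shape A z) =
    (\<Prod>k\<in>UNIV. f k True * z $ k + f k False * (1 - z $ k))"
proof -
  have "(\<Prod>k\<in>UNIV. f k True * z $ k + f k False * (1 - z $ k)) =
    (\<Sum>A\<in>Pow UNIV. (\<Prod>k\<in>A. f k True * z $ k) * (\<Prod>k\<in>UNIV - A. f k False * (1 - z $ k)))"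
    by (rule prod_add) simp
  also have "\<dots> = (\<Sum>A\<in>UNIV. (\<Prod>k\<in>UNIV. f k (k \<in> A)) * cube_shape A z)"
  proof (rule sum.cong)
    fix A :: "'n set"
    have "(\<Prod>k\<in>A. f k True * z $ k) * (\<Prod>k\<in>UNIV - A. f k False * (1 - z $ k)) =
      (\<Prod>k\<in>A. f k (k \<in> A) * (if k \<in> A then z $ k else 1 - z $ k)) * (\<Prod>k\<in>UNIV - A. f k (k \<in> A) * (if k \<in> A then z $ k else 1 - z $ k))"
      by (intro arg_cong2[where f="(*)"] prod.cong) auto
    also have "\<dots> = (\<Prod>k\<in>UNIV. f k (k \<in> A) * (if k \<in> A then z $ k else 1 - z $ k))"
      by (subst prod.subset_diff[of A UNIV]) (auto simp: mult.commute)
    finally show "(\<Prod>k\<in>A. f k True * z $ k) * (\<Prod>k\<in>UNIV - A. f k False * (1 - z $ k)) = (\<Prod>k\<in>UNIV. f k (k \<in> A)) * cube_shape A z"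
      by (simp add: cube_shape_def prod.distrib)
  qed simp
  finally show ?thesis by simp
qed

lemma cube_shape_multilinear: "cube_shape (A :: 'n::finite set) \<in> multilinear"
proof -
  define s where "s k = (if k \<in> A then 1 else -1 :: real)" for k
  define t where "t k = (if k \<in> A then 0 else 1 :: real)" for k
  have "cube_shape A z = (\<Sum>S\<in>UNIV. ((\<Prod>k\<in>S. s k) * (\<Prod>k\<in>UNIV-S. t k)) * (\<Prod>i\<in>S. z $ i))" for z
  proof -
    have "cube_shape A z = (\<Prod>k\<in>UNIV. s k * z $ k + t k)"
      unfolding cube_shape_def by (rule prod.cong) (auto simp: s_def t_def)
    also have "\<dots> = (\<Sum>S\<in>Pow UNIV. (\<Prod>k\<in>S. s k * z $ k) * (\<Prod>k\<in>UNIV - S. t k))" by (rule prod_add) simp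
    finally show ?thesis by (simp add: prod.distrib mult_ac)
  qed
  then show ?thesis unfolding multilinear_def
    by (intro CollectI exI[of _ "\<lambda>S. (\<Prod>k\<in>S. s k) * (\<Prod>k\<in>UNIV-S. t k)"]) blast
qed

lemma cube_shape_vertex: "cube_shape A (cube_vertex B) = (if A = B then 1 else 0)"
proof (cases "A = B")
  case True
  then show ?thesis by (auto simp: cube_shape_def cube_vertex_def intro!: prod.neutral)
next
  case False
  then obtain k where "k \<in> A \<longleftrightarrow> k \<notin> B" by blast
  then show ?thesis using False by (auto simp: cube_shape_def cube_vertex_def intro!: exI[of _ k] prod_zero)
qed

lemma multilinear_cube_expand:
  fixes q :: "real^'n \<Rightarrow> real"
  assumes q: "q \<in> multilinear"
  shows "q z = (\<Sum>A\<in>UNIV. q (cube_vertex A) * cube_shape A z)"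
proof -
  obtain c :: "'n set \<Rightarrow> real" where c: "\<And>x. q x = (\<Sum>S\<in>UNIV. c S * (\<Prod>i\<in>S. x $ i))"
    using q by (auto simp: multilinear_def)
  have mon: "(\<Prod>i\<in>S. z $ i) = (\<Sum>A\<in>UNIV. (\<Prod>i\<in>S. cube_vertex A $ i) * cube_shape A z)" for S :: "'n set"
  proof -
    \<comment> \<open>\<open>f k b\<close> is the \<open>k\<close>-th factor of the monomial at a
      vertex whose \<open>k\<close>-th coordinate is \<open>b\<close>: the coordinate itself for
      \<open>k\<close> in \<open>S\<close>, and one otherwise.\<close>
    define f where "f k b = (if k \<in> S \<and> \<not> b then 0 else 1 :: real)" for k b
    have "(\<Prod>i\<in>S. cube_vertex A $ i) = (\<Prod>k\<in>UNIV. f k (k \<in> A))" for A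
    proof -
      have "(\<Prod>k\<in>UNIV. f k (k \<in> A)) = (\<Prod>k\<in>S. f k (k \<in> A))"
        by (rule prod.mono_neutral_right) (auto simp: f_def)
      also have "\<dots> = (\<Prod>i\<in>S. cube_vertex A $ i)" by (rule prod.cong) (auto simp: f_def cube_vertex_def)
      finally show ?thesis by simp
    qed
    then have "(\<Sum>A\<in>UNIV. (\<Prod>i\<in>S. cube_vertex A $ i) * cube_shape A z) = (\<Prod>k\<in>UNIV. f k True * z $ k + f k False * (1 - z $ k))"
      by (simp add: cube_shape_sum)
    also have "\<dots> = (\<Prod>k\<in>S. f k True * z $ k + f k False * (1 - z $ k))"
      by (rule prod.mono_neutral_right) (auto simp: f_def)
    also have "\<dots> = (\<Prod>i\<in>S. z $ i)" by (rule prod.cong) (auto simp: f_def)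
    finally show ?thesis by simp
  qed
  have "q z = (\<Sum>S\<in>UNIV. \<Sum>A\<in>UNIV. c S * ((\<Prod>i\<in>S. cube_vertex A $ i) * cube_shape A z))"
    unfolding c mon by (simp add: sum_distrib_left)
  also have "\<dots> = (\<Sum>A\<in>UNIV. \<Sum>S\<in>UNIV. c S * ((\<Prod>i\<in>S. cube_vertex A $ i) * cube_shape A z))"
    by (rule sum.swap)
  also have "\<dots> = (\<Sum>A\<in>UNIV. q (cube_vertex A) * cube_shape A z)"
    unfolding c by (simp add: sum_distrib_right mult.assoc)
  finally show ?thesis .
qed

lemma cube_mem: "z \<in> cbox 0 (1 :: real^'n) \<longleftrightarrow> (\<forall>k. 0 \<le> z $ k \<and> z $ k \<le> 1)"
  by (simp add: mem_box_cart)

lemma cube_face: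
  fixes b :: real
  assumes b: "b = 0 \<or> b = 1"
  shows "{z \<in> cbox 0 (1 :: real^'n). z $ k = b} face_of cbox 0 1"
proof -
  have in_eq: "z $ k = axis k 1 \<bullet> z" for z :: "real^'n" by (simp add: inner_axis')
  have eq: "{z \<in> cbox 0 (1 :: real^'n). z $ k = b} = cbox 0 1 \<inter> {z. axis k 1 \<bullet> z = b}"
    using in_eq by auto
  show ?thesis unfolding eq
  proof (cases "b = 0")
    case True
    show "cbox 0 1 \<inter> {z. axis k (1::real) \<bullet> z = b} face_of cbox 0 1"
      by (rule face_of_Int_supporting_hyperplane_ge) (use True in \<open>auto simp: cube_mem in_eq[symmetric]\<close>)
  next
    case False
    then show "cbox 0 1 \<inter> {z. axis k (1::real) \<bullet> z = b} face_of cbox 0 1"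
      using b by (intro face_of_Int_supporting_hyperplane_le) (auto simp: cube_mem in_eq[symmetric])
  qed
qed

text \<open>A relative interior point of a proper face lies on the boundary of the cube, so one of
  its coordinates is 0 or 1. A face that contains such a point contains all of
  \<open>G\<close>.\<close>

lemma cube_proper_face:
  assumes G: "G face_of cbox 0 (1 :: real^'n)" "G \<noteq> {}" "G \<noteq> cbox 0 1"
  obtains k b where "b = 0 \<or> b = 1" "G \<subseteq> {z \<in> cbox 0 1. z $ k = b}"
proof -
  have convG: "convex G" using G face_of_imp_convex convex_box by blast
  then obtain z where z: "z \<in> rel_interior G" using G(2) rel_interior_eq_empty by blast
  then have zG: "z \<in> G" using rel_interior_subset by blast
  have GQ: "G \<subseteq> cbox 0 1" using G face_of_imp_subset by blast
  have "G \<inter> interior (cbox 0 1) = {}" by (rule face_of_disjoint_interior[OF G(1,3)])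
  then have "z \<notin> box 0 1" using zG by (auto simp: interior_cbox)
  then obtain k where k: "\<not> (0 < z $ k \<and> z $ k < 1)" by (auto simp: mem_box_cart)
  have "z \<in> cbox 0 1" using zG GQ by blast
  then have "0 \<le> z $ k \<and> z $ k \<le> 1" unfolding cube_mem by blast
  then have b: "z $ k = 0 \<or> z $ k = 1" using k by linarith
  have "G \<subseteq> {x \<in> cbox 0 1. x $ k = z $ k}"
    by (rule subset_of_face_of[OF cube_face[OF b] GQ]) (use z \<open>z \<in> cbox 0 1\<close> in auto)
  then show ?thesis using that b by blast
qed

lemma cube_extreme_point:
  "z extreme_point_of cbox 0 (1 :: real^'n) \<longleftrightarrow> (\<exists>A. z = cube_vertex A)"
proof
  assume z: "z extreme_point_of cbox 0 1"
  then have zQ: "z \<in> cbox 0 1" by (simp add: extreme_point_of_def)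
  have "z $ k = 0 \<or> z $ k = 1" for k
  proof (rule ccontr)
    assume "\<not> (z $ k = 0 \<or> z $ k = 1)"
    then have zk: "0 < z $ k" "z $ k < 1" using zQ by (auto simp: cube_mem less_le)
    \<comment> \<open>The largest perturbation of the \<open>k\<close>-th coordinate that stays in
      the cube in both directions.\<close>
    define e where "e = min (z $ k) (1 - z $ k)"
    have e: "e > 0" "e \<le> z $ k" "e \<le> 1 - z $ k" using zk by (auto simp: e_def)
    define p where "p = z + e *\<^sub>R axis k 1"
    define m where "m = z - e *\<^sub>R axis k 1"
    have pk: "p $ j = z $ j + (if j = k then e else 0)" "m $ j = z $ j - (if j = k then e else 0)" for j
      by (auto simp: p_def m_def axis_def)
    have pm: "p \<in> cbox 0 1" "m \<in> cbox 0 1" using zQ e by (auto simp: cube_mem pk)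
    have "p $ k \<noteq> m $ k" using e pk[of k] by simp
    then have "p \<noteq> m" by auto
    moreover have "z = (1 - 1/2) *\<^sub>R m + (1/2) *\<^sub>R p" by (simp add: vec_eq_iff pk field_simps)
    ultimately have "z \<in> open_segment m p" by (auto simp: in_segment intro!: exI[of _ "1/2"])
    then show False using z pm by (auto simp: extreme_point_of_def)
  qed
  then have "z = cube_vertex {k. z $ k = 1}" by (auto simp: cube_vertex_def vec_eq_iff)
  then show "\<exists>A. z = cube_vertex A" by blast
next
  assume "\<exists>A. z = cube_vertex A"
  then obtain A where A: "z = cube_vertex A" by blast
  show "z extreme_point_of cbox 0 1"
    unfolding extreme_point_of_def
  proof (intro conjI ballI notI)
    show "z \<in> cbox 0 1" using A by (auto simp: cube_mem cube_vertex_def)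
    fix a b :: "real^'n" assume ab: "a \<in> cbox 0 1" "b \<in> cbox 0 1" "z \<in> open_segment a b"
    then obtain t where t: "0 < t" "t < 1" "z = (1 - t) *\<^sub>R a + t *\<^sub>R b" "a \<noteq> b" by (auto simp: in_segment)
    have "a $ k = b $ k" for k
    proof -
      have zk: "z $ k = (1 - t) * a $ k + t * b $ k" using t by simp
      have bd: "0 \<le> a $ k" "a $ k \<le> 1" "0 \<le> b $ k" "b $ k \<le> 1" using ab by (auto simp: cube_mem)
      show ?thesis
      proof (cases "k \<in> A")
        case True
        then have "(1 - t) * (1 - a $ k) + t * (1 - b $ k) = 0" using zk A by (simp add: cube_vertex_def algebra_simps)
        moreover have "0 \<le> (1 - t) * (1 - a $ k)" "0 \<le> t * (1 - b $ k)" using bd t by auto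
        ultimately have "(1 - t) * (1 - a $ k) = 0" "t * (1 - b $ k) = 0" by linarith+
        then show ?thesis using t by auto
      next
        case False
        then have "(1 - t) * a $ k + t * b $ k = 0" using zk A by (simp add: cube_vertex_def)
        moreover have "0 \<le> (1 - t) * a $ k" "0 \<le> t * b $ k" using bd t by auto
        ultimately have "(1 - t) * a $ k = 0" "t * b $ k = 0" by linarith+
        then show ?thesis using t by auto
      qed
    qed
    then show False using t(4) by (simp add: vec_eq_iff)
  qed
qed

lemma cube_shape_bounds:
  assumes "z \<in> cbox 0 (1 :: real^'n)"
  shows "0 \<le> cube_shape A z"
  using assms by (auto simp: cube_shape_def cube_mem intro!: prod_nonneg)

lemma cube_shape_partition: "(\<Sum>A\<in>UNIV. cube_shape A (z :: real^'n)) = 1"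
  using cube_shape_sum[of "\<lambda>_ _. 1" z] by simp

text \<open>On the line through \<open>m\<close> along axis \<open>k\<close> the shape function is
  linear and vanishes at \<open>m\<close>. Its slope is, up to sign, the product of the other
  factors, which is positive since the other coordinates of \<open>m\<close> are strictly between 0
  and 1.\<close>

lemma cube_shape_derivative_on_face:
  fixes m :: "real^'n"
  assumes mk: "m $ k = b" and m: "\<And>l. l \<noteq> k \<Longrightarrow> 0 < m $ l \<and> m $ l < 1"
    and b: "b = 0 \<or> b = 1" and A: "cube_vertex A $ k \<noteq> b"
    and D: "(cube_shape A has_derivative D) (at m)"
  shows "D (axis k 1) \<noteq> 0"
proof -
  define s where "s = (if k \<in> A then 1 else -1 :: real)"
  define p where "p = (\<Prod>l\<in>UNIV-{k}. if l \<in> A then m $ l else 1 - m $ l)"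
  have line: "cube_shape A (m + t *\<^sub>R axis k 1) = t * (s * p)" for t
  proof -
    have "cube_shape A (m + t *\<^sub>R axis k 1) = (\<Prod>l\<in>UNIV. if l = k then (if k \<in> A then b + t else 1 - (b + t)) else if l \<in> A then m $ l else 1 - m $ l)"
      unfolding cube_shape_def by (rule prod.cong) (auto simp: mk axis_def)
    also have "\<dots> = (if k \<in> A then b + t else 1 - (b + t)) *
        (\<Prod>l\<in>UNIV-{k}. if l = k then (if k \<in> A then b + t else 1 - (b + t)) else if l \<in> A then m $ l else 1 - m $ l)"
      by (subst prod.remove[of UNIV k]) auto
    also have "(\<Prod>l\<in>UNIV-{k}. if l = k then (if k \<in> A then b + t else 1 - (b + t)) else if l \<in> A then m $ l else 1 - m $ l) = p"
      unfolding p_def by (rule prod.cong) auto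
    also have "(if k \<in> A then b + t else 1 - (b + t)) = t * s"
      using A b by (auto simp: s_def cube_vertex_def split: if_splits)
    finally show ?thesis by simp
  qed
  have "((\<lambda>t. m + t *\<^sub>R axis k (1::real)) has_derivative (\<lambda>t. t *\<^sub>R axis k 1)) (at 0)"
    by (auto intro!: derivative_eq_intros)
  moreover have "(cube_shape A has_derivative D) (at (m + 0 *\<^sub>R axis k 1))" using D by simp
  ultimately have "((\<lambda>t. cube_shape A (m + t *\<^sub>R axis k 1)) has_derivative (\<lambda>t. D (t *\<^sub>R axis k 1))) (at 0)"
    by (rule has_derivative_compose)
  then have "((\<lambda>t. t * (s * p)) has_derivative (\<lambda>t. D (t *\<^sub>R axis k 1))) (at 0)" by (simp add: line)
  moreover have "((\<lambda>t. t * (s * p)) has_derivative (\<lambda>t. t * (s * p))) (at 0)"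
    by (auto intro!: derivative_eq_intros)
  ultimately have "(\<lambda>t. D (t *\<^sub>R axis k 1)) = (\<lambda>t. t * (s * p))" by (rule has_derivative_unique)
  then have "D (1 *\<^sub>R axis k 1) = 1 * (s * p)" by (rule fun_cong)
  moreover have "p > 0" unfolding p_def by (intro prod_pos) (use m in auto)
  then have "s * p \<noteq> 0" by (simp add: s_def)
  ultimately show ?thesis by simp
qed

text \<open>By the chain rule the gradient \<open>w\<close> in physical coordinates solves a linear
  system with the transposed Jacobian and right-hand side \<open>Dq\<close>. So \<open>w\<close> is
  continuous up to the boundary, and it can vanish only where \<open>Dq\<close> does, which later
  transfers the nonvanishing of gradients from the cube to the element.\<close>

lemma compose_inverse_C1:
  fixes \<Phi> :: "real^'n \<Rightarrow> real^'n" and q :: "real^'n \<Rightarrow> real"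
  assumes \<Phi>: "\<And>j. (\<lambda>z. \<Phi> z $ j) \<in> multilinear" and inj: "inj_on \<Phi> Q" and Q: "compact Q"
    and det: "\<And>z. z \<in> Q \<Longrightarrow> det (matrix (frechet_derivative \<Phi> (at z))) \<noteq> 0"
    and q: "\<And>z. (q has_derivative (\<lambda>v. Dq z \<bullet> v)) (at z)" "continuous_on UNIV Dq"
  shows "\<exists>w. continuous_on (\<Phi> ` Q) w \<and> (\<forall>z\<in>Q. w (\<Phi> z) = 0 \<longrightarrow> Dq z = 0) \<and>
    (\<forall>x\<in>\<Phi> ` Q. ((\<lambda>x. q (inv_into Q \<Phi> x)) has_derivative (\<lambda>v. w x \<bullet> v)) (at x within \<Phi> ` Q))"
proof -
  have "\<exists>D. continuous_on UNIV D \<and> (\<forall>z. ((\<lambda>z. \<Phi> z $ j) has_derivative (\<lambda>v. D z \<bullet> v)) (at z))" for j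
    using multilinear_C1[OF \<Phi>[of j]] by metis
  then obtain D where D: "\<And>j. continuous_on UNIV (D j)" "\<And>j z. ((\<lambda>z. \<Phi> z $ j) has_derivative (\<lambda>v. D j z \<bullet> v)) (at z)"
    by metis
  define J where "J z = (\<chi> j. D j z)" for z
  have Jv: "J z *v v = (\<chi> j. D j z \<bullet> v)" for z v
    by (simp add: J_def matrix_vector_mult_def inner_vec_def)
  have d\<Phi>: "(\<Phi> has_derivative (\<lambda>v. J z *v v)) (at z)" for z
    unfolding Jv by (subst has_derivative_componentwise_within) (auto simp: Basis_vec_def inner_axis D)
  have fd: "frechet_derivative \<Phi> (at z) = (\<lambda>v. J z *v v)" for z
    using frechet_derivative_at[OF d\<Phi>] by simp
  have detJ: "det (J z) \<noteq> 0" if "z \<in> Q" for z using det[OF that] by (simp add: fd)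
  have cont\<Phi>: "continuous_on S \<Phi>" for S
    by (intro continuous_at_imp_continuous_on ballI has_derivative_continuous[OF d\<Phi>])
  define g where "g = inv_into Q \<Phi>"
  have g\<Phi>: "g (\<Phi> z) = z" if "z \<in> Q" for z using that inj by (simp add: g_def)
  have contg: "continuous_on (\<Phi> ` Q) g"
    by (rule continuous_on_inv[OF cont\<Phi> Q]) (use g\<Phi> in auto)
  \<comment> \<open>Cramer's rule writes the solution of the transposed system by determinants, so
    its continuity follows from that of their entries.\<close>
  define W where "W z = (\<chi> k. det (\<chi> i j. if j = k then Dq z $ i else transpose (J z) $ i $ j) / det (transpose (J z)))" for z
  have W: "transpose (J z) *v W z = Dq z" if "z \<in> Q" for z
    using cramer[of "transpose (J z)" "W z" "Dq z"] detJ[OF that] by (simp add: W_def)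
  have contJ: "continuous_on UNIV (\<lambda>z. J z $ i $ j)" for i j
    unfolding J_def by simp (rule continuous_on_component[OF D(1)])
  have contW: "continuous_on Q W"
  proof -
    have cD: "continuous_on Q (\<lambda>z. Dq z $ i)" for i
      by (rule continuous_on_component) (rule continuous_on_subset[OF q(2)], simp)
    have cJ: "continuous_on Q (\<lambda>z. J z $ i $ j)" for i j
      by (rule continuous_on_subset[OF contJ]) simp
    have cJt: "continuous_on Q (\<lambda>z. if p then Dq z $ i else transpose (J z) $ i $ j)" for p i j
      using cD cJ by (cases p) (auto simp: transpose_def)
    then have c1: "continuous_on Q (\<lambda>z. det (\<chi> i j. if j = k then Dq z $ i else transpose (J z) $ i $ j))" for k
      unfolding det_def vec_lambda_beta by (intro continuous_intros cJt)
    have c2: "continuous_on Q (\<lambda>z. det (J z))"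
      unfolding det_def by (intro continuous_intros cJ)
    show ?thesis unfolding W_def det_transpose
      by (intro continuous_on_vec_lambda continuous_on_divide c1 c2) (use detJ in auto)
  qed
  have der: "((\<lambda>x. q (g x)) has_derivative (\<lambda>v. W z \<bullet> v)) (at (\<Phi> z) within \<Phi> ` Q)" if z: "z \<in> Q" for z
  proof -
    obtain B where B: "J z ** B = mat 1" "B ** J z = mat 1"
      using detJ[OF z] unfolding invertible_det_nz[symmetric] invertible_def by blast
    have "(g has_derivative (\<lambda>v. B *v v)) (at (\<Phi> z) within \<Phi> ` Q)"
    proof (rule has_derivative_inverse_within)
      show "(\<Phi> has_derivative (\<lambda>v. J z *v v)) (at z within Q)" by (rule has_derivative_at_withinI[OF d\<Phi>])
      show "continuous (at (\<Phi> z) within \<Phi> ` Q) g" using contg z by (auto simp: continuous_on_eq_continuous_within)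
      show "linear (\<lambda>v. B *v v)" by simp
      show "(\<lambda>v. B *v v) \<circ> (\<lambda>v. J z *v v) = id"
        using B(2) by (auto simp: fun_eq_iff matrix_vector_mul_assoc)
    qed (use z g\<Phi> in auto)
    moreover have "(q has_derivative (\<lambda>v. Dq z \<bullet> v)) (at (g (\<Phi> z)))" using q(1) g\<Phi>[OF z] by simp
    ultimately have "((\<lambda>x. q (g x)) has_derivative (\<lambda>v. Dq z \<bullet> (B *v v))) (at (\<Phi> z) within \<Phi> ` Q)"
      by (rule has_derivative_compose)
    moreover have "Dq z \<bullet> (B *v v) = W z \<bullet> v" for v
    proof -
      have "Dq z \<bullet> (B *v v) = W z \<bullet> (J z *v (B *v v))"
        using W[OF z] by (metis dot_lmul_matrix vector_transpose_matrix transpose_transpose)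
      also have "J z *v (B *v v) = v"
        using B(1) by (simp add: matrix_vector_mul_assoc)
      finally show ?thesis .
    qed
    ultimately show ?thesis by simp
  qed
  show ?thesis
  proof (intro exI[of _ "\<lambda>x. W (g x)"] conjI ballI)
    show "continuous_on (\<Phi> ` Q) (\<lambda>x. W (g x))"
      by (rule continuous_on_compose2[OF contW contg]) (use g\<Phi> in auto)
    show "W (g (\<Phi> z)) = 0 \<longrightarrow> Dq z = 0" if "z \<in> Q" for z
      using W[OF that] g\<Phi>[OF that] by auto
    fix x assume "x \<in> \<Phi> ` Q"
    then obtain z where z: "z \<in> Q" "x = \<Phi> z" by blast
    then show "((\<lambda>x. q (inv_into Q \<Phi> x)) has_derivative (\<lambda>v. W (g x) \<bullet> v)) (at x within \<Phi> ` Q)"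
      using der[OF z(1)] g\<Phi>[OF z(1)] by (simp add: g_def)
  qed
qed

text \<open>The cube face that corresponds to \<open>F\<close> lies in a coordinate face. The image
  of the latter is a proper face of \<open>K\<close> containing \<open>F\<close>, and maximality of
  facets forces equality.\<close>

lemma cube_map_facet:
  fixes K :: "(real^'n) set"
  assumes \<Phi>: "cube_map \<Phi> K" and F: "F facet_of K"
  obtains k b where "b = 0 \<or> b = 1" "F = \<Phi> ` {z \<in> cbox 0 1. z $ k = b}"
proof -
  have inj: "inj_on \<Phi> (cbox 0 1)" and Keq: "K = \<Phi> ` cbox 0 1" and poly: "polytope K"
    and faces: "(\<lambda>F. \<Phi> ` F) ` {F. F face_of cbox 0 1} = {F. F face_of K}"
    using \<Phi> by (auto simp: cube_map_def)
  have "F face_of K" "F \<noteq> {}" "F \<noteq> K" using F facet_of_irrefl by (auto simp: facet_of_def)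
  then obtain G where G: "G face_of cbox 0 1" "F = \<Phi> ` G" using faces by blast
  have "G \<noteq> {}" "G \<noteq> cbox 0 1" using G \<open>F \<noteq> {}\<close> \<open>F \<noteq> K\<close> Keq by auto
  then obtain k b where kb: "b = 0 \<or> b = 1" "G \<subseteq> {z \<in> cbox 0 1. z $ k = b}"
    using cube_proper_face[OF G(1)] by metis
  define H where "H = \<Phi> ` {z \<in> cbox 0 1. z $ k = b}"
  have HK: "H face_of K" using cube_face[OF kb(1)] faces unfolding H_def by blast
  have FH: "F \<subseteq> H" using G kb by (auto simp: H_def)
  have "H \<noteq> K"
  proof
    assume "H = K"
    \<comment> \<open>A vertex of the cube off the coordinate face; by injectivity its image is
      missed, so the image face is proper.\<close>
    define z :: "real^'n" where "z = cube_vertex (if b = 0 then UNIV else {})"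
    have z: "z \<in> cbox 0 1" "z $ k \<noteq> b" using kb by (auto simp: z_def cube_mem cube_vertex_def)
    then have "\<Phi> z \<in> H" using \<open>H = K\<close> Keq by blast
    then obtain y where "y \<in> cbox 0 1" "y $ k = b" "\<Phi> z = \<Phi> y" by (auto simp: H_def)
    then show False using z inj by (auto simp: inj_on_def)
  qed
  have "F = H" by (rule facet_of_maximal[OF polytope_imp_convex[OF poly] F HK \<open>H \<noteq> K\<close> FH])
  then show ?thesis using that kb(1) by (simp add: H_def)
qed

text \<open>Vertices are singleton faces, and the correspondence of faces together with injectivity
  preserves singletons.\<close>

lemma cube_map_vertices:
  fixes K :: "(real^'n) set"
  assumes \<Phi>: "cube_map \<Phi> K"
  shows "vertices K = range (\<lambda>A. \<Phi> (cube_vertex A))"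
proof -
  have inj: "inj_on \<Phi> (cbox 0 1)"
    and faces: "(\<lambda>F. \<Phi> ` F) ` {F. F face_of cbox 0 1} = {F. F face_of K}"
    using \<Phi> by (auto simp: cube_map_def)
  show ?thesis
  proof (intro equalityI subsetI)
    fix x assume "x \<in> vertices K"
    then have "{x} face_of K" by (simp add: vertices_def face_of_singleton)
    then obtain G where G: "G face_of cbox 0 1" "\<Phi> ` G = {x}" using faces by (metis (no_types, lifting) imageE mem_Collect_eq)
    then obtain z where z: "z \<in> G" "\<Phi> z = x" by blast
    have GQ: "G \<subseteq> cbox 0 1" using G face_of_imp_subset by blast
    have "G = {z}"
    proof -
      have "y = z" if "y \<in> G" for y
      proof -
        have "\<Phi> y = \<Phi> z" using that z G(2) by blast
        then show ?thesis using inj GQ that z(1) by (meson inj_on_def subsetD)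
      qed
      then show ?thesis using z(1) by blast
    qed
    then have "z extreme_point_of cbox 0 1" using G(1) face_of_singleton by blast
    then obtain A where "z = cube_vertex A" using cube_extreme_point by blast
    then show "x \<in> range (\<lambda>A. \<Phi> (cube_vertex A))" using z by blast
  next
    fix x assume "x \<in> range (\<lambda>A. \<Phi> (cube_vertex A))"
    then obtain A where A: "x = \<Phi> (cube_vertex A)" by blast
    have "{cube_vertex A} face_of cbox 0 1" using cube_extreme_point face_of_singleton by blast
    then have "\<Phi> ` {cube_vertex A} face_of K" using faces by blast
    then show "x \<in> vertices K" using A by (simp add: vertices_def face_of_singleton)
  qed
qed

lemma Q1_nodal_element:
  fixes K :: "(real^'n) set"
  assumes \<Phi>: "cube_map \<Phi> K"
  shows "\<exists>\<phi>. nodal_element K (Q1 \<Phi>) \<phi>"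
proof -
  define Q where "Q = cbox 0 (1 :: real^'n)"
  have ml: "\<And>j. (\<lambda>z. \<Phi> z $ j) \<in> multilinear" and inj: "inj_on \<Phi> Q"
    and det: "\<And>z. z \<in> Q \<Longrightarrow> det (matrix (frechet_derivative \<Phi> (at z))) \<noteq> 0"
    and poly: "polytope K" and Keq: "K = \<Phi> ` Q"
    using \<Phi> by (auto simp: cube_map_def Q_def)
  have compQ: "compact Q" by (simp add: Q_def)
  note V = cube_map_vertices[OF \<Phi>]
  define g where "g = inv_into Q \<Phi>"
  have vQ: "cube_vertex A \<in> Q" for A :: "'n set" by (auto simp: Q_def cube_mem cube_vertex_def)
  have g\<Phi>: "g (\<Phi> z) = z" if "z \<in> Q" for z using that inj by (simp add: g_def)
  have gK: "g x \<in> Q" "\<Phi> (g x) = x" if "x \<in> K" for x using that g\<Phi> by (auto simp: Keq)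
  \<comment> \<open>Recovers the index set \<open>A\<close> of the reference vertex from its
    image.\<close>
  define idx where "idx i = {k. g i $ k = 1}" for i
  have idx: "idx (\<Phi> (cube_vertex A)) = A" for A
    unfolding idx_def g\<Phi>[OF vQ] by (auto simp: cube_vertex_def)
  define \<phi> where "\<phi> i x = (if x \<in> K then cube_shape (idx i) (g x) else 0)" for i x
  have \<phi>\<Phi>: "\<phi> (\<Phi> (cube_vertex A)) (\<Phi> z) = cube_shape A z" if "z \<in> Q" for A z
    using that by (simp add: \<phi>_def idx g\<Phi> Keq)
  have sumV: "(\<Sum>j\<in>vertices K. h j) = (\<Sum>A\<in>UNIV. h (\<Phi> (cube_vertex A)))" for h :: "_ \<Rightarrow> real"
  proof -
    have "inj (\<lambda>A. \<Phi> (cube_vertex A))" by (rule inj_on_inverseI[of _ idx]) (simp add: idx)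
    then show ?thesis unfolding V by (simp add: sum.reindex)
  qed
  have contQ: "continuous_on Q \<Phi>"
  proof -
    have "continuous_on Q (\<lambda>z. \<Phi> z $ j)" for j
      using multilinear_C1[OF ml[of j]] by (metis has_derivative_continuous continuous_at_imp_continuous_on)
    then have "continuous_on Q (\<lambda>z. \<chi> j. \<Phi> z $ j)" by (rule continuous_on_vec_lambda)
    then show ?thesis by simp
  qed
  have int: "interior K \<noteq> {}"
  proof -
    have sub: "box 0 1 \<subseteq> Q" unfolding Q_def by (rule box_subset_cbox)
    have "open (\<Phi> ` box 0 1)"
      by (rule invariance_of_domain[OF continuous_on_subset[OF contQ sub] open_box inj_on_subset[OF inj sub]])
    moreover have "\<Phi> ` box 0 1 \<subseteq> K" using sub Keq by blast
    moreover have "(\<chi> i. 1/2) \<in> box 0 (1 :: real^'n)" by (simp add: mem_box_cart)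
    then have "\<Phi> ` box 0 1 \<noteq> {}" by blast
    ultimately show ?thesis using interior_maximal by blast
  qed
  have conv: "convex K" using poly by (rule polytope_imp_convex)
  have C1: "\<exists>w. continuous_on K w \<and> (\<forall>x\<in>K. (\<phi> i has_derivative (\<lambda>v. w x \<bullet> v)) (at x within K)) \<and>
     (\<forall>z\<in>Q. \<forall>D. (cube_shape (idx i) has_derivative D) (at z) \<longrightarrow> w (\<Phi> z) = 0 \<longrightarrow> D = (\<lambda>_. 0))" for i
  proof -
    obtain Dq where Dq: "continuous_on UNIV Dq" "\<And>z. (cube_shape (idx i) has_derivative (\<lambda>v. Dq z \<bullet> v)) (at z)"
      using multilinear_C1[OF cube_shape_multilinear[of "idx i"]] by metis
    obtain w where w: "continuous_on K w" "\<And>z. z \<in> Q \<Longrightarrow> w (\<Phi> z) = 0 \<Longrightarrow> Dq z = 0"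
      "\<And>x. x \<in> K \<Longrightarrow> ((\<lambda>x. cube_shape (idx i) (g x)) has_derivative (\<lambda>v. w x \<bullet> v)) (at x within K)"
      using compose_inverse_C1[OF ml inj compQ det Dq(2,1)] unfolding Keq[symmetric] g_def[symmetric] by blast
    show ?thesis
    proof (intro exI[of _ w] conjI ballI allI impI w(1))
      fix x assume x: "x \<in> K"
      show "(\<phi> i has_derivative (\<lambda>v. w x \<bullet> v)) (at x within K)"
        by (rule has_derivative_transform[OF x _ w(3)[OF x]]) (simp add: \<phi>_def)
    next
      fix z D assume z: "z \<in> Q" and D: "(cube_shape (idx i) has_derivative D) (at z)" and "w (\<Phi> z) = 0"
      then have "Dq z = 0" using w(2) by blast
      moreover have "D = (\<lambda>v. Dq z \<bullet> v)" by (rule has_derivative_unique[OF D Dq(2)])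
      ultimately show "D = (\<lambda>_. 0)" by (auto simp: fun_eq_iff)
    qed
  qed
  have on: "cube_vertex B $ k = b" if "\<Phi> (cube_vertex B) \<in> \<Phi> ` {z \<in> Q. z $ k = b}" for B k b
  proof -
    from that obtain z where z: "z \<in> Q" "z $ k = b" "\<Phi> (cube_vertex B) = \<Phi> z" by auto
    have "cube_vertex B = z" by (rule inj_onD[OF inj z(3) vQ z(1)])
    then show ?thesis using z(2) by simp
  qed
  \<comment> \<open>Relative interior points of a facet must come from points of the coordinate face
    with no further coordinate at 0 or 1; there the remaining factors of the shape functions are
    nonzero.\<close>
  have inner: "\<exists>z. z \<in> Q \<and> x = \<Phi> z \<and> z $ k = b \<and> (\<forall>l. l \<noteq> k \<longrightarrow> 0 < z $ l \<and> z $ l < 1)"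
    if F: "F facet_of K" and b: "b = 0 \<or> b = 1" and Fkb: "F = \<Phi> ` {z \<in> Q. z $ k = b}" and x: "x \<in> rel_interior F" for F k b x
  proof -
    have xF: "x \<in> F" using x rel_interior_subset by blast
    then obtain z where z: "z \<in> Q" "x = \<Phi> z" "z $ k = b" using Fkb by blast
    have "0 < z $ l \<and> z $ l < 1" if l: "l \<noteq> k" for l
    proof (rule ccontr)
      assume "\<not> (0 < z $ l \<and> z $ l < 1)"
      moreover have "0 \<le> z $ l \<and> z $ l \<le> 1" using z(1) unfolding Q_def cube_mem by blast
      ultimately have zl: "z $ l = 0 \<or> z $ l = 1" by linarith
      define G where "G = \<Phi> ` {y \<in> Q. y $ l = z $ l}"
      have "G \<in> (\<lambda>F. \<Phi> ` F) ` {F. F face_of cbox 0 1}" using cube_face[OF zl, of l] by (auto simp: G_def Q_def)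
      then have GK: "G face_of K" using \<Phi> by (simp add: cube_map_def)
      have "x \<in> G" using z by (auto simp: G_def)
      then have FG: "F \<subseteq> G" using subset_of_face_of[OF GK facet_of_imp_subset[OF F]] x by blast
      \<comment> \<open>A vertex on the \<open>k\<close>-face but off the \<open>l\<close>-face. It
        shows that \<open>F\<close> cannot be contained in the image of the
        \<open>l\<close>-face.\<close>
      define B where "B = (if b = 1 then {k} else {}) \<union> (if z $ l = 1 then {} else {l})"
      have Bk: "cube_vertex B $ k = b" "cube_vertex B $ l \<noteq> z $ l" using b zl l by (auto simp: B_def cube_vertex_def)
      then have "\<Phi> (cube_vertex B) \<in> G" using FG Fkb vQ by blast
      then have "cube_vertex B $ l = z $ l" unfolding G_def by (rule on)
      then show False using Bk by simp
    qed
    then show ?thesis using z by blast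
  qed
  have "nodal_element K (Q1 \<Phi>) \<phi>"
  proof
    show "polytope K" "interior K \<noteq> {}" by fact+
    show "\<phi> i \<in> Q1 \<Phi>" for i
      unfolding Q1_def Q_def[symmetric]
      by (intro CollectI bexI[of _ "cube_shape (idx i)"] ballI cube_shape_multilinear) (simp add: \<phi>_def Keq g\<Phi>)
    show "f x = (\<Sum>j\<in>vertices K. f j * \<phi> j x)" if f: "f \<in> Q1 \<Phi>" and x: "x \<in> K" for f x
    proof -
      obtain q where q: "q \<in> multilinear" "\<And>z. z \<in> Q \<Longrightarrow> f (\<Phi> z) = q z" using f by (auto simp: Q1_def Q_def)
      have "f x = q (g x)" using q(2)[of "g x"] gK[OF x] by simp
      also have "\<dots> = (\<Sum>A\<in>UNIV. q (cube_vertex A) * cube_shape A (g x))" by (rule multilinear_cube_expand[OF q(1)])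
      also have "\<dots> = (\<Sum>A\<in>UNIV. f (\<Phi> (cube_vertex A)) * \<phi> (\<Phi> (cube_vertex A)) x)"
        using x by (simp add: q(2)[OF vQ] \<phi>_def idx)
      finally show ?thesis by (simp add: sumV)
    qed
    show "\<phi> i j = (if j = i then 1 else 0)" if ij: "i \<in> vertices K" "j \<in> vertices K" for i j
    proof -
      obtain A B where AB: "i = \<Phi> (cube_vertex A)" "j = \<Phi> (cube_vertex B)" using ij V by blast
      have "j = i \<longleftrightarrow> A = B" using idx AB by metis
      then show ?thesis by (simp add: AB \<phi>\<Phi>[OF vQ] cube_shape_vertex)
    qed
    show "\<phi> i x = 0" if "x \<notin> K" for i x using that by (simp add: \<phi>_def)
    show "0 \<le> \<phi> i x" if "x \<in> K" for i x
      using cube_shape_bounds[OF gK(1)[OF that, unfolded Q_def], of "idx i"] by (simp add: \<phi>_def)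
    show "(\<Sum>j\<in>vertices K. \<phi> j x) = 1" if x: "x \<in> K" for x
      using x by (simp add: sumV \<phi>_def idx cube_shape_partition)
    show "C1_on K (\<phi> i)" for i unfolding C1_on_def using C1[of i] by blast
    show "\<phi> i x = 0" if F: "F facet_of K" and i: "i \<in> vertices K" "i \<notin> F" and x: "x \<in> F" for F i x
    proof -
      obtain k b where kb: "b = 0 \<or> b = 1" "F = \<Phi> ` {z \<in> Q. z $ k = b}" using cube_map_facet[OF \<Phi> F] unfolding Q_def by metis
      obtain A where A: "i = \<Phi> (cube_vertex A)" using i V by blast
      obtain z where z: "z \<in> Q" "z $ k = b" "x = \<Phi> z" using x kb by blast
      have "cube_vertex A $ k \<noteq> b" using i(2) kb(2) vQ A by blast
      then have "(if k \<in> A then z $ k else 1 - z $ k) = 0" using kb(1) z(2) by (auto simp: cube_vertex_def split: if_splits)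
      then have "cube_shape A z = 0" unfolding cube_shape_def by (intro prod_zero bexI[of _ k]) auto
      then show ?thesis by (simp add: A z(3) \<phi>\<Phi>[OF z(1)])
    qed
    show "0 < \<phi> j x" if F: "F facet_of K" and j: "j \<in> vertices K" "j \<in> F" and x: "x \<in> rel_interior F" for F j x
    proof -
      obtain k b where kb: "b = 0 \<or> b = 1" "F = \<Phi> ` {z \<in> Q. z $ k = b}" using cube_map_facet[OF \<Phi> F] unfolding Q_def by metis
      obtain B where B: "j = \<Phi> (cube_vertex B)" using j V by blast
      have Bk: "cube_vertex B $ k = b" by (rule on) (use j(2) kb(2) B in simp)
      obtain z where z: "z \<in> Q" "x = \<Phi> z" "z $ k = b" "\<And>l. l \<noteq> k \<Longrightarrow> 0 < z $ l \<and> z $ l < 1" using inner[OF F kb x] by blast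
      have "0 < (if l \<in> B then z $ l else 1 - z $ l)" for l
        using z(3,4) Bk kb(1) by (cases "l = k") (auto simp: cube_vertex_def split: if_splits)
      then have "0 < cube_shape B z" unfolding cube_shape_def by (intro prod_pos) auto
      then show ?thesis using \<phi>\<Phi>[OF z(1)] by (simp add: B z(2))
    qed
    show "grad K (\<phi> i) x \<noteq> 0" if F: "F facet_of K" and i: "i \<in> vertices K" "i \<notin> F" and x: "x \<in> rel_interior F" for F i x
    proof
      assume g0: "grad K (\<phi> i) x = 0"
      obtain k b where kb: "b = 0 \<or> b = 1" "F = \<Phi> ` {z \<in> Q. z $ k = b}" using cube_map_facet[OF \<Phi> F] unfolding Q_def by metis
      obtain A where A: "i = \<Phi> (cube_vertex A)" using i V by blast
      have Ak: "cube_vertex A $ k \<noteq> b" using i(2) kb(2) vQ A by blast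
      obtain z where z: "z \<in> Q" "x = \<Phi> z" "z $ k = b" "\<And>l. l \<noteq> k \<Longrightarrow> 0 < z $ l \<and> z $ l < 1" using inner[OF F kb x] by blast
      have xK: "x \<in> K" using z Keq by blast
      obtain w where w: "\<And>x. x \<in> K \<Longrightarrow> (\<phi> i has_derivative (\<lambda>v. w x \<bullet> v)) (at x within K)"
        "\<And>z D. z \<in> Q \<Longrightarrow> (cube_shape (idx i) has_derivative D) (at z) \<Longrightarrow> w (\<Phi> z) = 0 \<Longrightarrow> D = (\<lambda>_. 0)"
        using C1[of i] by blast
      have w0: "w (\<Phi> z) = 0" using grad_eqI[OF conv int xK w(1)[OF xK]] g0 z(2) by simp
      obtain Dq where Dq: "(cube_shape A has_derivative (\<lambda>v. Dq z \<bullet> v)) (at z)"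
        using multilinear_C1[OF cube_shape_multilinear[of A]] by metis
      have "(\<lambda>v. Dq z \<bullet> v) = (\<lambda>_. 0)" by (rule w(2)[OF z(1) _ w0]) (use Dq in \<open>simp add: A idx\<close>)
      then have "Dq z \<bullet> axis k 1 = 0" by (rule fun_cong)
      then show False using cube_shape_derivative_on_face[OF z(3,4) kb(1) Ak Dq] by simp
    qed
    show "(\<exists>w. \<forall>x\<in>K. grad K (\<phi> i) x = w) \<or> (\<exists>j\<in>vertices K. \<forall>F. F facet_of K \<longrightarrow> \<not> (i \<in> F \<and> j \<in> F))"
      if i: "i \<in> vertices K" for i
    proof (rule disjI2)
      obtain A where A: "i = \<Phi> (cube_vertex A)" using i V by blast
      show "\<exists>j\<in>vertices K. \<forall>F. F facet_of K \<longrightarrow> \<not> (i \<in> F \<and> j \<in> F)"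
      \<comment> \<open>Complementary vertices differ in every coordinate, so no coordinate face,
        and thus no facet, contains both.\<close>
      proof (intro bexI[of _ "\<Phi> (cube_vertex (- A))"] allI impI notI)
        show "\<Phi> (cube_vertex (- A)) \<in> vertices K" using V by blast
        fix F assume F: "F facet_of K" and both: "i \<in> F \<and> \<Phi> (cube_vertex (- A)) \<in> F"
        obtain k b where kb: "b = 0 \<or> b = 1" "F = \<Phi> ` {z \<in> Q. z $ k = b}" using cube_map_facet[OF \<Phi> F] unfolding Q_def by metis
        have "cube_vertex A $ k = b" "cube_vertex (- A) $ k = b" by (rule on; use both A kb(2) in simp)+
        then show False by (auto simp: cube_vertex_def split: if_splits)
      qed
    qed
  qed
  then show ?thesis by blast
qed


section \<open>Facets of a mesh\<close>

text \<open>At a boundary point the region below the graph is open and misses the domain, hence its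
  closure, and it comes arbitrarily close to the point. This excludes slits: a facet between two
  elements cannot lie on the boundary of the domain.\<close>

lemma lipschitz_interior_closure:
  fixes \<Omega> :: "(real^'n) set"
  assumes "lipschitz_domain \<Omega>"
  shows "interior (closure \<Omega>) = \<Omega>"
proof
  have op: "open \<Omega>" and lb: "lipschitz_boundary \<Omega>" using assms by (auto simp: lipschitz_domain_def)
  show "\<Omega> \<subseteq> interior (closure \<Omega>)" using op by (simp add: interior_maximal closure_subset)
  show "interior (closure \<Omega>) \<subseteq> \<Omega>"
  proof (rule ccontr)
    assume "\<not> interior (closure \<Omega>) \<subseteq> \<Omega>"
    then obtain x where x: "x \<in> interior (closure \<Omega>)" "x \<notin> \<Omega>" by blast
    then have "x \<in> frontier \<Omega>" using op interior_subset by (auto simp: frontier_def interior_open)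
    then obtain r e \<gamma> L where r: "r > 0" and e: "norm e = 1" and lip: "L-lipschitz_on {z. z \<bullet> e = 0} \<gamma>"
      and graph: "\<Omega> \<inter> ball x r = {y \<in> ball x r. \<gamma> (y - (y \<bullet> e) *\<^sub>R e) < y \<bullet> e}"
      using lb unfolding lipschitz_boundary_def by blast
    define p where "p y = y - (y \<bullet> e) *\<^sub>R e" for y
    have ee: "e \<bullet> e = 1" using e by (simp add: norm_eq_1)
    have cont: "continuous_on UNIV (\<lambda>y. \<gamma> (p y))"
      by (rule continuous_on_compose2[OF lipschitz_on_continuous_on[OF lip]])
         (auto simp: p_def ee inner_diff_left intro!: continuous_intros)
    define U where "U = ball x r \<inter> {y. y \<bullet> e < \<gamma> (p y)}"
    have "open {y. y \<bullet> e < \<gamma> (p y)}" by (intro open_Collect_less cont continuous_intros)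
    then have U: "open U" unfolding U_def by auto
    have "z \<notin> \<Omega>" if z: "z \<in> U" for z
    proof
      assume "z \<in> \<Omega>"
      then have "z \<in> \<Omega> \<inter> ball x r" using z by (simp add: U_def)
      then have "\<gamma> (p z) < z \<bullet> e" unfolding graph p_def by blast
      then show False using z by (simp add: U_def)
    qed
    then have "U \<inter> \<Omega> = {}" by blast
    then have U0: "U \<inter> closure \<Omega> = {}" using U open_Int_closure_eq_empty by blast
    obtain d where d: "d > 0" "ball x d \<subseteq> closure \<Omega>" using x(1) mem_interior by blast
    define s where "s = min d r / 2"
    have s: "0 < s" "s < d" "s < r" using d r by (auto simp: s_def)
    define y where "y = x - s *\<^sub>R e"
    have "dist x y = s" using s e by (simp add: y_def dist_norm)
    then have yb: "y \<in> ball x d" "y \<in> ball x r" using s by auto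
    have "p y = p x" by (simp add: p_def y_def ee algebra_simps)
    moreover have "x \<bullet> e \<le> \<gamma> (p x)" using graph x(2) r by (force simp: p_def)
    moreover have "y \<bullet> e = x \<bullet> e - s" by (simp add: y_def inner_diff_left ee)
    ultimately have "y \<in> U" using yb s by (simp add: U_def)
    then show False using U0 d yb by blast
  qed
qed

lemma facet_affine_hull:
  fixes K :: "(real^'n) set"
  assumes K: "polyhedron K" and int: "interior K \<noteq> {}" and F: "F facet_of K" and x: "x \<in> F"
  shows "affine hull F = {y. outward_normal K F \<bullet> y = outward_normal K F \<bullet> x}"
  by (rule facet_hyperplane[OF int F]) (use outward_normal_props(1,3)[OF K int F x] in auto)

text \<open>At a relative interior point of \<open>F\<close> the constraints of the other facets
  hold strictly, hence also nearby, so \<open>F\<close> alone decides membership in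
  \<open>K\<close>.\<close>

lemma facet_half_ball:
  fixes K :: "(real^'n) set"
  assumes K: "polytope K" and int: "interior K \<noteq> {}" and F: "F facet_of K" and x: "x \<in> rel_interior F"
  obtains e where "e > 0" "\<And>y. y \<in> ball x e \<Longrightarrow> outward_normal K F \<bullet> y \<le> outward_normal K F \<bullet> x \<Longrightarrow> y \<in> K"
proof -
  have ph: "polyhedron K" using K by (rule polytope_imp_polyhedron)
  have some: "(SOME y. y \<in> G) \<in> G" if "G facet_of K" for G using facet_nonempty[OF that] by (simp add: some_in_eq)
  have fin: "finite {G. G facet_of K}" using K by (rule finite_polytope_facets)
  have xF: "x \<in> F" using x rel_interior_subset by blast
  have xK: "x \<in> K" using xF F facet_of_imp_subset by blast
  define U where "U = (\<Inter>G\<in>{G. G facet_of K} - {F}. {y. outward_normal K G \<bullet> y < outward_normal K G \<bullet> (SOME y. y \<in> G)})"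
  have "open U" unfolding U_def using fin by (auto intro: open_halfspace_lt)
  moreover have "x \<in> U" unfolding U_def
  proof (intro INT_I CollectI)
    fix G assume G: "G \<in> {G. G facet_of K} - {F}"
    then have GK: "G facet_of K" by blast
    have "x \<notin> G"
    proof
      assume "x \<in> G"
      then have "F \<subseteq> G"
        using subset_of_face_of[OF facet_of_imp_face_of[OF GK] facet_of_imp_subset[OF F]] x by blast
      moreover have "F \<noteq> K" "G \<noteq> K" using F GK facet_of_irrefl by blast+
      ultimately have "F = G" using facet_of_maximal[OF polytope_imp_convex[OF K] F facet_of_imp_face_of[OF GK]] by blast
      then show False using G by blast
    qed
    then show "outward_normal K G \<bullet> x < outward_normal K G \<bullet> (SOME y. y \<in> G)"
      using outward_normal_props(2)[OF ph int GK some[OF GK] xK] outward_normal_props(3)[OF ph int GK some[OF GK]] xK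
      by (auto simp: less_le)
  qed
  ultimately obtain e where e: "e > 0" "ball x e \<subseteq> U" using open_contains_ball by blast
  show ?thesis
  proof (rule that[OF e(1)])
    fix y assume y: "y \<in> ball x e" "outward_normal K F \<bullet> y \<le> outward_normal K F \<bullet> x"
    have "outward_normal K F \<bullet> x = outward_normal K F \<bullet> (SOME y. y \<in> F)"
      using outward_normal_props(3)[OF ph int F some[OF F]] xF by blast
    then have "outward_normal K G \<bullet> y \<le> outward_normal K G \<bullet> (SOME y. y \<in> G)" if "G facet_of K" for G
    proof (cases "G = F")
      case False
      have "y \<in> U" using y(1) e(2) by blast
      then show ?thesis using False that unfolding U_def by (auto intro: less_imp_le)
    qed (use y in simp)
    then show "y \<in> K" using polytope_halfspaces[OF K int] by blast
  qed
qed

text \<open>The slabs on the two sides differ by a translation along the normal, which preserves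
  Lebesgue measure and does not change the projection. Hence the facet integral does not depend on
  the orientation.\<close>

lemma hyperplane_measure_flip:
  fixes n :: "real^'n"
  assumes n: "norm n = 1"
  shows "hyperplane_measure (- n) (- c) = hyperplane_measure n c"
proof (rule measure_eqI)
  show "sets (hyperplane_measure (- n) (- c)) = sets (hyperplane_measure n c)" by simp
  have nn: "n \<bullet> n = 1" using n by (simp add: norm_eq_1)
  have em: "emeasure (hyperplane_measure m d) A = emeasure lborel {z. d \<le> m \<bullet> z \<and> m \<bullet> z \<le> d + 1 \<and> z - (m \<bullet> z - d) *\<^sub>R m \<in> A}"
    if [measurable]: "A \<in> sets borel" for m d and A :: "(real^'n) set"
  proof -
    have [measurable]: "{z. d \<le> m \<bullet> z \<and> m \<bullet> z \<le> d + 1} \<in> sets (borel :: (real^'n) measure)" by measurable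
    have m[measurable]: "(\<lambda>z. z - (m \<bullet> z - d) *\<^sub>R m) \<in> restrict_space lborel {z. d \<le> m \<bullet> z \<and> m \<bullet> z \<le> d + 1} \<rightarrow>\<^sub>M borel"
      by (rule measurable_restrict_space1) measurable
    show ?thesis
      unfolding hyperplane_measure_def
      by (subst emeasure_distr[OF m that], subst emeasure_restrict_space)
         (auto simp: space_restrict_space intro!: arg_cong2[where f=emeasure])
  qed
  fix A assume "A \<in> sets (hyperplane_measure (- n) (- c))"
  then have A[measurable]: "A \<in> sets borel" by simp
  define S where "S = {z. - c \<le> - n \<bullet> z \<and> - n \<bullet> z \<le> - c + 1 \<and> z - (- n \<bullet> z - (- c)) *\<^sub>R (- n) \<in> A}"
  have [measurable]: "S \<in> sets borel" unfolding S_def by measurable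
  have "emeasure lborel S = emeasure (distr lborel borel ((+) (- n))) S" by (simp add: lborel_distr_plus)
  also have "\<dots> = emeasure lborel {z. - n + z \<in> S}" by (subst emeasure_distr) (auto simp: vimage_def)
  also have "{z. - n + z \<in> S} = {z. c \<le> n \<bullet> z \<and> n \<bullet> z \<le> c + 1 \<and> z - (n \<bullet> z - c) *\<^sub>R n \<in> A}"
    by (auto simp: S_def inner_add_right inner_diff_right nn algebra_simps)
  finally show "emeasure (hyperplane_measure (- n) (- c)) A = emeasure (hyperplane_measure n c) A"
    by (simp add: em[OF A] S_def)
qed

text \<open>Positivity at a single point spreads to a neighbourhood in the facet by continuity. The
  part of the slab above that neighbourhood contains a nonempty open set, which is not
  negligible.\<close>

lemma facet_integral_pos:
  fixes K :: "(real^'n) set" and f :: "real^'n \<Rightarrow> real"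
  assumes K: "polytope K" and int: "interior K \<noteq> {}" and F: "F facet_of K"
    and f: "continuous_on F f" and nonneg: "\<And>x. x \<in> F \<Longrightarrow> 0 \<le> f x" and x: "x \<in> F" "0 < f x"
  shows "0 < (LINT x:F|facet_measure K F. f x)"
proof -
  have ph: "polyhedron K" using K by (rule polytope_imp_polyhedron)
  define y0 where "y0 = (SOME y. y \<in> F)"
  have y0: "y0 \<in> F" using facet_nonempty[OF F] by (simp add: y0_def some_in_eq)
  define n where "n = outward_normal K F"
  define c where "c = n \<bullet> y0"
  note p = outward_normal_props[OF ph int F y0, folded n_def]
  have nn: "n \<bullet> n = 1" using p(1) by (simp add: norm_eq_1)
  have fm: "facet_measure K F = hyperplane_measure n c" by (simp add: facet_measure_def n_def c_def y0_def)
  have compF: "compact F" by (rule facet_compact[OF K F])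
  have convF: "convex F" using F facet_of_imp_face_of face_of_imp_convex by blast
  have FB: "F \<in> sets borel" using compF by (simp add: compact_imp_closed)
  define h where "h x = indicator F x * f x" for x
  have hm: "h \<in> borel_measurable borel"
    using borel_measurable_continuous_on_indicator[OF FB f] by (simp add: h_def[abs_def])
  have si: "set_integrable (facet_measure K F) F f" by (rule facet_set_integrable[OF K int F f])
  define k where "k z = indicator {z. c \<le> n \<bullet> z \<and> n \<bullet> z \<le> c + 1} z * h (z - (n \<bullet> z - c) *\<^sub>R n)" for z
  have ik: "integrable lborel k"
    using si hyperplane_measure_integral(2)[OF hm, of n c] by (simp add: set_integrable_def fm h_def[abs_def] k_def[abs_def])
  have eq: "(LINT x:F|facet_measure K F. f x) = (\<integral>z. k z \<partial>lborel)"
    using hyperplane_measure_integral(1)[OF hm, of n c] by (simp add: set_lebesgue_integral_def fm h_def[abs_def] k_def[abs_def])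
  have k0: "0 \<le> k z" for z using nonneg by (auto simp: k_def h_def indicator_def)
  have "(\<integral>z. k z \<partial>lborel) \<noteq> 0"
  proof
    assume "(\<integral>z. k z \<partial>lborel) = 0"
    then have ae: "AE z in lborel. k z = 0" using integral_nonneg_eq_0_iff_AE[OF ik] k0 by simp
    have "x \<in> closure (rel_interior F)" using x convF by (metis convex_closure_rel_interior closure_subset subsetD)
    obtain d where d: "d > 0" "\<And>y. y \<in> F \<Longrightarrow> dist y x < d \<Longrightarrow> 0 < f y"
    proof -
      have "\<forall>e>0. \<exists>d>0. \<forall>x'\<in>F. dist x' x < d \<longrightarrow> dist (f x') (f x) < e"
        using f x(1) by (auto simp: continuous_on_iff)
      then obtain d where "d > 0" "\<And>x'. x' \<in> F \<Longrightarrow> dist x' x < d \<Longrightarrow> dist (f x') (f x) < f x" using x(2) by blast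
      then show ?thesis using that[of d] by (force simp: dist_real_def abs_if split: if_splits)
    qed
    obtain y where y: "y \<in> rel_interior F" "dist y x < d"
      using \<open>x \<in> closure (rel_interior F)\<close> d(1) by (meson closure_approachable)
    obtain e where e: "e > 0" "ball y e \<inter> affine hull F \<subseteq> F"
      using y(1) mem_rel_interior_ball by blast
    have hull: "affine hull F = {z. n \<bullet> z = c}"
      using facet_affine_hull[OF ph int F y0] by (simp add: n_def c_def)
    define r where "r = min e (d - dist y x)"
    have r: "r > 0" using e y by (simp add: r_def)
    \<comment> \<open>The open cylinder of slab points that project near \<open>y\<close>. The
      radius \<open>r\<close> keeps the projections both in \<open>F\<close> and in the region
      around \<open>x\<close> where \<open>f\<close> is positive.\<close>
    define A where "A = {z. c < n \<bullet> z} \<inter> {z. n \<bullet> z < c + 1} \<inter> (\<lambda>z. z - (n \<bullet> z - c) *\<^sub>R n) -` ball y r"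
    have "open A" unfolding A_def
      by (intro open_Int open_halfspace_lt open_halfspace_gt open_vimage open_ball continuous_intros)
    moreover have "A \<noteq> {}"
    proof -
      have "y \<in> F" using y rel_interior_subset by blast
      then have "n \<bullet> y = c" using p(3) c_def by blast
      then have "y + (1/2) *\<^sub>R n \<in> A" using r by (simp add: A_def inner_add_right nn)
      then show ?thesis by blast
    qed
    ultimately have "\<not> negligible A" by (rule open_not_negligible)
    have pos: "k z > 0" if z: "z \<in> A" for z
    proof -
      define w where "w = z - (n \<bullet> z - c) *\<^sub>R n"
      have "n \<bullet> w = c" by (simp add: w_def inner_diff_right nn)
      moreover have wr: "dist y w < r" using z by (simp add: A_def w_def)
      ultimately have "w \<in> F" using e hull by (auto simp: r_def)
      moreover have "dist w x < d" using wr dist_triangle[of w x y] by (simp add: r_def dist_commute)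
      ultimately have "0 < f w" using d by blast
      then show ?thesis using z \<open>w \<in> F\<close> by (simp add: k_def h_def A_def w_def)
    qed
    obtain N where N: "N \<in> null_sets lborel" "{z \<in> space lborel. k z \<noteq> 0} \<subseteq> N"
      using ae by (auto elim!: AE_E simp: null_sets_def)
    have "A \<subseteq> N"
    proof
      fix z assume "z \<in> A"
      then have "k z \<noteq> 0" using pos by force
      then show "z \<in> N" using N(2) by auto
    qed
    moreover have "negligible N" using N(1) negligible_iff_null_sets null_sets_completionI by blast
    ultimately show False using \<open>\<not> negligible A\<close> negligible_subset by blast
  qed
  moreover have "0 \<le> (\<integral>z. k z \<partial>lborel)" using k0 by simp
  ultimately show ?thesis using eq by linarith
qed


section \<open>Interior and boundary facets of a mesh\<close>

locale dg_mesh =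
  fixes \<Omega> :: "(real^'n) set" and T :: "'n cell set" and P :: "'n cell \<Rightarrow> (real^'n \<Rightarrow> real) set"
  assumes domain: "lipschitz_domain \<Omega>" and mesh: "fe_mesh \<Omega> T P"
begin

lemma finite_T: "finite T" using mesh by (simp add: fe_mesh_def)
lemma Union_T: "\<Union>T = closure \<Omega>" using mesh by (simp add: fe_mesh_def)

lemma T_disjoint: "K \<in> T \<Longrightarrow> K' \<in> T \<Longrightarrow> K \<noteq> K' \<Longrightarrow> interior K \<inter> interior K' = {}"
  and T_face: "K \<in> T \<Longrightarrow> K' \<in> T \<Longrightarrow> K \<noteq> K' \<Longrightarrow> (K \<inter> K') face_of K"
  using mesh by (simp_all add: fe_mesh_def)

lemma element: assumes "K \<in> T" shows "nodal_element K (P K) (shape P K)"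
proof -
  consider "\<forall>K\<in>T. int CARD('n) simplex K \<and> P K = P1 K" | "\<forall>K\<in>T. \<exists>\<Phi>. cube_map \<Phi> K \<and> P K = Q1 \<Phi>"
    using mesh unfolding fe_mesh_def by blast
  then have "\<exists>\<phi>. nodal_element K (P K) \<phi>"
  proof cases
    case 1
    then show ?thesis using assms P1_nodal_element[of K] by metis
  next
    case 2
    then show ?thesis using assms Q1_nodal_element by metis
  qed
  then obtain \<phi> where "nodal_element K (P K) \<phi>" by blast
  then interpret E: nodal_element K "P K" \<phi> .
  show ?thesis
    by (rule E.cong) (simp add: shape_def E.the_shape_eq)
qed

lemma interior_closure: "interior (closure \<Omega>) = \<Omega>" by (rule lipschitz_interior_closure[OF domain])
lemma open_\<Omega>: "open \<Omega>" using domain by (simp add: lipschitz_domain_def)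

lemma element_subset: "K \<in> T \<Longrightarrow> K \<subseteq> closure \<Omega>" using Union_T by blast

lemma interior_element_subset: "K \<in> T \<Longrightarrow> interior K \<subseteq> \<Omega>"
  using interior_mono[OF element_subset] interior_closure by blast

lemma T_poly: "K \<in> T \<Longrightarrow> polytope K" and T_int: "K \<in> T \<Longrightarrow> interior K \<noteq> {}"
  using nodal_element.poly[OF element] nodal_element.int[OF element] by blast+

lemma T_polyhedron: "K \<in> T \<Longrightarrow> polyhedron K" by (simp add: T_poly polytope_imp_polyhedron)
lemma T_convex: "K \<in> T \<Longrightarrow> convex K" by (simp add: T_poly polytope_imp_convex)
lemma T_compact: "K \<in> T \<Longrightarrow> compact K" by (simp add: T_poly polytope_imp_compact)

lemma rel_interior_facet: "F facet_of K \<Longrightarrow> \<exists>x. x \<in> rel_interior F"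
  using face_of_imp_convex[OF facet_of_imp_face_of] facet_nonempty rel_interior_eq_empty by blast

lemma normal_unit:
  assumes "K \<in> T" "F facet_of K"
  shows "outward_normal K F \<bullet> outward_normal K F = 1"
proof -
  obtain x where x: "x \<in> F" using facet_nonempty[OF assms(2)] by blast
  show ?thesis using outward_normal_props(1)[OF T_polyhedron[OF assms(1)] T_int[OF assms(1)] assms(2) x] by (simp add: norm_eq_1)
qed

lemma normals_same_or_opposite:
  assumes K: "K \<in> T" "K' \<in> T" and F: "F facet_of K" "F facet_of K'"
  shows "outward_normal K' F = outward_normal K F \<or> outward_normal K' F = - outward_normal K F"
proof -
  obtain x where x: "x \<in> F" using facet_nonempty[OF F(1)] by blast
  note p = outward_normal_props(1)[OF T_polyhedron T_int _ x]
  show ?thesis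
    by (rule unit_normals_eq_or_opposite[OF p[OF K(1) K(1) F(1)] p[OF K(2) K(2) F(2)] refl refl, of x])
       (use facet_affine_hull[OF T_polyhedron[OF K(1)] T_int[OF K(1)] F(1) x]
         facet_affine_hull[OF T_polyhedron[OF K(2)] T_int[OF K(2)] F(2) x] in simp)
qed

text \<open>With equal normals both elements would contain the same half-ball at a relative interior
  point of the facet, against disjointness of their interiors.\<close>

lemma normals_opposite:
  assumes K: "K \<in> T" "K' \<in> T" "K \<noteq> K'" and F: "F facet_of K" "F facet_of K'"
  shows "outward_normal K' F = - outward_normal K F"
proof (rule ccontr)
  assume "outward_normal K' F \<noteq> - outward_normal K F"
  then have eq: "outward_normal K' F = outward_normal K F"
    using normals_same_or_opposite[OF K(1,2) F] by blast
  define n where "n = outward_normal K F"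
  obtain x where x: "x \<in> rel_interior F" using rel_interior_facet[OF F(1)] by blast
  then have xF: "x \<in> F" using rel_interior_subset by blast
  obtain e where e: "e > 0" "\<And>y. y \<in> ball x e \<Longrightarrow> n \<bullet> y \<le> n \<bullet> x \<Longrightarrow> y \<in> K"
    using facet_half_ball[OF T_poly[OF K(1)] T_int[OF K(1)] F(1) x] by (metis n_def)
  obtain e' where e': "e' > 0" "\<And>y. y \<in> ball x e' \<Longrightarrow> n \<bullet> y \<le> n \<bullet> x \<Longrightarrow> y \<in> K'"
    using facet_half_ball[OF T_poly[OF K(2)] T_int[OF K(2)] F(2) x] eq by (metis n_def)
  define U where "U = ball x (min e e') \<inter> {y. n \<bullet> y < n \<bullet> x}"
  have "open U" unfolding U_def by (intro open_Int open_ball open_halfspace_lt)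
  moreover have "U \<subseteq> K" "U \<subseteq> K'" using e e' by (auto simp: U_def)
  ultimately have "U \<subseteq> interior K \<inter> interior K'" by (simp add: interior_maximal)
  then have "U = {}" using T_disjoint[OF K] by blast
  have n1: "norm n = 1" using outward_normal_props(1)[OF T_polyhedron T_int F(1) xF] K by (simp add: n_def)
  then have nn: "n \<bullet> n = 1" by (simp add: norm_eq_1)
  define d where "d = min e e' / 2"
  have d: "0 < d" "d < min e e'" using e(1) e'(1) by (auto simp: d_def)
  have "dist x (x - d *\<^sub>R n) = d" using n1 d by (simp add: dist_norm)
  then have "x - d *\<^sub>R n \<in> U" using d by (simp add: U_def inner_diff_right nn)
  then show False using \<open>U = {}\<close> by blast
qed

lemma in_adjacent: "K \<in> adjacent T F \<longleftrightarrow> K \<in> T \<and> F facet_of K"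
  by (auto simp: adjacent_def)

text \<open>Three unit normals cannot be pairwise opposite, so a third element cannot share the
  facet.\<close>

lemma adjacent_pair:
  assumes K: "K \<in> T" "K' \<in> T" "K \<noteq> K'" and F: "F facet_of K" "F facet_of K'"
  shows "adjacent T F = {K, K'}"
proof
  show "{K, K'} \<subseteq> adjacent T F" using assms by (auto simp: in_adjacent)
  show "adjacent T F \<subseteq> {K, K'}"
  proof
    fix L assume "L \<in> adjacent T F"
    then have L: "L \<in> T" "F facet_of L" by (auto simp: in_adjacent)
    show "L \<in> {K, K'}"
    proof (rule ccontr)
      assume "L \<notin> {K, K'}"
      then have "outward_normal L F = - outward_normal K F" "outward_normal L F = - outward_normal K' F"
        using normals_opposite[OF K(1) L(1) _ F(1) L(2)] normals_opposite[OF K(2) L(1) _ F(2) L(2)] by auto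
      moreover have "outward_normal K' F = - outward_normal K F" by (rule normals_opposite[OF K F])
      ultimately have "outward_normal K F = - outward_normal K F" by simp
      then have "outward_normal K F \<bullet> outward_normal K F = - (outward_normal K F \<bullet> outward_normal K F)"
        by (metis inner_minus_left)
      then show False using normal_unit[OF K(1) F(1)] by simp
    qed
  qed
qed

lemma interior_facetD:
  assumes F: "F \<in> interior_facets T" and K: "K \<in> T" "F facet_of K"
  obtains K' where "K' \<in> T" "K' \<noteq> K" "F facet_of K'" "adjacent T F = {K, K'}" "outward_normal K' F = - outward_normal K F"
proof -
  obtain K1 K2 where K12: "K1 \<in> T" "K2 \<in> T" "K1 \<noteq> K2" "F facet_of K1" "F facet_of K2"
    using F by (auto simp: interior_facets_def)
  then have "\<exists>K'. K' \<in> T \<and> K' \<noteq> K \<and> F facet_of K'" by (cases "K = K1") auto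
  then obtain K' where K': "K' \<in> T" "K' \<noteq> K" "F facet_of K'" by blast
  then show ?thesis using that adjacent_pair[OF K(1) K'(1) _ K(2) K'(3)] normals_opposite[OF K(1) K'(1) _ K(2) K'(3)] by blast
qed

text \<open>The half-balls on the two sides fill a ball inside the closure of the domain. Its centre
  then belongs to the domain itself, because the domain is the interior of its closure.\<close>

lemma interior_not_boundary:
  assumes F: "F \<in> interior_facets T" shows "F \<notin> boundary_facets T \<Omega>"
proof
  assume bd: "F \<in> boundary_facets T \<Omega>"
  obtain K K' where K: "K \<in> T" "K' \<in> T" "K \<noteq> K'" and FK: "F facet_of K" "F facet_of K'"
    using F by (auto simp: interior_facets_def)
  define n where "n = outward_normal K F"
  have n': "outward_normal K' F = - n" using normals_opposite[OF K FK] by (simp add: n_def)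
  obtain x where x: "x \<in> rel_interior F" using rel_interior_facet[OF FK(1)] by blast
  obtain e where e: "e > 0" "\<And>y. y \<in> ball x e \<Longrightarrow> n \<bullet> y \<le> n \<bullet> x \<Longrightarrow> y \<in> K"
    using facet_half_ball[OF T_poly[OF K(1)] T_int[OF K(1)] FK(1) x] by (metis n_def)
  obtain e' where e': "e' > 0" "\<And>y. y \<in> ball x e' \<Longrightarrow> (- n) \<bullet> y \<le> (- n) \<bullet> x \<Longrightarrow> y \<in> K'"
    using facet_half_ball[OF T_poly[OF K(2)] T_int[OF K(2)] FK(2) x] n' by metis
  have "ball x (min e e') \<subseteq> closure \<Omega>"
  proof
    fix y assume y: "y \<in> ball x (min e e')"
    show "y \<in> closure \<Omega>"
    proof (cases "n \<bullet> y \<le> n \<bullet> x")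
      case True
      then have "y \<in> K" using y e(2) by simp
      then show ?thesis using element_subset[OF K(1)] by blast
    next
      case False
      then have "y \<in> K'" using y e'(2) by simp
      then show ?thesis using element_subset[OF K(2)] by blast
    qed
  qed
  then have "x \<in> interior (closure \<Omega>)" using e(1) e'(1) by (meson mem_interior min_less_iff_conj)
  then have "x \<in> \<Omega>" by (simp add: interior_closure)
  moreover have "x \<in> frontier \<Omega>" using bd x rel_interior_subset by (auto simp: boundary_facets_def)
  ultimately show False using open_\<Omega> by (simp add: frontier_def interior_open)
qed

lemma boundary_facetD:
  assumes F: "F \<in> boundary_facets T \<Omega>" and K: "K \<in> T" "F facet_of K"
  shows "adjacent T F = {K}"
proof -
  have "L = K" if "L \<in> adjacent T F" for L
  proof (rule ccontr)
    assume "L \<noteq> K"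
    then have "F \<in> interior_facets T" using that K unfolding interior_facets_def in_adjacent by blast
    then show False using interior_not_boundary F by blast
  qed
  then show ?thesis using K in_adjacent by blast
qed

lemma common_facet_eq_Int:
  assumes K: "K \<in> T" "K' \<in> T" "K \<noteq> K'" and F: "F facet_of K" "F \<subseteq> K \<inter> K'"
  shows "F = K \<inter> K'"
proof (rule facet_of_maximal[OF T_convex[OF K(1)] F(1) T_face[OF K] _ F(2)])
  show "K \<inter> K' \<noteq> K"
  proof
    assume "K \<inter> K' = K"
    then have "interior K \<subseteq> interior K'" by (metis Int_lower2 interior_mono)
    then show False using T_disjoint[OF K] T_int[OF K(1)] by blast
  qed
qed

text \<open>If no other element has \<open>F\<close> as a facet, then none reaches its relative
  interior. Near such a point the closure of the domain is just \<open>K\<close>, so the point could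
  lie in the domain only by being interior to \<open>K\<close>.\<close>

lemma facet_cases:
  assumes K: "K \<in> T" and F: "F facet_of K"
  shows "F \<in> interior_facets T \<or> F \<in> boundary_facets T \<Omega>"
proof (rule disjCI)
  assume nb: "F \<notin> boundary_facets T \<Omega>"
  show "F \<in> interior_facets T"
  proof (rule ccontr)
    assume ni: "F \<notin> interior_facets T"
    have FKface: "F face_of K" "F \<subseteq> K" "F \<noteq> K"
      using F facet_of_imp_face_of facet_of_imp_subset facet_of_irrefl by blast+
    have dimK: "aff_dim L = int DIM(real^'n)" if "L \<in> T" for L using T_int[OF that] low_dim_interior by metis
    have "rel_interior F \<subseteq> frontier \<Omega>"
    proof
      fix x assume x: "x \<in> rel_interior F"
      then have xF: "x \<in> F" using rel_interior_subset by blast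
      \<comment> \<open>Another element through \<open>x\<close> would meet \<open>K\<close> in a
        face containing \<open>F\<close>, hence equal to \<open>F\<close>. As both elements are
        full-dimensional, \<open>F\<close> would be a facet of it too.\<close>
      have notin: "x \<notin> K'" if K': "K' \<in> T" "K' \<noteq> K" for K'
      proof
        assume "x \<in> K'"
        have f1: "(K \<inter> K') face_of K" using T_face[OF K K'(1)] K' by blast
        have f2: "(K \<inter> K') face_of K'" using T_face[OF K'(1) K] K' by (simp add: Int_commute)
        have FKK: "F \<subseteq> K \<inter> K'"
          by (rule subset_of_face_of[OF f1 FKface(2)]) (use x xF \<open>x \<in> K'\<close> FKface in blast)
        have "F = K \<inter> K'" by (rule common_facet_eq_Int[OF K K'(1) _ F FKK]) (use K' in blast)
        then have "F facet_of K'" using f2 F dimK[OF K] dimK[OF K'(1)] by (simp add: facet_of_def)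
        then show False using ni K K' F by (auto simp: interior_facets_def)
      qed
      have "closed (\<Union>(T - {K}))" using finite_T T_compact by (intro closed_Union) (auto simp: compact_imp_closed)
      then have "open (- \<Union>(T - {K}))" by (rule open_Compl)
      moreover have "x \<in> - \<Union>(T - {K})" using notin by blast
      ultimately obtain e where e: "e > 0" "ball x e \<subseteq> - \<Union>(T - {K})" using open_contains_ball by metis
      have "x \<notin> \<Omega>"
      proof
        assume "x \<in> \<Omega>"
        then obtain d where d: "d > 0" "ball x d \<subseteq> \<Omega>" using open_\<Omega> open_contains_ball by blast
        have "ball x (min d e) \<subseteq> K"
        proof
          fix y assume y: "y \<in> ball x (min d e)"
          then have "y \<in> ball x d" by simp
          then have "y \<in> closure \<Omega>" using d(2) closure_subset by blast
          then have "y \<in> \<Union>T" unfolding Union_T .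
          then show "y \<in> K" using y e(2) by auto
        qed
        then have "x \<in> interior K" using d(1) e(1) by (meson mem_interior min_less_iff_conj)
        then show False using face_of_disjoint_interior[OF FKface(1,3)] xF by blast
      qed
      moreover have "x \<in> closure \<Omega>" using xF FKface(2) element_subset[OF K] by blast
      ultimately show "x \<in> frontier \<Omega>" using open_\<Omega> by (simp add: frontier_def interior_open)
    qed
    then have "closure (rel_interior F) \<subseteq> frontier \<Omega>" by (simp add: closure_minimal)
    moreover have "closure (rel_interior F) = F"
      using convex_closure_rel_interior[of F] facet_compact[OF T_poly[OF K] F] FKface(1) face_of_imp_convex
      by (metis closure_closed compact_imp_closed)
    ultimately show False using nb K F by (auto simp: boundary_facets_def)
  qed
qed

lemma finite_facets: "finite {F. \<exists>K\<in>T. F facet_of K}"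
proof -
  have "{F. \<exists>K\<in>T. F facet_of K} = (\<Union>K\<in>T. {F. F facet_of K})" by blast
  then show ?thesis using finite_T T_poly by (simp add: finite_polytope_facets)
qed

lemma finite_interior_facets: "finite (interior_facets T)"
  by (rule finite_subset[OF _ finite_facets]) (auto simp: interior_facets_def)

lemma finite_boundary_facets: "finite (boundary_facets T \<Omega>)"
  by (rule finite_subset[OF _ finite_facets]) (auto simp: boundary_facets_def)

text \<open>The element chosen inside \<open>facet_integral\<close> may lie on the other side of
  \<open>F\<close>; flipping the normal leaves the measure unchanged.\<close>

lemma facet_integral_eq:
  assumes K: "K \<in> T" "F facet_of K"
  shows "facet_integral T F f = (LINT x:F|facet_measure K F. f x)"
proof -
  define L where "L = (SOME K. K \<in> adjacent T F)"
  have "L \<in> adjacent T F" unfolding L_def by (rule someI[of _ K]) (use K in \<open>simp add: in_adjacent\<close>)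
  then have L: "L \<in> T" "F facet_of L" by (auto simp: in_adjacent)
  obtain x where x: "x \<in> F" using facet_nonempty[OF K(2)] by blast
  have n1: "norm (outward_normal K F) = 1"
    using outward_normal_props(1)[OF T_polyhedron T_int _ x] K by blast
  have "facet_measure L F = facet_measure K F"
    using normals_same_or_opposite[OF K(1) L(1) K(2) L(2)]
  proof
    assume "outward_normal L F = - outward_normal K F"
    then show ?thesis using hyperplane_measure_flip[OF n1] by (simp add: facet_measure_def)
  qed (simp add: facet_measure_def)
  then show ?thesis
    unfolding facet_integral_def facet_normal_def L_def[symmetric] by (simp add: facet_measure_def)
qed

lemma facet_normal_boundary:
  assumes "F \<in> boundary_facets T \<Omega>" "K \<in> T" "F facet_of K"
  shows "facet_normal T F = outward_normal K F"
  using boundary_facetD[OF assms] by (simp add: facet_normal_def)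

lemma finite_nodes: "finite (nodes T)"
proof -
  have "nodes T = (\<Union>K\<in>T. (\<lambda>x. (x, K)) ` vertices K)" by (auto simp: nodes_def)
  then show ?thesis using finite_T nodal_element.finite_vertices[OF element] by simp
qed

end


section \<open>The bilinear forms\<close>

lemma set_integral_sum:
  fixes f :: "'b \<Rightarrow> 'a \<Rightarrow> real"
  assumes f: "\<And>b. b \<in> S \<Longrightarrow> set_integrable M A (f b)" and eq: "\<And>x. x \<in> A \<Longrightarrow> g x = (\<Sum>b\<in>S. c b * f b x)"
  shows "(LINT x:A|M. g x) = (\<Sum>b\<in>S. c b * (LINT x:A|M. f b x))"
proof -
  have "(LINT x:A|M. g x) = (\<integral>x. (\<Sum>b\<in>S. c b * (indicator A x *\<^sub>R f b x)) \<partial>M)"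
    unfolding set_lebesgue_integral_def
    by (rule Bochner_Integration.integral_cong) (auto simp: indicator_def eq)
  also have "\<dots> = (\<Sum>b\<in>S. \<integral>x. c b * (indicator A x *\<^sub>R f b x) \<partial>M)"
    by (rule Bochner_Integration.integral_sum) (use f in \<open>auto simp: set_integrable_def\<close>)
  finally show ?thesis by (simp add: set_lebesgue_integral_def)
qed

lemma set_integral_cong_on: "(\<And>x. x \<in> A \<Longrightarrow> f x = g x) \<Longrightarrow> (LINT x:A|M. f x) = (LINT x:A|M. (g x :: real))"
  unfolding set_lebesgue_integral_def by (rule Bochner_Integration.integral_cong) (auto simp: indicator_def)

lemma set_integral_zero_on: "(\<And>x. x \<in> A \<Longrightarrow> f x = 0) \<Longrightarrow> (LINT x:A|M. (f x :: real)) = 0"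
  using set_integral_cong_on[of A f "\<lambda>_. 0" M] by (simp add: set_lebesgue_integral_def)

lemma set_integral_nonneg_on: "(\<And>x. x \<in> A \<Longrightarrow> 0 \<le> f x) \<Longrightarrow> 0 \<le> (LINT x:A|M. (f x :: real))"
  unfolding set_lebesgue_integral_def by (rule integral_nonneg_AE) (auto simp: indicator_def)

abbreviation facets :: "(real^'n) set \<Rightarrow> (real^'n) set set" where
  "facets K \<equiv> {F. F facet_of K}"

definition supported_on :: "'n cell \<Rightarrow> 'n broken \<Rightarrow> bool" where
  "supported_on K v \<longleftrightarrow> (\<forall>L. L \<noteq> K \<longrightarrow> v L = (\<lambda>x. 0))"

lemma supported_basis: "supported_on (snd a) (basis P a)"
  by (auto simp: supported_on_def basis_def)

locale dg_scheme = dg_mesh +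
  fixes \<beta> :: "real^'n \<Rightarrow> real^'n" and \<mu> :: real and h :: "(real^'n) set \<Rightarrow> real"
  assumes velocity: "solenoidal_on \<Omega> \<beta>" and diffusion: "0 \<le> \<mu>"
    and conforming: "conforming_boundary T \<Omega> \<beta>"
    and length: "\<And>F. F \<in> interior_facets T \<union> boundary_facets T \<Omega> \<Longrightarrow> 0 < h F"
begin

abbreviation inF where "inF \<equiv> inflow_facets T \<Omega> \<beta>"
abbreviation outF where "outF \<equiv> outflow_facets T \<Omega> \<beta>"
abbreviation bdF where "bdF \<equiv> boundary_facets T \<Omega>"
abbreviation intF where "intF \<equiv> interior_facets T"

lemma in_out: "inF \<union> outF = bdF" using conforming by (simp add: conforming_boundary_def)

lemma in_out_disjoint: "F \<in> inF \<Longrightarrow> F \<notin> outF"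
proof
  assume F: "F \<in> inF" "F \<in> outF"
  then obtain K where "F facet_of K" by (auto simp: inflow_facets_def boundary_facets_def)
  then obtain x where "x \<in> rel_interior F" using rel_interior_facet by blast
  then show False using F by (force simp: inflow_facets_def outflow_facets_def)
qed

lemma facet_trichotomy:
  assumes "K \<in> T" "F facet_of K"
  obtains (int) "F \<in> intF" "F \<notin> inF" "F \<notin> outF" | (inflow) "F \<in> inF" "F \<in> bdF" "F \<notin> intF" "F \<notin> outF"
    | (out) "F \<in> outF" "F \<in> bdF" "F \<notin> intF" "F \<notin> inF"
  using facet_cases[OF assms] in_out in_out_disjoint interior_not_boundary by blast

lemma cont_\<beta>: "K \<in> T \<Longrightarrow> continuous_on K \<beta>"
proof -
  assume K: "K \<in> T"
  have "continuous_on (closure \<Omega>) \<beta>" using velocity by (simp add: solenoidal_on_def)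
  then show ?thesis by (rule continuous_on_subset) (rule element_subset[OF K])
qed

lemma cont_\<beta>_facet: "K \<in> T \<Longrightarrow> F facet_of K \<Longrightarrow> continuous_on F \<beta>"
  using cont_\<beta> continuous_on_subset facet_of_imp_subset by blast

text \<open>Divergence theorem for the field \<open>f * \<beta>\<close>: since \<beta> is
  solenoidal, its divergence is \<open>\<beta> \<bullet> grad f\<close>, and this is continuous up
  to the boundary although the derivative of \<beta> need not be.\<close>

lemma div_element:
  assumes K: "K \<in> T" and f: "C1_on K f"
  shows "(LINT x:K|lborel. \<beta> x \<bullet> grad K f x) = (\<Sum>F\<in>facets K. LINT x:F|facet_measure K F. f x * (\<beta> x \<bullet> outward_normal K F))"
proof -
  have \<beta>: "\<beta> differentiable (at x)" "divergence \<beta> x = 0" if "x \<in> \<Omega>" for x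
    using velocity that by (auto simp: solenoidal_on_def)
  have c\<beta>: "continuous_on \<Omega> (\<lambda>x. frechet_derivative \<beta> (at x) (axis i 1))" for i
    using velocity by (auto simp: solenoidal_on_def)
  note fK = C1_onD[OF T_convex[OF K] T_int[OF K] f]
  have iK: "interior K \<subseteq> K" by (rule interior_subset)
  have iO: "interior K \<subseteq> \<Omega>" by (rule interior_element_subset[OF K])
  have "(LINT x:K|lborel. \<beta> x \<bullet> grad K f x) = (\<Sum>F\<in>{F. F facet_of K}. LINT x:F|facet_measure K F. (f x *\<^sub>R \<beta> x) \<bullet> outward_normal K F)"
  proof (rule polytope_divergence[where G'="\<lambda>x v. f x *\<^sub>R frechet_derivative \<beta> (at x) v + (grad K f x \<bullet> v) *\<^sub>R \<beta> x"])
    show "polytope K" "interior K \<noteq> {}" using T_poly T_int K by blast+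
    show "continuous_on K (\<lambda>x. f x *\<^sub>R \<beta> x)" by (intro continuous_intros fK cont_\<beta>[OF K])
    show "((\<lambda>x. f x *\<^sub>R \<beta> x) has_derivative (\<lambda>v. f x *\<^sub>R frechet_derivative \<beta> (at x) v + (grad K f x \<bullet> v) *\<^sub>R \<beta> x)) (at x)"
      if x: "x \<in> interior K" for x
    proof -
      have "(f has_derivative (\<lambda>v. grad K f x \<bullet> v)) (at x)"
        using fK(2)[of x] x iK at_within_interior[OF x] by auto
      moreover have "(\<beta> has_derivative frechet_derivative \<beta> (at x)) (at x)"
        using \<beta>(1) x iO frechet_derivative_works by blast
      ultimately show ?thesis by (rule has_derivative_scaleR)
    qed
    show "continuous_on (interior K) (\<lambda>x. f x *\<^sub>R frechet_derivative \<beta> (at x) (axis i 1) + (grad K f x \<bullet> axis i 1) *\<^sub>R \<beta> x)" for i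
      by (intro continuous_intros continuous_on_subset[OF c\<beta> iO] continuous_on_subset[OF fK(1) iK]
          continuous_on_subset[OF fK(3) iK] continuous_on_subset[OF cont_\<beta>[OF K] iK])
    show "continuous_on K (\<lambda>x. \<beta> x \<bullet> grad K f x)" by (intro continuous_intros fK cont_\<beta>[OF K])
    show "\<beta> x \<bullet> grad K f x = (\<Sum>i\<in>UNIV. (f x *\<^sub>R frechet_derivative \<beta> (at x) (axis i 1) + (grad K f x \<bullet> axis i 1) *\<^sub>R \<beta> x) $ i)"
      if x: "x \<in> interior K" for x
    proof -
      have "(\<Sum>i\<in>UNIV. (f x *\<^sub>R frechet_derivative \<beta> (at x) (axis i 1) + (grad K f x \<bullet> axis i 1) *\<^sub>R \<beta> x) $ i)
        = f x * divergence \<beta> x + (\<Sum>i\<in>UNIV. \<beta> x $ i * grad K f x $ i)"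
        by (simp add: divergence_def sum.distrib sum_distrib_left inner_axis mult.commute)
      then show ?thesis using \<beta>(2) x iO by (auto simp: inner_vec_def)
    qed
  qed
  then show ?thesis by simp
qed

lemma adjacent_finite: "finite (adjacent T F)" using finite_T by (simp add: adjacent_def)

lemma facet_subset_adjacent: "K \<in> adjacent T F \<Longrightarrow> F \<subseteq> K" by (simp add: in_adjacent facet_of_imp_subset)

lemma grad_zero: "K \<in> T \<Longrightarrow> x \<in> K \<Longrightarrow> grad K (\<lambda>x. c) x = 0"
  by (rule grad_eqI[OF T_convex T_int]) (auto simp: has_derivative_eq_rhs[OF has_derivative_const] fun_eq_iff)

definition reg :: "'n broken \<Rightarrow> bool" where "reg v \<longleftrightarrow> (\<forall>K\<in>T. C1_on K (v K))"

text \<open>Equality is asked only on the closed elements, since branch values elsewhere are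
  irrelevant. Thus the constant one and every member of \<open>V_space\<close> are combinations of
  basis functions that vanish off their element.\<close>

definition lincomb :: "'b set \<Rightarrow> ('b \<Rightarrow> real) \<Rightarrow> ('b \<Rightarrow> 'n broken) \<Rightarrow> 'n broken \<Rightarrow> bool" where
  "lincomb S c w u \<longleftrightarrow> (\<forall>b\<in>S. reg (w b)) \<and> (\<forall>K\<in>T. \<forall>x\<in>K. u K x = (\<Sum>b\<in>S. c b * w b K x))"

lemma lincomb_grad:
  assumes "lincomb S c w u" "K \<in> T" "x \<in> K"
  shows "grad K (u K) x = (\<Sum>b\<in>S. c b *\<^sub>R grad K (w b K) x)"
  using assms by (intro grad_linear[OF T_convex T_int]) (auto simp: lincomb_def reg_def)

lemma lincomb_adjacent:
  assumes "lincomb S c w u" "K \<in> adjacent T F" "x \<in> F"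
  shows "u K x = (\<Sum>b\<in>S. c b * w b K x)"
  using assms(1,3) facet_subset_adjacent[OF assms(2)] assms(2)[unfolded in_adjacent] unfolding lincomb_def by blast

lemma jump_lincomb:
  assumes u: "lincomb S c w u" and x: "x \<in> F"
  shows "jump T F u x = (\<Sum>b\<in>S. c b *\<^sub>R jump T F (w b) x)"
proof -
  have "jump T F u x = (\<Sum>K\<in>adjacent T F. \<Sum>b\<in>S. (c b * w b K x) *\<^sub>R outward_normal K F)"
    unfolding jump_def
  proof (rule sum.cong[OF refl])
    fix K assume K: "K \<in> adjacent T F"
    then have "u K x = (\<Sum>b\<in>S. c b * w b K x)" by (rule lincomb_adjacent[OF u _ x])
    then show "u K x *\<^sub>R outward_normal K F = (\<Sum>b\<in>S. (c b * w b K x) *\<^sub>R outward_normal K F)"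
      by (simp add: scaleR_sum_left)
  qed
  also have "\<dots> = (\<Sum>b\<in>S. c b *\<^sub>R jump T F (w b) x)"
    unfolding jump_def by (subst sum.swap) (simp add: scaleR_sum_right)
  finally show ?thesis .
qed

lemma avg_lincomb:
  assumes "\<And>K. K \<in> adjacent T F \<Longrightarrow> v K x = (\<Sum>b\<in>S. c b *\<^sub>R w b K x)"
  shows "avg T F v x = (\<Sum>b\<in>S. c b *\<^sub>R avg T F (w b) x)"
proof -
  have "avg T F v x = (1 / real (card (adjacent T F))) *\<^sub>R (\<Sum>K\<in>adjacent T F. \<Sum>b\<in>S. c b *\<^sub>R w b K x)"
    unfolding avg_def by (simp add: assms)
  also have "\<dots> = (1 / real (card (adjacent T F))) *\<^sub>R (\<Sum>b\<in>S. \<Sum>K\<in>adjacent T F. c b *\<^sub>R w b K x)"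
    by (subst sum.swap) simp
  also have "\<dots> = (\<Sum>b\<in>S. c b *\<^sub>R avg T F (w b) x)"
    unfolding avg_def by (simp add: scaleR_sum_right mult.commute)
  finally show ?thesis .
qed

lemma avg_grad_lincomb:
  assumes "lincomb S c w u" "x \<in> F"
  shows "avg T F (\<lambda>K. grad K (u K)) x = (\<Sum>b\<in>S. c b *\<^sub>R avg T F (\<lambda>K. grad K (w b K)) x)"
  by (rule avg_lincomb[where w="\<lambda>b K. grad K (w b K)"]) (use assms facet_subset_adjacent in_adjacent in \<open>auto intro!: lincomb_grad\<close>)

lemma avg_\<beta>_lincomb:
  assumes "lincomb S c w u" "x \<in> F"
  shows "avg T F (\<lambda>K y. u K y *\<^sub>R \<beta> y) x = (\<Sum>b\<in>S. c b *\<^sub>R avg T F (\<lambda>K y. w b K y *\<^sub>R \<beta> y) x)"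
proof (rule avg_lincomb[where w="\<lambda>b K y. w b K y *\<^sub>R \<beta> y"])
  fix K assume "K \<in> adjacent T F"
  then have "u K x = (\<Sum>b\<in>S. c b * w b K x)" by (rule lincomb_adjacent[OF assms(1) _ assms(2)])
  then show "u K x *\<^sub>R \<beta> x = (\<Sum>b\<in>S. c b *\<^sub>R (w b K x *\<^sub>R \<beta> x))" by (simp add: scaleR_sum_left)
qed

lemma reg_cont:
  assumes "reg v" "K \<in> adjacent T F"
  shows "continuous_on F (v K)" "continuous_on F (\<lambda>x. grad K (v K) x)" "continuous_on F \<beta>"
proof -
  have K: "K \<in> T" "F \<subseteq> K" using assms(2) facet_subset_adjacent in_adjacent by blast+
  have C: "C1_on K (v K)" using assms(1) K by (simp add: reg_def)
  note c = C1_onD[OF T_convex[OF K(1)] T_int[OF K(1)] C]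
  show "continuous_on F (v K)" "continuous_on F (\<lambda>x. grad K (v K) x)" "continuous_on F \<beta>"
    using continuous_on_subset[OF c(3) K(2)] continuous_on_subset[OF c(1) K(2)] continuous_on_subset[OF cont_\<beta>[OF K(1)] K(2)] by auto
qed

lemma cont_jump: "reg v \<Longrightarrow> continuous_on F (jump T F v)"
  unfolding jump_def[abs_def] by (intro continuous_intros reg_cont)

lemma cont_avg_grad: "reg v \<Longrightarrow> continuous_on F (avg T F (\<lambda>K. grad K (v K)))"
  unfolding avg_def[abs_def] by (intro continuous_intros reg_cont)

lemma cont_avg_\<beta>: "reg v \<Longrightarrow> continuous_on F (avg T F (\<lambda>K y. v K y *\<^sub>R \<beta> y))"
  unfolding avg_def[abs_def] by (intro continuous_intros reg_cont)

section \<open>Localization of the forms to the element of the test function\<close>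

definition ip :: "'n broken \<Rightarrow> 'n broken \<Rightarrow> (real^'n) set \<Rightarrow> real^'n \<Rightarrow> real" where
  "ip u v F x = \<mu> *
          (- (jump T F u x \<bullet> avg T F (\<lambda>K. grad K (v K)) x)
           - avg T F (\<lambda>K. grad K (u K)) x \<bullet> jump T F v x
           + c_ip / h F * (jump T F u x \<bullet> jump T F v x))"

definition upw :: "'n broken \<Rightarrow> 'n broken \<Rightarrow> (real^'n) set \<Rightarrow> real^'n \<Rightarrow> real" where
  "upw u v F x = avg T F (\<lambda>K y. u K y *\<^sub>R \<beta> y) x \<bullet> jump T F v x"

definition stab :: "'n broken \<Rightarrow> 'n broken \<Rightarrow> (real^'n) set \<Rightarrow> real^'n \<Rightarrow> real" where
  "stab u v F x = \<bar>\<beta> x \<bullet> facet_normal T F\<bar> / 2 * (jump T F u x \<bullet> jump T F v x)"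

definition vol :: "'n cell \<Rightarrow> 'n broken \<Rightarrow> 'n broken \<Rightarrow> real^'n \<Rightarrow> real" where
  "vol K u v x = \<mu> * (grad K (u K) x \<bullet> grad K (v K) x) - u K x * (\<beta> x \<bullet> grad K (v K) x)"

abbreviation FI :: "'n cell \<Rightarrow> (real^'n) set \<Rightarrow> (real^'n \<Rightarrow> real) \<Rightarrow> real" where
  "FI K F f \<equiv> (LINT x:F|facet_measure K F. f x)"

definition facet_term :: "'n cell \<Rightarrow> 'n broken \<Rightarrow> 'n broken \<Rightarrow> (real^'n) set \<Rightarrow> real" where
  "facet_term K u v F = FI K F (ip u v F) + (if F \<in> outF \<union> intF then FI K F (upw u v F) else 0)
     + (if F \<in> intF then FI K F (stab u v F) else 0)"

abbreviation KF where "KF \<equiv> K_form \<Omega> T \<beta> \<mu> h"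
abbreviation BF where "BF \<equiv> B_form \<Omega> T \<beta> \<mu> h"

lemma jump_not_adjacent: "supported_on K v \<Longrightarrow> K \<notin> adjacent T F \<Longrightarrow> jump T F v x = 0"
  unfolding jump_def by (rule sum.neutral) (auto simp: supported_on_def)

lemma avg_grad_not_adjacent:
  assumes "supported_on K v" "K \<notin> adjacent T F" "x \<in> F"
  shows "avg T F (\<lambda>K. grad K (v K)) x = 0"
proof -
  have "(\<Sum>L\<in>adjacent T F. grad L (v L) x) = 0"
  proof (rule sum.neutral, rule ballI)
    fix L assume L: "L \<in> adjacent T F"
    then have "v L = (\<lambda>x. 0)" using assms by (auto simp: supported_on_def)
    then show "grad L (v L) x = 0" using grad_zero[of L x 0] L assms(3) facet_subset_adjacent in_adjacent by auto
  qed
  then show ?thesis by (simp add: avg_def)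
qed

lemma jump_adjacent:
  assumes "supported_on K v" "K \<in> adjacent T F"
  shows "jump T F v x = v K x *\<^sub>R outward_normal K F"
proof -
  have "jump T F v x = (\<Sum>L\<in>{K}. v L x *\<^sub>R outward_normal L F)"
    unfolding jump_def by (rule sum.mono_neutral_right) (use assms adjacent_finite in \<open>auto simp: supported_on_def\<close>)
  then show ?thesis by simp
qed

lemma avg_grad_adjacent:
  assumes "supported_on K v" "K \<in> adjacent T F" "x \<in> F"
  shows "avg T F (\<lambda>K. grad K (v K)) x = (1 / real (card (adjacent T F))) *\<^sub>R grad K (v K) x"
proof -
  have "(\<Sum>L\<in>adjacent T F. grad L (v L) x) = (\<Sum>L\<in>{K}. grad L (v L) x)"
  proof (rule sum.mono_neutral_right)
    show "\<forall>L\<in>adjacent T F - {K}. grad L (v L) x = 0"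
    proof
      fix L assume L: "L \<in> adjacent T F - {K}"
      then have "v L = (\<lambda>x. 0)" using assms by (auto simp: supported_on_def)
      then show "grad L (v L) x = 0" using grad_zero[of L x 0] L assms(3) facet_subset_adjacent in_adjacent by auto
    qed
  qed (use assms adjacent_finite in auto)
  then show ?thesis by (simp add: avg_def)
qed

lemma avg_\<beta>_supported:
  assumes "supported_on K v"
  shows "avg T F (\<lambda>K y. v K y *\<^sub>R \<beta> y) x = (if K \<in> adjacent T F then (v K x / real (card (adjacent T F))) *\<^sub>R \<beta> x else 0)"
proof (cases "K \<in> adjacent T F")
  case True
  have "(\<Sum>L\<in>adjacent T F. v L x *\<^sub>R \<beta> x) = (\<Sum>L\<in>{K}. v L x *\<^sub>R \<beta> x)"
    by (rule sum.mono_neutral_right) (use assms adjacent_finite True in \<open>auto simp: supported_on_def\<close>)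
  then show ?thesis using True by (simp add: avg_def)
next
  case False
  have "(\<Sum>L\<in>adjacent T F. v L x *\<^sub>R \<beta> x) = 0"
    by (rule sum.neutral) (use assms False in \<open>auto simp: supported_on_def\<close>)
  then show ?thesis using False by (simp add: avg_def)
qed

lemma sum_facets_restrict:
  assumes K: "K \<in> T" and S: "finite S" and zero: "\<And>F. F \<in> S \<Longrightarrow> F \<notin> facets K \<Longrightarrow> g F = (0::real)"
  shows "sum g S = (\<Sum>F\<in>facets K. if F \<in> S then g F else 0)"
proof -
  have "sum g S = sum g (facets K \<inter> S)"
    by (rule sum.mono_neutral_right) (use S zero in auto)
  also have "\<dots> = (\<Sum>F\<in>facets K. if F \<in> S then g F else 0)"
    by (rule sum.inter_restrict) (use finite_polytope_facets T_poly[OF K] in blast)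
  finally show ?thesis .
qed

lemma finite_inF: "finite inF" and finite_outF: "finite outF"
  using finite_boundary_facets in_out by (metis finite_Un)+

lemma facet_integral_zero: "(\<And>x. x \<in> F \<Longrightarrow> f x = 0) \<Longrightarrow> facet_integral T F f = 0"
  unfolding facet_integral_def by (rule set_integral_zero_on)

text \<open>On a facet not belonging to \<open>K\<close>, both the jump and the averaged gradient of
  \<open>v\<close> vanish, and each facet integrand carries one of them as a factor. Every matrix
  entry thus becomes a computation on one element and its facets.\<close>

lemma K_form_local:
  assumes K: "K \<in> T" and v: "supported_on K v"
  shows "KF u v = (LINT x:K|lborel. vol K u v x) + (\<Sum>F\<in>facets K. facet_term K u v F)"
proof -
  have 1: "(\<Sum>L\<in>T. LINT x:L|lborel. \<mu> * (grad L (u L) x \<bullet> grad L (v L) x) - u L x * (\<beta> x \<bullet> grad L (v L) x)) = (LINT x:K|lborel. vol K u v x)"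
  proof -
    have "(LINT x:L|lborel. \<mu> * (grad L (u L) x \<bullet> grad L (v L) x) - u L x * (\<beta> x \<bullet> grad L (v L) x)) = 0" if L: "L \<in> T" "L \<noteq> K" for L
    proof (rule set_integral_zero_on)
      fix x assume "x \<in> L"
      then have "grad L (v L) x = 0" using v L grad_zero[of L x 0] by (auto simp: supported_on_def)
      then show "\<mu> * (grad L (u L) x \<bullet> grad L (v L) x) - u L x * (\<beta> x \<bullet> grad L (v L) x) = 0" by simp
    qed
    then have "(\<Sum>L\<in>T. LINT x:L|lborel. \<mu> * (grad L (u L) x \<bullet> grad L (v L) x) - u L x * (\<beta> x \<bullet> grad L (v L) x))
      = (\<Sum>L\<in>{K}. LINT x:L|lborel. \<mu> * (grad L (u L) x \<bullet> grad L (v L) x) - u L x * (\<beta> x \<bullet> grad L (v L) x))"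
      by (intro sum.mono_neutral_right) (use finite_T K in auto)
    then show ?thesis by (simp add: vol_def)
  qed
  have nadj: "K \<notin> adjacent T F" if "F \<notin> facets K" for F using that by (simp add: in_adjacent)
  have FIeq: "facet_integral T F f = FI K F f" if "F \<in> facets K" for F f using facet_integral_eq[OF K] that by simp
  have S: "intF \<union> inF \<union> outF = intF \<union> bdF" using in_out by blast
  have 2: "(\<Sum>F\<in>intF \<union> inF \<union> outF. facet_integral T F (ip u v F)) = (\<Sum>F\<in>facets K. FI K F (ip u v F))"
  proof -
    have "(\<Sum>F\<in>intF \<union> bdF. facet_integral T F (ip u v F)) = (\<Sum>F\<in>facets K. if F \<in> intF \<union> bdF then facet_integral T F (ip u v F) else 0)"
    proof (rule sum_facets_restrict[OF K])
      show "finite (intF \<union> bdF)" using finite_interior_facets finite_boundary_facets by simp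
      fix F assume "F \<notin> facets K"
      then show "facet_integral T F (ip u v F) = 0"
        by (intro facet_integral_zero) (simp add: ip_def jump_not_adjacent[OF v nadj] avg_grad_not_adjacent[OF v nadj])
    qed
    also have "\<dots> = (\<Sum>F\<in>facets K. FI K F (ip u v F))"
      by (rule sum.cong) (use facet_cases[OF K] FIeq in auto)
    finally show ?thesis unfolding S .
  qed
  have 3: "(\<Sum>F\<in>outF \<union> intF. facet_integral T F (upw u v F)) = (\<Sum>F\<in>facets K. if F \<in> outF \<union> intF then FI K F (upw u v F) else 0)" (is "_ = ?rhs")
  proof -
    have "(\<Sum>F\<in>outF \<union> intF. facet_integral T F (upw u v F)) = (\<Sum>F\<in>facets K. if F \<in> outF \<union> intF then facet_integral T F (upw u v F) else 0)"
    proof (rule sum_facets_restrict[OF K])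
      show "finite (outF \<union> intF)" using finite_interior_facets finite_outF by simp
      fix F assume "F \<notin> facets K"
      then show "facet_integral T F (upw u v F) = 0"
        by (intro facet_integral_zero) (simp add: upw_def jump_not_adjacent[OF v nadj])
    qed
    also have "\<dots> = ?rhs" by (rule sum.cong) (use FIeq in auto)
    finally show ?thesis .
  qed
  have 4: "(\<Sum>F\<in>intF. facet_integral T F (stab u v F)) = (\<Sum>F\<in>facets K. if F \<in> intF then FI K F (stab u v F) else 0)" (is "_ = ?rhs")
  proof -
    have "(\<Sum>F\<in>intF. facet_integral T F (stab u v F)) = (\<Sum>F\<in>facets K. if F \<in> intF then facet_integral T F (stab u v F) else 0)"
    proof (rule sum_facets_restrict[OF K finite_interior_facets])
      fix F assume "F \<notin> facets K"
      then show "facet_integral T F (stab u v F) = 0"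
        by (intro facet_integral_zero) (simp add: stab_def jump_not_adjacent[OF v nadj])
    qed
    also have "\<dots> = ?rhs" by (rule sum.cong) (use FIeq in auto)
    finally show ?thesis .
  qed
  show ?thesis
    unfolding K_form_def 1
    unfolding ip_def[symmetric] upw_def[symmetric] stab_def[symmetric] 2 3 4
    by (simp add: facet_term_def sum.distrib)
qed

lemma avg_boundary:
  assumes "F \<in> bdF" "K \<in> T" "F facet_of K"
  shows "avg T F v x = v K x"
  using boundary_facetD[OF assms] by (simp add: avg_def)

definition bdry_term :: "'n cell \<Rightarrow> 'n broken \<Rightarrow> 'n broken \<Rightarrow> (real^'n) set \<Rightarrow> real" where
  "bdry_term K w v F =
     (if F \<in> inF then - FI K F (\<lambda>x. (\<beta> x \<bullet> outward_normal K F) * w K x * v K x) else 0)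
   + (if F \<in> bdF then - FI K F (\<lambda>x. \<mu> * w K x * (grad K (v K) x \<bullet> outward_normal K F))
        + FI K F (\<lambda>x. c_ip * \<mu> / h F * w K x * v K x) else 0)"

lemma avg_not_adjacent: "supported_on K v \<Longrightarrow> K \<notin> adjacent T F \<Longrightarrow> avg T F v x = 0"
proof -
  assume v: "supported_on K v" "K \<notin> adjacent T F"
  have "(\<Sum>L\<in>adjacent T F. v L x) = 0" by (rule sum.neutral) (use v in \<open>auto simp: supported_on_def\<close>)
  then show ?thesis by (simp add: avg_def)
qed

lemma B_form_local:
  assumes K: "K \<in> T" and v: "supported_on K v"
  shows "BF w v = (\<Sum>F\<in>facets K. bdry_term K w v F)"
proof -
  have nadj: "K \<notin> adjacent T F" if "F \<notin> facets K" for F using that by (simp add: in_adjacent)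
  have FIeq: "facet_integral T F f = FI K F f" if "F \<in> facets K" for F f using facet_integral_eq[OF K] that by simp
  have inbd: "F \<in> inF \<Longrightarrow> F \<in> bdF" for F using in_out by blast
  have 1: "(\<Sum>F\<in>inF. facet_integral T F (\<lambda>x. (\<beta> x \<bullet> facet_normal T F) * avg T F w x * avg T F v x)) =
     (\<Sum>F\<in>facets K. if F \<in> inF then FI K F (\<lambda>x. (\<beta> x \<bullet> outward_normal K F) * w K x * v K x) else 0)"
  proof (subst sum_facets_restrict[OF K finite_inF])
    fix F assume "F \<notin> facets K"
    then show "facet_integral T F (\<lambda>x. (\<beta> x \<bullet> facet_normal T F) * avg T F w x * avg T F v x) = 0"
      by (intro facet_integral_zero) (simp add: avg_not_adjacent[OF v nadj])
  next
    show "(\<Sum>F\<in>facets K. if F \<in> inF then facet_integral T F (\<lambda>x. (\<beta> x \<bullet> facet_normal T F) * avg T F w x * avg T F v x) else 0) =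
      (\<Sum>F\<in>facets K. if F \<in> inF then FI K F (\<lambda>x. (\<beta> x \<bullet> outward_normal K F) * w K x * v K x) else 0)"
      by (rule sum.cong) (use inbd K in \<open>auto simp: FIeq avg_boundary facet_normal_boundary\<close>)
  qed
  have 2: "(\<Sum>F\<in>inF \<union> outF. facet_integral T F (\<lambda>x. \<mu> * avg T F w x * (avg T F (\<lambda>K. grad K (v K)) x \<bullet> facet_normal T F))) =
     (\<Sum>F\<in>facets K. if F \<in> bdF then FI K F (\<lambda>x. \<mu> * w K x * (grad K (v K) x \<bullet> outward_normal K F)) else 0)"
    unfolding in_out
  proof (subst sum_facets_restrict[OF K finite_boundary_facets])
    fix F assume "F \<notin> facets K"
    then show "facet_integral T F (\<lambda>x. \<mu> * avg T F w x * (avg T F (\<lambda>K. grad K (v K)) x \<bullet> facet_normal T F)) = 0"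
      by (intro facet_integral_zero) (simp add: avg_grad_not_adjacent[OF v nadj])
  next
    show "(\<Sum>F\<in>facets K. if F \<in> bdF then facet_integral T F (\<lambda>x. \<mu> * avg T F w x * (avg T F (\<lambda>K. grad K (v K)) x \<bullet> facet_normal T F)) else 0) =
      (\<Sum>F\<in>facets K. if F \<in> bdF then FI K F (\<lambda>x. \<mu> * w K x * (grad K (v K) x \<bullet> outward_normal K F)) else 0)"
      by (rule sum.cong) (use K in \<open>auto simp: FIeq avg_boundary facet_normal_boundary\<close>)
  qed
  have 3: "(\<Sum>F\<in>inF \<union> outF. facet_integral T F (\<lambda>x. c_ip * \<mu> / h F * avg T F w x * avg T F v x)) =
     (\<Sum>F\<in>facets K. if F \<in> bdF then FI K F (\<lambda>x. c_ip * \<mu> / h F * w K x * v K x) else 0)"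
    unfolding in_out
  proof (subst sum_facets_restrict[OF K finite_boundary_facets])
    fix F assume "F \<notin> facets K"
    then show "facet_integral T F (\<lambda>x. c_ip * \<mu> / h F * avg T F w x * avg T F v x) = 0"
      by (intro facet_integral_zero) (simp add: avg_not_adjacent[OF v nadj])
  next
    show "(\<Sum>F\<in>facets K. if F \<in> bdF then facet_integral T F (\<lambda>x. c_ip * \<mu> / h F * avg T F w x * avg T F v x) else 0) =
      (\<Sum>F\<in>facets K. if F \<in> bdF then FI K F (\<lambda>x. c_ip * \<mu> / h F * w K x * v K x) else 0)"
      by (rule sum.cong) (use K in \<open>auto simp: FIeq avg_boundary facet_normal_boundary\<close>)
  qed
  show ?thesis
    unfolding B_form_def 1 2 3 sum_negf[symmetric] sum.distrib[symmetric] sum_subtractf[symmetric]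
    by (rule sum.cong) (auto simp: bdry_term_def)
qed

lemma FI_lincomb:
  assumes K: "K \<in> T" and F: "F facet_of K" and f: "\<And>b. b \<in> S \<Longrightarrow> continuous_on F (f b)"
    and eq: "\<And>x. x \<in> F \<Longrightarrow> g x = (\<Sum>b\<in>S. c b * f b x)"
  shows "FI K F g = (\<Sum>b\<in>S. c b * FI K F (f b))"
  by (rule set_integral_sum[OF facet_set_integrable[OF T_poly[OF K] T_int[OF K] F f] eq])

text \<open>Splitting the integrals of a sum requires each integrand to be integrable; this comes
  from the continuity of branches, gradients and \<beta> on closed elements and facets.\<close>

lemma K_form_lincomb:
  assumes K: "K \<in> T" and v: "supported_on K v" "reg v" and u: "lincomb S c w u"
  shows "KF u v = (\<Sum>b\<in>S. c b * KF (w b) v)"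
proof -
  have w: "reg (w b)" if "b \<in> S" for b using u that by (simp add: lincomb_def)
  have 1: "(LINT x:K|lborel. vol K u v x) = (\<Sum>b\<in>S. c b * (LINT x:K|lborel. vol K (w b) v x))"
  proof (rule set_integral_sum)
    fix b assume b: "b \<in> S"
    have cw: "C1_on K (w b K)" "C1_on K (v K)" using w[OF b] v(2) K by (auto simp: reg_def)
    have "continuous_on K (vol K (w b) v)" unfolding vol_def[abs_def]
      by (intro continuous_intros C1_onD[OF T_convex[OF K] T_int[OF K]] cw cont_\<beta>[OF K])
    then show "set_integrable lborel K (vol K (w b) v)"
      using T_compact[OF K] emeasure_compact_finite[OF T_compact[OF K]]
      by (intro set_integrable_continuous) (auto simp: compact_imp_closed)
  next
    fix x assume x: "x \<in> K"
    have "u K x = (\<Sum>b\<in>S. c b * w b K x)" using u K x by (simp add: lincomb_def)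
    then show "vol K u v x = (\<Sum>b\<in>S. c b * vol K (w b) v x)"
      by (simp add: vol_def lincomb_grad[OF u K x] inner_sum_left sum_distrib_left sum_distrib_right algebra_simps flip: sum_subtractf)
  qed
  have 2: "facet_term K u v F = (\<Sum>b\<in>S. c b * facet_term K (w b) v F)" if F: "F \<in> facets K" for F
  proof -
    have FK: "F facet_of K" using F by simp
    have "FI K F (ip u v F) = (\<Sum>b\<in>S. c b * FI K F (ip (w b) v F))"
    proof (rule FI_lincomb[OF K FK])
      show "continuous_on F (ip (w b) v F)" if "b \<in> S" for b
        unfolding ip_def[abs_def] by (intro continuous_intros cont_jump cont_avg_grad w[OF that] v)
      show "ip u v F x = (\<Sum>b\<in>S. c b * ip (w b) v F x)" if x: "x \<in> F" for x
        unfolding ip_def jump_lincomb[OF u x] avg_grad_lincomb[OF u x]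
        by (simp add: inner_sum_left sum_distrib_left algebra_simps flip: sum_subtractf sum_negf sum.distrib)
    qed
    moreover have "FI K F (upw u v F) = (\<Sum>b\<in>S. c b * FI K F (upw (w b) v F))"
    proof (rule FI_lincomb[OF K FK])
      show "continuous_on F (upw (w b) v F)" if "b \<in> S" for b
        unfolding upw_def[abs_def] by (intro continuous_intros cont_jump cont_avg_\<beta> w[OF that] v)
      show "upw u v F x = (\<Sum>b\<in>S. c b * upw (w b) v F x)" if x: "x \<in> F" for x
        unfolding upw_def avg_\<beta>_lincomb[OF u x] by (simp add: inner_sum_left)
    qed
    moreover have "FI K F (stab u v F) = (\<Sum>b\<in>S. c b * FI K F (stab (w b) v F))"
    proof (rule FI_lincomb[OF K FK])
      show "continuous_on F (stab (w b) v F)" if "b \<in> S" for b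
        unfolding stab_def[abs_def] by (intro continuous_intros cont_jump cont_\<beta>_facet[OF K FK] w[OF that] v) simp
      show "stab u v F x = (\<Sum>b\<in>S. c b * stab (w b) v F x)" if x: "x \<in> F" for x
        unfolding stab_def jump_lincomb[OF u x] by (simp add: inner_sum_left sum_distrib_left mult.left_commute)
    qed
    ultimately show ?thesis by (simp add: facet_term_def sum.distrib distrib_left)
  qed
  have "KF u v = (\<Sum>b\<in>S. c b * (LINT x:K|lborel. vol K (w b) v x)) + (\<Sum>F\<in>facets K. \<Sum>b\<in>S. c b * facet_term K (w b) v F)"
    unfolding K_form_local[OF K v(1)] 1 using 2 by simp
  also have "(\<Sum>F\<in>facets K. \<Sum>b\<in>S. c b * facet_term K (w b) v F) = (\<Sum>b\<in>S. c b * (\<Sum>F\<in>facets K. facet_term K (w b) v F))"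
    by (subst sum.swap) (simp add: sum_distrib_left)
  finally show ?thesis unfolding K_form_local[OF K v(1)] by (simp add: sum.distrib distrib_left)
qed

lemma B_form_lincomb:
  assumes K: "K \<in> T" and v: "supported_on K v" "reg v" and u: "lincomb S c w u"
  shows "BF u v = (\<Sum>b\<in>S. c b * BF (w b) v)"
proof -
  have w: "reg (w b)" if "b \<in> S" for b using u that by (simp add: lincomb_def)
  have 2: "bdry_term K u v F = (\<Sum>b\<in>S. c b * bdry_term K (w b) v F)" if F: "F \<in> facets K" for F
  proof -
    have FK: "F facet_of K" using F by simp
    have adj: "K \<in> adjacent T F" using FK K by (simp add: in_adjacent)
    have uF: "u K x = (\<Sum>b\<in>S. c b * w b K x)" if "x \<in> F" for x
      using u K that facet_of_imp_subset[OF FK] by (auto simp: lincomb_def)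
    have "FI K F (\<lambda>x. (\<beta> x \<bullet> outward_normal K F) * u K x * v K x) = (\<Sum>b\<in>S. c b * FI K F (\<lambda>x. (\<beta> x \<bullet> outward_normal K F) * w b K x * v K x))"
      by (rule FI_lincomb[OF K FK])
         (intro continuous_intros reg_cont[OF w adj] reg_cont[OF v(2) adj], assumption,
          simp add: uF sum_distrib_left sum_distrib_right mult_ac)
    moreover have "FI K F (\<lambda>x. \<mu> * u K x * (grad K (v K) x \<bullet> outward_normal K F)) = (\<Sum>b\<in>S. c b * FI K F (\<lambda>x. \<mu> * w b K x * (grad K (v K) x \<bullet> outward_normal K F)))"
      by (rule FI_lincomb[OF K FK])
         (intro continuous_intros reg_cont[OF w adj] reg_cont[OF v(2) adj], assumption,
          simp add: uF sum_distrib_left sum_distrib_right mult_ac)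
    moreover have "FI K F (\<lambda>x. c_ip * \<mu> / h F * u K x * v K x) = (\<Sum>b\<in>S. c b * FI K F (\<lambda>x. c_ip * \<mu> / h F * w b K x * v K x))"
      by (rule FI_lincomb[OF K FK])
         (intro continuous_intros reg_cont[OF w adj] reg_cont[OF v(2) adj], assumption,
          simp add: uF sum_distrib_left sum_distrib_right mult_ac)
    ultimately show ?thesis unfolding bdry_term_def
      by (simp add: algebra_simps sum_subtractf sum_negf sum.distrib)
  qed
  then show ?thesis unfolding B_form_local[OF K v(1)]
    by (simp add: sum_distrib_left) (rule sum.swap)
qed

end


section \<open>Signs of the matrix entries\<close>

lemma set_integral_minus_on: "(LINT x:A|M. - f x) = - (LINT x:A|M. (f x :: real))"
  by (simp add: set_lebesgue_integral_def)

context dg_scheme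
begin

lemma nodeD: assumes "a \<in> nodes T" shows "snd a \<in> T" "fst a \<in> vertices (snd a)" "fst a \<in> snd a"
  using assms nodal_element.vertex_in[OF element] by (auto simp: nodes_def)

lemma basis_self: "basis P a (snd a) = shape P (snd a) (fst a)"
  by (simp add: basis_def)

lemma basis_other: "L \<noteq> snd a \<Longrightarrow> basis P a L = (\<lambda>x. 0)"
  by (simp add: basis_def)

lemma C1_basis: "a \<in> nodes T \<Longrightarrow> C1_on (snd a) (basis P a (snd a))"
  unfolding basis_self by (rule nodal_element.C1[OF element]) (auto dest: nodeD)

lemma reg_basis:
  assumes "a \<in> nodes T" shows "reg (basis P a)"
  unfolding reg_def
proof
  fix L show "C1_on L (basis P a L)"
    by (cases "L = snd a") (auto simp: basis_other C1_on_const C1_basis[OF assms])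
qed

lemma basis_nonneg:
  assumes "a \<in> nodes T" "K \<in> T" "x \<in> K" shows "0 \<le> basis P a K x"
proof (cases "K = snd a")
  case True
  then show ?thesis using nodal_element.nonneg[OF element[OF assms(2)], of "fst a" x] nodeD[OF assms(1)] assms(3)
    by (simp add: basis_self)
qed (simp add: basis_other)

lemma basis_vanish:
  assumes "a \<in> nodes T" "F facet_of snd a" "fst a \<notin> F" "x \<in> F"
  shows "basis P a (snd a) x = 0"
  unfolding basis_self using nodal_element.vanish[OF element] nodeD[OF assms(1)] assms by blast

lemma basis_pos:
  assumes "a \<in> nodes T" "F facet_of snd a" "fst a \<in> F" "x \<in> rel_interior F"
  shows "0 < basis P a (snd a) x"
  unfolding basis_self using nodal_element.pos[OF element] nodeD[OF assms(1)] assms by blast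

lemma basis_normal_derivative:
  assumes a: "a \<in> nodes T" and F: "F facet_of snd a" "fst a \<notin> F" and x: "x \<in> F"
  shows "grad (snd a) (basis P a (snd a)) x \<bullet> outward_normal (snd a) F \<le> 0"
    and "x \<in> rel_interior F \<Longrightarrow> grad (snd a) (basis P a (snd a)) x \<bullet> outward_normal (snd a) F < 0"
proof -
  have K: "snd a \<in> T" by (rule nodeD(1)[OF a])
  show "grad (snd a) (basis P a (snd a)) x \<bullet> outward_normal (snd a) F \<le> 0"
    by (rule normal_derivative_at_facet(1)[OF T_poly[OF K] T_int[OF K] F(1) x C1_basis[OF a]])
       (auto intro: basis_nonneg[OF a K] basis_vanish[OF a F])
  assume "x \<in> rel_interior F"
  then have g: "grad (snd a) (basis P a (snd a)) x \<noteq> 0"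
    unfolding basis_self using nodal_element.grad_nz[OF element[OF K]] nodeD[OF a] F by blast
  show "grad (snd a) (basis P a (snd a)) x \<bullet> outward_normal (snd a) F < 0" 
    by (rule normal_derivative_at_facet(2)[OF T_poly[OF K] T_int[OF K] F(1) x C1_basis[OF a] _ _ g])
       (auto intro: basis_nonneg[OF a K] basis_vanish[OF a F])
qed

lemma sum_nodes_element:
  assumes K: "K \<in> T"
  shows "(\<Sum>b\<in>nodes T. g b * basis P b K x) = (\<Sum>j\<in>vertices K. g (j, K) * shape P K j x)"
proof -
  have "(\<Sum>b\<in>nodes T. g b * basis P b K x) = (\<Sum>b\<in>(\<lambda>j. (j, K)) ` vertices K. g b * basis P b K x)"
  proof (rule sum.mono_neutral_right[OF finite_nodes])
    show "(\<lambda>j. (j, K)) ` vertices K \<subseteq> nodes T" using K by (auto simp: nodes_def)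
    show "\<forall>b\<in>nodes T - (\<lambda>j. (j, K)) ` vertices K. g b * basis P b K x = 0"
    proof
      fix b assume b: "b \<in> nodes T - (\<lambda>j. (j, K)) ` vertices K"
      then have "K \<noteq> snd b" by (cases b) (auto simp: nodes_def)
      then show "g b * basis P b K x = 0" by (simp add: basis_other)
    qed
  qed
  also have "\<dots> = (\<Sum>j\<in>vertices K. g (j, K) * basis P (j, K) K x)"
    by (subst sum.reindex) (auto simp: inj_on_def)
  finally show ?thesis by (simp add: basis_def)
qed

lemma lincomb_V:
  assumes "u \<in> V_space T P" shows "lincomb (nodes T) (node_val u) (basis P) u"
  unfolding lincomb_def
proof (intro conjI ballI reg_basis)
  fix K x assume K: "K \<in> T" "x \<in> K"
  have "u K \<in> P K" using assms K by (simp add: V_space_def)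
  then have "u K x = (\<Sum>j\<in>vertices K. u K j * shape P K j x)"
    by (rule nodal_element.expand[OF element[OF K(1)] _ K(2)])
  then show "u K x = (\<Sum>b\<in>nodes T. node_val u b * basis P b K x)"
    by (simp add: sum_nodes_element[OF K(1)] node_val_def)
qed

lemma lincomb_one: "lincomb (nodes T) (\<lambda>_. 1) (basis P) (\<lambda>_ _. 1)"
  unfolding lincomb_def
proof (intro conjI ballI reg_basis)
  fix K x assume K: "K \<in> T" "x \<in> K"
  then show "1 = (\<Sum>b\<in>nodes T. 1 * basis P b K x)"
    using nodal_element.sum1[OF element[OF K(1)] K(2)] sum_nodes_element[OF K(1), of "\<lambda>_. 1" x] by simp
qed

lemma bdry_nodes_subset: "bdry_nodes T \<Omega> \<subseteq> nodes T" by (auto simp: bdry_nodes_def)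

lemma lincomb_bdry: "lincomb (bdry_nodes T \<Omega>) (\<lambda>b. ubar (fst b)) (basis P) (bdry_interp \<Omega> T P ubar)"
  unfolding lincomb_def bdry_interp_def using reg_basis bdry_nodes_subset by blast

text \<open>On a boundary facet the basis functions of nodes off the boundary vanish, so restricting
  the partition of unity to boundary nodes loses nothing.\<close>

lemma bdry_interp_one:
  assumes K: "K \<in> T" and F: "F facet_of K" "F \<in> bdF" and x: "x \<in> F"
  shows "bdry_interp \<Omega> T P (\<lambda>_. 1) K x = 1"
proof -
  have xK: "x \<in> K" using x F facet_of_imp_subset by blast
  have "bdry_interp \<Omega> T P (\<lambda>_. 1) K x = (\<Sum>b\<in>nodes T. 1 * basis P b K x)"
    unfolding bdry_interp_def
  proof (rule sum.mono_neutral_left[OF finite_nodes bdry_nodes_subset], rule ballI)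
    fix b assume b: "b \<in> nodes T - bdry_nodes T \<Omega>"
    show "1 * basis P b K x = 0"
    proof (cases "K = snd b")
      case True
      have "F \<subseteq> frontier \<Omega>" using F(2) by (simp add: boundary_facets_def)
      then have "fst b \<notin> F" using b by (auto simp: bdry_nodes_def)
      then show ?thesis using basis_vanish[of b F x] b F x True by simp
    qed (simp add: basis_other)
  qed
  also have "\<dots> = 1" using lincomb_one K xK by (simp add: lincomb_def)
  finally show ?thesis .
qed

lemma facet_in_closure_rel_interior:
  assumes K: "K \<in> T" and F: "F facet_of K"
  shows "closure (rel_interior F) = F"
  using convex_closure_rel_interior[of F] facet_compact[OF T_poly[OF K] F]
    face_of_imp_convex[OF facet_of_imp_face_of[OF F]] by (simp add: closure_closed compact_imp_closed)

text \<open>The strict sign is prescribed on the relative interior only; continuity of \<beta>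
  carries the weak sign to the whole facet.\<close>

lemma inflow_sign:
  assumes K: "K \<in> T" and F: "F facet_of K" "F \<in> inF" and x: "x \<in> F"
  shows "\<beta> x \<bullet> outward_normal K F \<le> 0"
proof (rule continuous_le_on_closure[where S="rel_interior F" and f="\<lambda>x. \<beta> x \<bullet> outward_normal K F"])
  show "continuous_on (closure (rel_interior F)) (\<lambda>x. \<beta> x \<bullet> outward_normal K F)"
    unfolding facet_in_closure_rel_interior[OF K F(1)] by (intro continuous_intros cont_\<beta>_facet[OF K F(1)])
  show "x \<in> closure (rel_interior F)" using x by (simp add: facet_in_closure_rel_interior[OF K F(1)])
  fix y assume "y \<in> rel_interior F"
  then have "\<beta> y \<bullet> facet_normal T F < 0" using F(2) by (simp add: inflow_facets_def)
  moreover have "facet_normal T F = outward_normal K F"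
    by (rule facet_normal_boundary[OF _ K F(1)]) (use F(2) in_out in blast)
  ultimately show "\<beta> y \<bullet> outward_normal K F \<le> 0" by simp
qed

lemma outflow_sign:
  assumes K: "K \<in> T" and F: "F facet_of K" "F \<in> outF" and x: "x \<in> F"
  shows "0 \<le> \<beta> x \<bullet> outward_normal K F"
proof (rule continuous_ge_on_closure[where S="rel_interior F" and f="\<lambda>x. \<beta> x \<bullet> outward_normal K F"])
  show "continuous_on (closure (rel_interior F)) (\<lambda>x. \<beta> x \<bullet> outward_normal K F)"
    unfolding facet_in_closure_rel_interior[OF K F(1)] by (intro continuous_intros cont_\<beta>_facet[OF K F(1)])
  show "x \<in> closure (rel_interior F)" using x by (simp add: facet_in_closure_rel_interior[OF K F(1)])
  fix y assume "y \<in> rel_interior F"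
  then have "\<beta> y \<bullet> facet_normal T F \<ge> 0" using F(2) by (simp add: outflow_facets_def)
  moreover have "facet_normal T F = outward_normal K F"
    by (rule facet_normal_boundary[OF _ K F(1)]) (use F(2) in_out in blast)
  ultimately show "0 \<le> \<beta> y \<bullet> outward_normal K F" by simp
qed

lemma common_facet_unique:
  assumes K: "K \<in> T" "K' \<in> T" "K \<noteq> K'" and F: "F facet_of K" "F facet_of K'" and G: "G facet_of K" "G facet_of K'"
  shows "F = G"
  using common_facet_eq_Int[OF K] F G by (metis facet_of_imp_subset le_inf_iff)

lemma facet_has_vertex:
  assumes K: "K \<in> T" and F: "F facet_of K"
  obtains j where "j \<in> vertices K" "j \<in> F"
proof -
  obtain j where "j extreme_point_of F"
    using extreme_point_exists_convex[OF facet_compact[OF T_poly[OF K] F] face_of_imp_convex[OF facet_of_imp_face_of[OF F]] facet_nonempty[OF F]] by blast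
  then show ?thesis using that extreme_point_of_face[OF facet_of_imp_face_of[OF F]] by (auto simp: vertices_def)
qed

lemma facet_misses_vertex:
  assumes K: "K \<in> T" and F: "F facet_of K"
  obtains j where "j \<in> vertices K" "j \<notin> F"
proof -
  have "\<not> vertices K \<subseteq> F"
  proof
    assume "vertices K \<subseteq> F"
    then have "convex hull vertices K \<subseteq> F"
      using face_of_imp_convex[OF facet_of_imp_face_of[OF F]] by (simp add: subset_hull)
    moreover have "K = convex hull vertices K"
      using Krein_Milman_Minkowski[OF T_compact[OF K] T_convex[OF K]] by (simp add: vertices_def)
    ultimately have "K = F" using facet_of_imp_subset[OF F] by blast
    then show False using F facet_of_irrefl by blast
  qed
  then show ?thesis using that by blast
qed

lemma facet_term_zero:
  assumes "\<And>x. x \<in> F \<Longrightarrow> ip u v F x = 0" "\<And>x. x \<in> F \<Longrightarrow> upw u v F x = 0" "\<And>x. x \<in> F \<Longrightarrow> stab u v F x = 0"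
  shows "facet_term K u v F = 0"
proof -
  have "FI K F (ip u v F) = 0" "FI K F (upw u v F) = 0" "FI K F (stab u v F) = 0"
    using assms by (auto intro!: set_integral_zero_on)
  then show ?thesis by (simp add: facet_term_def)
qed

lemma facet_term_not_adjacent:
  assumes "supported_on K' u" "K' \<notin> adjacent T F"
  shows "facet_term K u v F = 0"
  by (rule facet_term_zero)
     (simp_all add: ip_def upw_def stab_def jump_not_adjacent[OF assms] avg_grad_not_adjacent[OF assms] avg_\<beta>_supported[OF assms(1)] assms(2))

lemma vol_other:
  assumes b: "b \<in> nodes T" and K: "K \<in> T" "K \<noteq> snd b"
  shows "(LINT x:K|lborel. vol K (basis P b) v x) = 0"
  by (rule set_integral_zero_on) (simp add: vol_def basis_other[OF K(2)] grad_zero[OF K(1)])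

text \<open>No element that contains the vertex of \<open>a\<close> contains that of
  \<open>b\<close>. A common facet lies in both elements, so it can contain neither vertex, and both
  traces vanish on it.\<close>

lemma not_nbr_traces:
  assumes a: "a \<in> nodes T" and b: "b \<in> nodes T" "b \<notin> nbrs T a"
  shows "snd b \<noteq> snd a" "F facet_of snd a \<Longrightarrow> F facet_of snd b \<Longrightarrow> fst b \<notin> F \<and> fst a \<notin> F"
proof -
  have n: "fst b \<notin> L" if "L \<in> T" "fst a \<in> L" for L using b that by (auto simp: nbrs_def patch_def)
  show "snd b \<noteq> snd a" using n[of "snd a"] nodeD[OF a] nodeD[OF b(1)] by auto
  assume F: "F facet_of snd a" "F facet_of snd b"
  show "fst b \<notin> F \<and> fst a \<notin> F"
    using n[of "snd a"] n[of "snd b"] nodeD[OF a] nodeD[OF b(1)] F facet_of_imp_subset by blast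
qed

text \<open>The node \<open>b\<close> may sit in an adjacent element without being a neighbour, but
  then both traces, hence both jumps, vanish on the shared facet. This matches the sums over all
  nodes from linearity with the viscosity sums over \<open>nbrs\<close>.\<close>

lemma K_form_not_nbr:
  assumes a: "a \<in> nodes T" and b: "b \<in> nodes T" "b \<notin> nbrs T a"
  shows "KF (basis P b) (basis P a) = 0"
proof -
  note nt = not_nbr_traces[OF assms]
  have K: "snd a \<in> T" by (rule nodeD(1)[OF a])
  have "facet_term (snd a) (basis P b) (basis P a) F = 0" if F: "F \<in> facets (snd a)" for F
  proof (cases "snd b \<in> adjacent T F")
    case False
    then show ?thesis by (rule facet_term_not_adjacent[OF supported_basis])
  next
    case True
    then have Fb: "F facet_of snd b" by (simp add: in_adjacent)
    have Fa: "F facet_of snd a" using F by simp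
    have adj: "snd a \<in> adjacent T F" using Fa K by (simp add: in_adjacent)
    have z: "basis P b (snd b) x = 0" "basis P a (snd a) x = 0" if "x \<in> F" for x
      using basis_vanish nt(2)[OF Fa Fb] a b(1) Fa Fb that by blast+
    have j: "jump T F (basis P b) x = 0" "jump T F (basis P a) x = 0" if "x \<in> F" for x
      using jump_adjacent[OF supported_basis True] jump_adjacent[OF supported_basis adj] z[OF that] by simp_all
    show ?thesis by (rule facet_term_zero) (simp_all add: ip_def upw_def stab_def j)
  qed
  then show ?thesis
    unfolding K_form_local[OF K supported_basis] using vol_other[OF b(1) K] nt(1) by simp
qed

lemma B_form_not_nbr:
  assumes a: "a \<in> nodes T" and b: "b \<in> nodes T" "b \<notin> nbrs T a"
  shows "BF (basis P b) (basis P a) = 0"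
proof -
  have K: "snd a \<in> T" by (rule nodeD(1)[OF a])
  have "basis P b (snd a) = (\<lambda>x. 0)" using not_nbr_traces(1)[OF assms] by (intro basis_other) auto
  then have z: "basis P b (snd a) x = 0" for x by (rule fun_cong)
  show ?thesis
    unfolding B_form_local[OF K supported_basis] bdry_term_def z
    by (intro sum.neutral ballI) (simp add: set_lebesgue_integral_def)
qed

lemma facet_integral_pos_rel_interior:
  assumes K: "K \<in> T" and F: "F facet_of K" and f: "continuous_on F f"
    and nonneg: "\<And>x. x \<in> F \<Longrightarrow> 0 \<le> f x" and pos: "\<And>x. x \<in> rel_interior F \<Longrightarrow> 0 < f x"
  shows "0 < FI K F f"
proof -
  obtain x where "x \<in> rel_interior F" using rel_interior_facet[OF F] by blast
  then show ?thesis
    using facet_integral_pos[OF T_poly[OF K] T_int[OF K] F f nonneg, of x] pos rel_interior_subset by blast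
qed

text \<open>The function whose vertex is off the facet has zero trace there, so the penalty, upwind
  and stabilization terms vanish. What survives is the other trace times the averaged gradient of
  this function, and its outward normal derivative is negative by
  \<open>basis_normal_derivative\<close>.\<close>

lemma K_form_neg:
  assumes \<mu>: "0 < \<mu>" and a: "a \<in> nodes T" and b: "b \<in> nodes T" and ne: "snd a \<noteq> snd b"
    and F: "F facet_of snd a" "F facet_of snd b" and one: "fst a \<in> F \<longleftrightarrow> fst b \<notin> F"
  shows "KF (basis P b) (basis P a) < 0"
proof -
  define K K' where "K = snd a" and "K' = snd b"
  have K: "K \<in> T" "K' \<in> T" "K \<noteq> K'" using nodeD a b ne by (auto simp: K_def K'_def)
  have FK: "F facet_of K" "F facet_of K'" using F by (auto simp: K_def K'_def)
  have adj: "adjacent T F = {K, K'}" by (rule adjacent_pair[OF K FK])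
  have adjK: "K \<in> adjacent T F" "K' \<in> adjacent T F" using adj by auto
  have card: "card (adjacent T F) = 2" using adj K(3) by simp
  have opp: "outward_normal K' F = - outward_normal K F" by (rule normals_opposite[OF K FK])
  have intF: "F \<in> intF" using K FK by (auto simp: interior_facets_def)
  define v w where "v = basis P a" and "w = basis P b"
  have sv: "supported_on K v" and sw: "supported_on K' w" by (simp_all add: v_def w_def K_def K'_def supported_basis)
  have rv: "reg v" "reg w" using reg_basis a b by (simp_all add: v_def w_def)
  note J = jump_adjacent[OF sv adjK(1)] jump_adjacent[OF sw adjK(2)]
  note A = avg_grad_adjacent[OF sv adjK(1)] avg_grad_adjacent[OF sw adjK(2)]
  \<comment> \<open>Two elements share at most one facet, so no other facet sees both
    functions.\<close>
  have rest: "facet_term K w v G = 0" if G: "G \<in> facets K" "G \<noteq> F" for G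
  proof (rule facet_term_not_adjacent[OF sw])
    show "K' \<notin> adjacent T G" using common_facet_unique[OF K FK, of G] G by (auto simp: in_adjacent)
  qed
  have fin: "finite (facets K)" using T_poly[OF K(1)] by (rule finite_polytope_facets)
  have "(\<Sum>G\<in>facets K. facet_term K w v G) = (\<Sum>G\<in>{F}. facet_term K w v G)"
    by (rule sum.mono_neutral_right[OF fin]) (use rest FK in auto)
  then have KFeq: "KF w v = facet_term K w v F"
    unfolding K_form_local[OF K(1) sv] using vol_other[OF b K(1)] K(3) by (simp add: w_def K'_def)
  have "facet_term K w v F < 0"
  proof (cases "fst a \<in> F")
    case True
    then have w0: "w K' x = 0" if "x \<in> F" for x using basis_vanish[OF b F(2) _ that] one by (simp add: w_def K'_def)
    \<comment> \<open>The factor 1/2 is the weight of the average; writing the flux with the normal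
      of \<open>K'\<close>, opposite to that of \<open>K\<close>, exposes the sign.\<close>
    have ip: "ip w v F x = - (\<mu> / 2 * (v K x * - (grad K' (w K') x \<bullet> outward_normal K' F)))" if x: "x \<in> F" for x
      by (simp add: ip_def J A[OF x] w0[OF x] card opp)
    have up: "upw w v F x = 0" "stab w v F x = 0" if x: "x \<in> F" for x
      using w0[OF x] by (simp_all add: upw_def stab_def J avg_\<beta>_supported[OF sw])
    have "0 < FI K F (\<lambda>x. \<mu> / 2 * (v K x * - (grad K' (w K') x \<bullet> outward_normal K' F)))"
    proof (rule facet_integral_pos_rel_interior[OF K(1) FK(1)])
      show "continuous_on F (\<lambda>x. \<mu> / 2 * (v K x * - (grad K' (w K') x \<bullet> outward_normal K' F)))"
        by (intro continuous_intros reg_cont[OF rv(1) adjK(1)] reg_cont[OF rv(2) adjK(2)]) 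
      fix x assume x: "x \<in> F"
      then have "0 \<le> v K x" using basis_nonneg[OF a K(1)] FK facet_of_imp_subset by (auto simp: v_def)
      moreover have "grad K' (w K') x \<bullet> outward_normal K' F \<le> 0"
        using basis_normal_derivative(1)[OF b F(2) _ x] one True by (simp add: w_def K'_def)
      ultimately show "0 \<le> \<mu> / 2 * (v K x * - (grad K' (w K') x \<bullet> outward_normal K' F))"
        using \<mu> by (intro mult_nonneg_nonneg) auto
    next
      fix x assume x: "x \<in> rel_interior F"
      then have xF: "x \<in> F" using rel_interior_subset by blast
      have "0 < v K x" using basis_pos[OF a F(1) True x] by (simp add: v_def K_def)
      moreover have "grad K' (w K') x \<bullet> outward_normal K' F < 0"
        using basis_normal_derivative(2)[OF b F(2) _ xF x] one True by (simp add: w_def K'_def)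
      ultimately show "0 < \<mu> / 2 * (v K x * - (grad K' (w K') x \<bullet> outward_normal K' F))"
        using \<mu> by (intro mult_pos_pos) auto
    qed
    moreover have "FI K F (ip w v F) = - FI K F (\<lambda>x. \<mu> / 2 * (v K x * - (grad K' (w K') x \<bullet> outward_normal K' F)))"
      unfolding set_integral_minus_on[symmetric] by (rule set_integral_cong_on) (rule ip)
    moreover have "FI K F (upw w v F) = 0" by (rule set_integral_zero_on) (rule up(1))
    moreover have "FI K F (stab w v F) = 0" by (rule set_integral_zero_on) (rule up(2))
    ultimately show ?thesis by (simp add: facet_term_def)
  next
    case False
    then have v0: "v K x = 0" if "x \<in> F" for x using basis_vanish[OF a F(1) _ that] by (simp add: v_def K_def)
    have ip: "ip w v F x = - (\<mu> / 2 * (w K' x * - (grad K (v K) x \<bullet> outward_normal K F)))" if x: "x \<in> F" for x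
      by (simp add: ip_def J A[OF x] v0[OF x] card opp inner_commute)
    have up: "upw w v F x = 0" "stab w v F x = 0" if x: "x \<in> F" for x
      using v0[OF x] by (simp_all add: upw_def stab_def J)
    have "0 < FI K F (\<lambda>x. \<mu> / 2 * (w K' x * - (grad K (v K) x \<bullet> outward_normal K F)))"
    proof (rule facet_integral_pos_rel_interior[OF K(1) FK(1)])
      show "continuous_on F (\<lambda>x. \<mu> / 2 * (w K' x * - (grad K (v K) x \<bullet> outward_normal K F)))"
        by (intro continuous_intros reg_cont[OF rv(1) adjK(1)] reg_cont[OF rv(2) adjK(2)]) 
      fix x assume x: "x \<in> F"
      then have "0 \<le> w K' x" using basis_nonneg[OF b K(2)] FK facet_of_imp_subset by (auto simp: w_def)
      moreover have "grad K (v K) x \<bullet> outward_normal K F \<le> 0"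
        using basis_normal_derivative(1)[OF a F(1) False x] by (simp add: v_def K_def)
      ultimately show "0 \<le> \<mu> / 2 * (w K' x * - (grad K (v K) x \<bullet> outward_normal K F))"
        using \<mu> by (intro mult_nonneg_nonneg) auto
    next
      fix x assume x: "x \<in> rel_interior F"
      then have xF: "x \<in> F" using rel_interior_subset by blast
      have "0 < w K' x" using basis_pos[OF b F(2) _ x] one False by (simp add: w_def K'_def)
      moreover have "grad K (v K) x \<bullet> outward_normal K F < 0"
        using basis_normal_derivative(2)[OF a F(1) False xF x] by (simp add: v_def K_def)
      ultimately show "0 < \<mu> / 2 * (w K' x * - (grad K (v K) x \<bullet> outward_normal K F))"
        using \<mu> by (intro mult_pos_pos) auto
    qed
    moreover have "FI K F (ip w v F) = - FI K F (\<lambda>x. \<mu> / 2 * (w K' x * - (grad K (v K) x \<bullet> outward_normal K F)))"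
      unfolding set_integral_minus_on[symmetric] by (rule set_integral_cong_on) (rule ip)
    moreover have "FI K F (upw w v F) = 0" by (rule set_integral_zero_on) (rule up(1))
    moreover have "FI K F (stab w v F) = 0" by (rule set_integral_zero_on) (rule up(2))
    ultimately show ?thesis by (simp add: facet_term_def)
  qed
  then show ?thesis using KFeq by (simp add: v_def w_def)
qed

text \<open>Depending on the side of the common facet on which the node lies, the neighbour is a vertex off or on it.\<close>
lemma interior_facet_neg_entry:
  assumes \<mu>: "0 < \<mu>" and a: "a \<in> nodes T" and F: "F facet_of snd a" "F \<in> intF"
  shows "\<exists>b\<in>nodes T. b \<noteq> a \<and> KF (basis P b) (basis P a) < 0"
proof -
  have K: "snd a \<in> T" by (rule nodeD(1)[OF a])
  obtain K' where K': "K' \<in> T" "K' \<noteq> snd a" "F facet_of K'" using interior_facetD[OF F(2) K F(1)] by metis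
  obtain j where j: "j \<in> vertices K'" "fst a \<in> F \<longleftrightarrow> j \<notin> F"
    using facet_has_vertex[OF K'(1,3)] facet_misses_vertex[OF K'(1,3)] by metis
  have b: "(j, K') \<in> nodes T" using j K' by (simp add: nodes_def)
  have "KF (basis P (j, K')) (basis P a) < 0"
    by (rule K_form_neg[OF \<mu> a b _ F(1)]) (use K' j in auto)
  then show ?thesis using b K' by (intro bexI[of _ "(j, K')"]) auto
qed

end


section \<open>Row sums, inviscid entries and elements without interior facets\<close>

context dg_scheme
begin

lemma basis_cont_facet:
  assumes a: "a \<in> nodes T" and F: "F facet_of snd a"
  shows "continuous_on F (basis P a (snd a))" "continuous_on F (\<lambda>x. grad (snd a) (basis P a (snd a)) x)" "continuous_on F \<beta>"
  using reg_cont[OF reg_basis[OF a], of "snd a" F] nodeD(1)[OF a] F by (simp_all add: in_adjacent)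

lemma facet_continuous_integrable:
  "K \<in> T \<Longrightarrow> F facet_of K \<Longrightarrow> continuous_on F f \<Longrightarrow> set_integrable (facet_measure K F) F (f :: _ \<Rightarrow> real)"
  by (rule facet_set_integrable[OF T_poly T_int])

text \<open>Consistency of the scheme with the constant solution.\<close>
lemma row_sum_form:
  assumes a: "a \<in> nodes T"
  shows "KF (\<lambda>_ _. 1) (basis P a) = BF (bdry_interp \<Omega> T P (\<lambda>_. 1)) (basis P a)"
proof -
  define K v where "K = snd a" and "v = basis P a"
  define one where "one = (\<lambda>(_::'n cell) (_::real^'n). 1::real)"
  define W where "W = bdry_interp \<Omega> T P (\<lambda>_. 1)"
  have K: "K \<in> T" using nodeD[OF a] by (simp add: K_def)
  have sv: "supported_on K v" by (simp add: K_def v_def supported_basis)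
  have C1v: "C1_on K (v K)" using C1_basis[OF a] by (simp add: K_def v_def)
  have vol: "(LINT x:K|lborel. vol K one v x) = - (\<Sum>F\<in>facets K. FI K F (\<lambda>x. v K x * (\<beta> x \<bullet> outward_normal K F)))"
  proof -
    have "(LINT x:K|lborel. vol K one v x) = (LINT x:K|lborel. - (\<beta> x \<bullet> grad K (v K) x))"
      by (rule set_integral_cong_on) (simp add: vol_def one_def grad_zero[OF K])
    also have "\<dots> = - (LINT x:K|lborel. \<beta> x \<bullet> grad K (v K) x)" by (rule set_integral_minus_on)
    finally show ?thesis unfolding div_element[OF K C1v] .
  qed
  \<comment> \<open>The volume term is minus the flux through all facets. The upwind term restores
    the flux on interior and outflow facets; on inflow facets it is absent, and the compensating
    flux is the inflow part of the boundary form.\<close>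
  have "facet_term K one v F = FI K F (\<lambda>x. v K x * (\<beta> x \<bullet> outward_normal K F)) + bdry_term K W v F" if F: "F \<in> facets K" for F
  proof -
    have FK: "F facet_of K" using F by simp
    have adj: "K \<in> adjacent T F" using FK K by (simp add: in_adjacent)
    note cf = basis_cont_facet[OF a, of F, folded K_def v_def, OF FK]
    note J = jump_adjacent[OF sv adj] and A = avg_grad_adjacent[OF sv adj]
    have g1: "avg T F (\<lambda>K. grad K (one K)) x = 0" if "x \<in> F" for x
    proof -
      have "grad L (one L) x = 0" if "L \<in> adjacent T F" for L
        using grad_zero[of L x 1] that \<open>x \<in> F\<close> facet_subset_adjacent in_adjacent by (auto simp: one_def)
      then show ?thesis by (simp add: avg_def)
    qed
    have b1: "avg T F (\<lambda>K y. one K y *\<^sub>R \<beta> y) x = \<beta> x" for x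
    proof -
      have "card (adjacent T F) \<noteq> 0" using adj adjacent_finite by auto
      then show ?thesis by (simp add: avg_def one_def sum_constant_scaleR del: sum_constant)
    qed
    have up: "FI K F (upw one v F) = FI K F (\<lambda>x. v K x * (\<beta> x \<bullet> outward_normal K F))"
      by (rule set_integral_cong_on) (simp add: upw_def b1 J)
    have bd: "FI K F (ip one v F) = - FI K F (\<lambda>x. \<mu> * W K x * (grad K (v K) x \<bullet> outward_normal K F))
        + FI K F (\<lambda>x. c_ip * \<mu> / h F * W K x * v K x)" if bF: "F \<in> bdF"
    proof -
      have adj1: "adjacent T F = {K}" by (rule boundary_facetD[OF bF K FK])
      have W1: "W K x = 1" if "x \<in> F" for x using bdry_interp_one[OF K FK bF that] by (simp add: W_def)
      have nn: "outward_normal K F \<bullet> outward_normal K F = 1" by (rule normal_unit[OF K FK])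
      have cW: "continuous_on F (W K)"
        by (rule continuous_on_eq[OF continuous_on_const[of _ 1]]) (simp add: W1)
      have "FI K F (ip one v F) = FI K F (\<lambda>x. c_ip * \<mu> / h F * W K x * v K x - \<mu> * W K x * (grad K (v K) x \<bullet> outward_normal K F))"
      proof (rule set_integral_cong_on)
        fix x assume x: "x \<in> F"
        have j1: "jump T F one x = outward_normal K F" by (simp add: jump_def adj1 one_def)
        show "ip one v F x = c_ip * \<mu> / h F * W K x * v K x - \<mu> * W K x * (grad K (v K) x \<bullet> outward_normal K F)"
          by (simp add: ip_def j1 g1[OF x] J A[OF x] adj1 W1[OF x] nn inner_commute algebra_simps)
      qed
      also have "\<dots> = FI K F (\<lambda>x. c_ip * \<mu> / h F * W K x * v K x) - FI K F (\<lambda>x. \<mu> * W K x * (grad K (v K) x \<bullet> outward_normal K F))"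
        by (rule set_integral_diff(2)) (rule facet_continuous_integrable[OF K FK], intro continuous_intros cf cW)+
      finally show ?thesis by simp
    qed
    show ?thesis
      using K FK
    proof (cases rule: facet_trichotomy)
      case int
      obtain K' where K': "adjacent T F = {K, K'}" "K' \<noteq> K" "outward_normal K' F = - outward_normal K F"
        using interior_facetD[OF int(1) K FK] by metis
      have j0: "jump T F one x = 0" for x using K' by (simp add: jump_def one_def)
      have "FI K F (ip one v F) = 0" by (rule set_integral_zero_on) (simp add: ip_def j0 g1)
      moreover have "FI K F (stab one v F) = 0" by (rule set_integral_zero_on) (simp add: stab_def j0)
      moreover have "F \<notin> bdF" using int interior_not_boundary by blast
      ultimately show ?thesis using int up by (simp add: facet_term_def bdry_term_def)
    next
      case inflow
      have "FI K F (\<lambda>x. (\<beta> x \<bullet> outward_normal K F) * W K x * v K x) = FI K F (\<lambda>x. v K x * (\<beta> x \<bullet> outward_normal K F))"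
        by (rule set_integral_cong_on) (use bdry_interp_one[OF K FK inflow(2)] in \<open>simp add: W_def\<close>)
      then show ?thesis using inflow bd by (simp add: facet_term_def bdry_term_def)
    next
      case out
      then show ?thesis using up bd by (simp add: facet_term_def bdry_term_def)
    qed
  qed
  then have "KF one v = (\<Sum>F\<in>facets K. bdry_term K W v F)"
    unfolding K_form_local[OF K sv] vol by (simp add: sum.distrib)
  then show ?thesis unfolding B_form_local[OF K sv, symmetric] by (simp add: one_def v_def W_def)
qed

lemma row_sum:
  assumes a: "a \<in> nodes T"
  shows "(\<Sum>b\<in>nodes T. KF (basis P b) (basis P a)) = (\<Sum>b\<in>bdry_nodes T \<Omega>. BF (basis P b) (basis P a))"
  using row_sum_form[OF a]
    K_form_lincomb[OF nodeD(1)[OF a] supported_basis reg_basis[OF a] lincomb_one]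
    B_form_lincomb[OF nodeD(1)[OF a] supported_basis reg_basis[OF a] lincomb_bdry[of "\<lambda>_. 1"]] by simp

lemma diagonal_nonneg:
  assumes \<mu>: "\<mu> = 0" and a: "a \<in> nodes T"
  shows "0 \<le> KF (basis P a) (basis P a)"
proof -
  define K v where "K = snd a" and "v = basis P a"
  have K: "K \<in> T" using nodeD[OF a] by (simp add: K_def)
  have sv: "supported_on K v" by (simp add: K_def v_def supported_basis)
  have C1v: "C1_on K (v K)" using C1_basis[OF a] by (simp add: K_def v_def)
  note sq = C1_on_square[OF T_convex[OF K] T_int[OF K] C1v]
  have vol: "(LINT x:K|lborel. vol K v v x) = - (\<Sum>F\<in>facets K. FI K F (\<lambda>x. (v K x * v K x) * (\<beta> x \<bullet> outward_normal K F))) / 2"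
  proof -
    have "(LINT x:K|lborel. vol K v v x) = (LINT x:K|lborel. (- 1 / 2) * (\<beta> x \<bullet> grad K (\<lambda>x. v K x * v K x) x))"
      unfolding vol_def by (rule set_integral_cong_on) (simp add: \<mu> sq(2))
    also have "\<dots> = (- 1 / 2) * (LINT x:K|lborel. \<beta> x \<bullet> grad K (\<lambda>x. v K x * v K x) x)"
      by (rule set_integral_mult_right)
    finally show ?thesis unfolding div_element[OF K sq(1)] by simp
  qed
  \<comment> \<open>Half the flux of \<open>v * v\<close> is charged to each facet. The average on
    an interior facet pays it exactly and leaves the stabilization; an outflow facet has half of its
    flux left over; on an inflow facet the flux is nonpositive, so the charge itself has the right
    sign.\<close>
  have "0 \<le> facet_term K v v F - FI K F (\<lambda>x. (v K x * v K x) * (\<beta> x \<bullet> outward_normal K F)) / 2" if F: "F \<in> facets K" for F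
  proof -
    have FK: "F facet_of K" using F by simp
    have adj: "K \<in> adjacent T F" using FK K by (simp add: in_adjacent)
    note J = jump_adjacent[OF sv adj] and Ab = avg_\<beta>_supported[OF sv]
    have nn: "outward_normal K F \<bullet> outward_normal K F = 1" by (rule normal_unit[OF K FK])
    have ip: "FI K F (ip v v F) = 0" unfolding ip_def by (rule set_integral_zero_on) (simp add: \<mu>)
    show ?thesis
      using K FK
    proof (cases rule: facet_trichotomy)
      case int
      have "card (adjacent T F) = 2" using interior_facetD[OF int(1) K FK] by (metis card_2_iff)
      then have "FI K F (upw v v F) = FI K F (\<lambda>x. (1 / 2) * ((v K x * v K x) * (\<beta> x \<bullet> outward_normal K F)))"
        by (intro set_integral_cong_on) (simp add: upw_def Ab adj J)
      also have "\<dots> = (1 / 2) * FI K F (\<lambda>x. (v K x * v K x) * (\<beta> x \<bullet> outward_normal K F))"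
        by (rule set_integral_mult_right)
      finally have up: "FI K F (upw v v F) = FI K F (\<lambda>x. (v K x * v K x) * (\<beta> x \<bullet> outward_normal K F)) / 2" by simp
      have "0 \<le> FI K F (stab v v F)" by (rule set_integral_nonneg_on) (simp add: stab_def J nn)
      then show ?thesis using int up ip by (simp add: facet_term_def)
    next
      case inflow
      have "0 \<le> FI K F (\<lambda>x. - ((v K x * v K x) * (\<beta> x \<bullet> outward_normal K F)))"
        by (rule set_integral_nonneg_on) (use inflow_sign[OF K FK inflow(1)] in \<open>simp add: mult_nonneg_nonpos\<close>)
      then show ?thesis unfolding set_integral_minus_on using inflow ip by (simp add: facet_term_def)
    next
      case out
      have "card (adjacent T F) = 1" using boundary_facetD[OF out(2) K FK] by simp
      then have up: "FI K F (upw v v F) = FI K F (\<lambda>x. (v K x * v K x) * (\<beta> x \<bullet> outward_normal K F))"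
        by (intro set_integral_cong_on) (simp add: upw_def Ab adj J)
      have "0 \<le> FI K F (\<lambda>x. (v K x * v K x) * (\<beta> x \<bullet> outward_normal K F))"
        by (rule set_integral_nonneg_on) (use outflow_sign[OF K FK out(1)] in simp)
      then show ?thesis using out ip up by (simp add: facet_term_def)
    qed
  qed
  then have "0 \<le> (\<Sum>F\<in>facets K. facet_term K v v F - FI K F (\<lambda>x. (v K x * v K x) * (\<beta> x \<bullet> outward_normal K F)) / 2)"
    by (rule sum_nonneg)
  also have "\<dots> = KF v v"
    unfolding K_form_local[OF K sv] vol by (simp add: sum_subtractf sum_divide_distrib)
  finally show ?thesis by (simp add: v_def)
qed

lemma inflow_term_nonneg:
  assumes K: "K \<in> T" and F: "F facet_of K" "F \<in> inF" and w: "\<And>x. x \<in> F \<Longrightarrow> 0 \<le> w x" and v: "\<And>x. x \<in> F \<Longrightarrow> 0 \<le> v x"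
  shows "0 \<le> - FI K F (\<lambda>x. (\<beta> x \<bullet> outward_normal K F) * w x * v x)"
  unfolding set_integral_minus_on[symmetric]
  by (rule set_integral_nonneg_on) (use inflow_sign[OF K F] w v in \<open>simp add: mult_nonpos_nonneg mult_nonneg_nonneg mult.assoc\<close>)

lemma inviscid_boundary_entry_nonneg:
  assumes \<mu>: "\<mu> = 0" and a: "a \<in> nodes T" and b: "b \<in> nodes T"
  shows "0 \<le> BF (basis P b) (basis P a)"
proof -
  have K: "snd a \<in> T" by (rule nodeD(1)[OF a])
  have "0 \<le> bdry_term (snd a) (basis P b) (basis P a) F" if "F \<in> facets (snd a)" for F
  proof -
    have F: "F facet_of snd a" using that by simp
    have nonneg: "0 \<le> basis P c (snd a) x" if "c \<in> nodes T" "x \<in> F" for c x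
      using basis_nonneg[OF that(1) K] that F facet_of_imp_subset by blast
    have "0 \<le> - FI (snd a) F (\<lambda>x. (\<beta> x \<bullet> outward_normal (snd a) F) * basis P b (snd a) x * basis P a (snd a) x)"
      if "F \<in> inF" by (rule inflow_term_nonneg[OF K F that]) (rule nonneg[OF b] nonneg[OF a], assumption)+
    then show ?thesis unfolding bdry_term_def by (simp add: \<mu> set_lebesgue_integral_def)
  qed
  then show ?thesis unfolding B_form_local[OF K supported_basis] by (rule sum_nonneg)
qed

text \<open>The divergence theorem for a constant field. It removes the total flux of a constant
  shape gradient.\<close>

lemma facet_normals_sum_zero:
  assumes K: "K \<in> T"
  shows "(\<Sum>F\<in>facets K. FI K F (\<lambda>x. c \<bullet> outward_normal K F)) = 0"
proof -
  have "(LINT x:K|lborel. 0) = (\<Sum>F\<in>facets K. FI K F (\<lambda>x. c \<bullet> outward_normal K F))"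
    by (rule polytope_divergence[OF T_poly[OF K] T_int[OF K], where G'="\<lambda>_ _. 0"]) auto
  then show ?thesis by (simp add: set_lebesgue_integral_def)
qed

lemma facet_of_vertex:
  assumes K: "K \<in> T" and i: "i \<in> vertices K"
  obtains F where "F facet_of K" "i \<in> F"
proof -
  have f: "{i} face_of K" using i by (simp add: vertices_def face_of_singleton)
  have "{i} \<noteq> K" using T_int[OF K] by (metis interior_singleton)
  then obtain F where "F facet_of K" "{i} \<subseteq> F"
    using face_of_polyhedron_subset_facet[OF T_polyhedron[OF K] f] by blast
  then show ?thesis using that by blast
qed

text \<open>With a constant gradient, the sum of all boundary entries is the form at the interpolant
  of one: the fluxes cancel over the facets, and a positive penalty remains, so some entry is
  positive. Otherwise take the opposite vertex: the two traces are never both nonzero on a facet, so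
  only flux terms remain, and these are positive on the facets through that vertex.\<close>

lemma isolated_element_pos_entry:
  assumes \<mu>: "0 < \<mu>" and a: "a \<in> nodes T" and all: "\<And>F. F facet_of snd a \<Longrightarrow> F \<in> bdF"
  shows "\<exists>b\<in>bdry_nodes T \<Omega>. 0 < BF (basis P b) (basis P a)"
proof -
  define K i v where "K = snd a" and "i = fst a" and "v = basis P a"
  have K: "K \<in> T" and i: "i \<in> vertices K" using nodeD[OF a] by (auto simp: K_def i_def)
  have bF: "F \<in> bdF" if "F facet_of K" for F using all that by (simp add: K_def)
  have sv: "supported_on K v" and rv: "reg v" using reg_basis[OF a] by (simp_all add: K_def v_def supported_basis)
  have fin: "finite (facets K)" using T_poly[OF K] by (rule finite_polytope_facets)
  have pen: "0 < c_ip * \<mu> / h F" if "F facet_of K" for F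
    using length[of F] bF[OF that] \<mu> by (simp add: c_ip_def)
  have vn: "0 \<le> v K x" if "F facet_of K" "x \<in> F" for F x
    using basis_nonneg[OF a K] that facet_of_imp_subset by (auto simp: v_def)
  note cf = basis_cont_facet[OF a, folded K_def v_def]
  from nodal_element.flat_or_opposite[OF element[OF K] i] show ?thesis
  proof
    assume "\<exists>w. \<forall>x\<in>K. grad K (shape P K i) x = w"
    then obtain w0 where w0: "\<And>x. x \<in> K \<Longrightarrow> grad K (v K) x = w0" by (auto simp: v_def K_def i_def basis_self)
    define W where "W = bdry_interp \<Omega> T P (\<lambda>_. 1)"
    define S where "S F = FI K F (\<lambda>x. w0 \<bullet> outward_normal K F)" for F
    have W1: "W K x = 1" if "F facet_of K" "x \<in> F" for F x
      using bdry_interp_one[OF K that(1) bF[OF that(1)] that(2)] by (simp add: W_def)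
    \<comment> \<open>Adding \<open>\<mu> * S F\<close> removes the flux from each facet term; it is
      free in the end, as the \<open>S F\<close> sum to zero. The facets through the vertex of
      \<open>a\<close> give strict positivity.\<close>
    have ge: "0 \<le> bdry_term K W v F + \<mu> * S F" and gt: "i \<in> F \<Longrightarrow> 0 < bdry_term K W v F + \<mu> * S F" if F: "F facet_of K" for F
    proof -
      have xK: "x \<in> K" if "x \<in> F" for x using that F facet_of_imp_subset by blast
      have "FI K F (\<lambda>x. \<mu> * W K x * (grad K (v K) x \<bullet> outward_normal K F)) = FI K F (\<lambda>x. \<mu> * (w0 \<bullet> outward_normal K F))"
        by (rule set_integral_cong_on) (simp add: W1[OF F] w0[OF xK])
      also have "\<dots> = \<mu> * S F" unfolding S_def by (rule set_integral_mult_right)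
      finally have 1: "FI K F (\<lambda>x. \<mu> * W K x * (grad K (v K) x \<bullet> outward_normal K F)) = \<mu> * S F" .
      have 2: "FI K F (\<lambda>x. c_ip * \<mu> / h F * W K x * v K x) = FI K F (\<lambda>x. c_ip * \<mu> / h F * v K x)"
        by (rule set_integral_cong_on) (simp add: W1[OF F])
      have in0: "0 \<le> (if F \<in> inF then - FI K F (\<lambda>x. (\<beta> x \<bullet> outward_normal K F) * W K x * v K x) else 0)"
        using inflow_term_nonneg[OF K F, of "W K" "v K"] W1[OF F] vn[OF F] by auto
      have eq: "bdry_term K W v F + \<mu> * S F = (if F \<in> inF then - FI K F (\<lambda>x. (\<beta> x \<bullet> outward_normal K F) * W K x * v K x) else 0)
          + FI K F (\<lambda>x. c_ip * \<mu> / h F * v K x)"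
        using bF[OF F] 1 2 by (simp add: bdry_term_def)
      have "0 \<le> FI K F (\<lambda>x. c_ip * \<mu> / h F * v K x)"
        by (rule set_integral_nonneg_on) (rule mult_nonneg_nonneg[OF less_imp_le[OF pen[OF F]] vn[OF F]])
      then show "0 \<le> bdry_term K W v F + \<mu> * S F" using in0 eq by linarith
      assume iF: "i \<in> F"
      have "0 < FI K F (\<lambda>x. c_ip * \<mu> / h F * v K x)"
      proof (rule facet_integral_pos_rel_interior[OF K F])
        show "continuous_on F (\<lambda>x. c_ip * \<mu> / h F * v K x)" by (intro continuous_intros cf[OF F])
        show "0 \<le> c_ip * \<mu> / h F * v K x" if "x \<in> F" for x
          by (rule mult_nonneg_nonneg[OF less_imp_le[OF pen[OF F]] vn[OF F that]])
        show "0 < c_ip * \<mu> / h F * v K x" if "x \<in> rel_interior F" for x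
          using pen[OF F] basis_pos[OF a, of F x] F iF that by (intro mult_pos_pos) (auto simp: v_def K_def i_def)
      qed
      then show "0 < bdry_term K W v F + \<mu> * S F" using in0 eq by linarith
    qed
    obtain F0 where F0: "F0 facet_of K" "i \<in> F0" using facet_of_vertex[OF K i] by blast
    have "0 < (\<Sum>F\<in>facets K. bdry_term K W v F + \<mu> * S F)"
      by (rule sum_pos2[OF fin, of F0]) (use F0 ge gt in auto)
    also have "\<dots> = BF W v"
      unfolding B_form_local[OF K sv] using facet_normals_sum_zero[OF K, of w0]
      by (simp add: sum.distrib S_def flip: sum_distrib_left)
    also have "\<dots> = (\<Sum>b\<in>bdry_nodes T \<Omega>. 1 * BF (basis P b) v)"
      unfolding W_def by (rule B_form_lincomb[OF K sv rv lincomb_bdry[of "\<lambda>_. 1"]])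
    finally have "0 < (\<Sum>b\<in>bdry_nodes T \<Omega>. BF (basis P b) v)" by simp
    then show ?thesis unfolding v_def by (meson not_le sum_nonpos)
  next
    assume "\<exists>j\<in>vertices K. \<forall>F. F facet_of K \<longrightarrow> \<not> (i \<in> F \<and> j \<in> F)"
    then obtain j where j: "j \<in> vertices K" "\<And>F. F facet_of K \<Longrightarrow> j \<in> F \<Longrightarrow> i \<notin> F" by blast
    define b where "b = (j, K)"
    have bn: "b \<in> nodes T" using j K by (simp add: b_def nodes_def)
    obtain F0 where F0: "F0 facet_of K" "j \<in> F0" using facet_of_vertex[OF K j(1)] by blast
    have bb: "b \<in> bdry_nodes T \<Omega>" using bn F0 bF[OF F0(1)] by (auto simp: bdry_nodes_def b_def boundary_facets_def)
    define w where "w = basis P b"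
    have sb: "snd b = K" "fst b = j" by (simp_all add: b_def)
    have cw: "continuous_on F (w K)" if "F facet_of K" for F
      using basis_cont_facet(1)[OF bn, of F] that by (simp add: sb w_def)
    have ge: "0 \<le> bdry_term K w v F" and gt: "j \<in> F \<Longrightarrow> 0 < bdry_term K w v F" if F: "F facet_of K" for F
    proof -
      \<comment> \<open>Each facet misses one of the two opposite vertices, so one of the two traces
        vanishes on it.\<close>
      have wv: "w K x * v K x = 0" if x: "x \<in> F" for x
      proof (cases "j \<in> F")
        case True
        then show ?thesis using basis_vanish[OF a, of F x] j(2)[OF F] F x by (simp add: v_def K_def i_def)
      next
        case False
        then show ?thesis using basis_vanish[OF bn, of F x] F x by (simp add: w_def sb)
      qed
      have 1: "FI K F (\<lambda>x. (\<beta> x \<bullet> outward_normal K F) * w K x * v K x) = 0"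
        by (rule set_integral_zero_on) (simp add: mult.assoc wv)
      have 2: "FI K F (\<lambda>x. c_ip * \<mu> / h F * w K x * v K x) = 0"
        by (rule set_integral_zero_on) (use wv in \<open>simp add: mult.assoc\<close>)
      have eq: "bdry_term K w v F = FI K F (\<lambda>x. - (\<mu> * w K x * (grad K (v K) x \<bullet> outward_normal K F)))"
        unfolding set_integral_minus_on bdry_term_def using bF[OF F] 1 2 by simp
      have wn: "0 \<le> w K x" if "x \<in> F" for x
        using basis_nonneg[OF bn K] that F facet_of_imp_subset by (auto simp: w_def)
      have gn: "grad K (v K) x \<bullet> outward_normal K F \<le> 0" if "j \<in> F" "x \<in> F" for x
        using basis_normal_derivative(1)[OF a, of F x] j(2)[OF F that(1)] F that(2) by (simp add: v_def K_def i_def)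
      have pt: "0 \<le> - (\<mu> * w K x * (grad K (v K) x \<bullet> outward_normal K F))" if x: "x \<in> F" for x
      proof (cases "j \<in> F")
        case True
        have "0 \<le> \<mu> * w K x" using \<mu> wn[OF x] by simp
        then show ?thesis using gn[OF True x] by (simp add: mult_nonneg_nonpos)
      next
        case False
        then show ?thesis using basis_vanish[OF bn, of F x] F x by (simp add: w_def sb)
      qed
      show "0 \<le> bdry_term K w v F" unfolding eq by (rule set_integral_nonneg_on) (rule pt)
      assume jF: "j \<in> F"
      show "0 < bdry_term K w v F" unfolding eq
      proof (rule facet_integral_pos_rel_interior[OF K F _ pt])
        show "continuous_on F (\<lambda>x. - (\<mu> * w K x * (grad K (v K) x \<bullet> outward_normal K F)))"
          by (intro continuous_intros cf[OF F] cw[OF F])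
        fix x assume x: "x \<in> rel_interior F"
        then have xF: "x \<in> F" using rel_interior_subset by blast
        have "0 < w K x" using basis_pos[OF bn, of F x] F jF x by (simp add: w_def sb)
        moreover have "grad K (v K) x \<bullet> outward_normal K F < 0"
          using basis_normal_derivative(2)[OF a, of F x] j(2)[OF F jF] F xF x by (simp add: v_def K_def i_def)
        ultimately show "0 < - (\<mu> * w K x * (grad K (v K) x \<bullet> outward_normal K F))"
          using \<mu> by (simp add: mult_pos_neg)
      qed
    qed
    have "0 < (\<Sum>F\<in>facets K. bdry_term K w v F)"
      by (rule sum_pos2[OF fin, of F0]) (use F0 ge gt in auto)
    then have "0 < BF w v" unfolding B_form_local[OF K sv] .
    then show ?thesis using bb by (auto simp: w_def v_def)
  qed
qed

end


section \<open>The discrete maximum principle\<close>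

lemma weighted_sums_zero:
  fixes p d :: "'b \<Rightarrow> real" and q e :: "'c \<Rightarrow> real"
  assumes fin: "finite A" "finite B"
    and A: "\<And>b. b \<in> A \<Longrightarrow> 0 \<le> p b \<and> 0 < d b" and B: "\<And>b. b \<in> B \<Longrightarrow> 0 \<le> q b \<and> 0 < e b"
    and sum: "(\<Sum>b\<in>A. p b * d b) + (\<Sum>b\<in>B. q b * e b) = 0"
  shows "b \<in> A \<Longrightarrow> p b = 0" "c \<in> B \<Longrightarrow> q c = 0"
proof -
  have A': "0 \<le> p b * d b" if "b \<in> A" for b using A[OF that] by simp
  have B': "0 \<le> q b * e b" if "b \<in> B" for b using B[OF that] by simp
  have "0 \<le> (\<Sum>b\<in>A. p b * d b)" by (rule sum_nonneg) (rule A')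
  moreover have "0 \<le> (\<Sum>b\<in>B. q b * e b)" by (rule sum_nonneg) (rule B')
  ultimately have z: "(\<Sum>b\<in>A. p b * d b) = 0" "(\<Sum>b\<in>B. q b * e b) = 0" using sum by linarith+
  show "p b = 0" if "b \<in> A"
  proof -
    have "p b * d b = 0" by (rule sum_nonneg_0[of A "\<lambda>b. p b * d b"]) (use A' z(1) fin(1) that in auto)
    then show ?thesis using A[OF that] by simp
  qed
  show "q c = 0" if "c \<in> B"
  proof -
    have "q c * e c = 0" by (rule sum_nonneg_0[of B "\<lambda>b. q b * e b"]) (use B' z(2) fin(2) that in auto)
    then show ?thesis using B[OF that] by simp
  qed
qed

context dg_scheme
begin

lemma node_val_basis:
  assumes "a \<in> nodes T" "c \<in> nodes T"
  shows "node_val (basis P a) c = (if c = a then 1 else 0)"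
proof (cases "snd c = snd a")
  case True
  then show ?thesis
    using nodal_element.delta[OF element[OF nodeD(1)[OF assms(1)]] nodeD(2)[OF assms(1)], of "fst c"] nodeD(2)[OF assms(2)]
    by (auto simp: node_val_def basis_def prod_eq_iff)
qed (auto simp: node_val_def basis_other)

lemma node_val_bdry_interp:
  assumes b: "b \<in> bdry_nodes T \<Omega>"
  shows "node_val (bdry_interp \<Omega> T P ubar) b = ubar (fst b)"
proof -
  have "node_val (bdry_interp \<Omega> T P ubar) b = (\<Sum>c\<in>bdry_nodes T \<Omega>. ubar (fst c) * node_val (basis P c) b)"
    by (simp add: node_val_def bdry_interp_def)
  also have "\<dots> = (\<Sum>c\<in>bdry_nodes T \<Omega>. if c = b then ubar (fst c) else 0)"
  proof (rule sum.cong[OF refl])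
    fix c assume "c \<in> bdry_nodes T \<Omega>"
    then have "c \<in> nodes T" "b \<in> nodes T" using b bdry_nodes_subset by blast+
    then show "ubar (fst c) * node_val (basis P c) b = (if c = b then ubar (fst c) else 0)"
      by (simp add: node_val_basis)
  qed
  also have "\<dots> = ubar (fst b)"
    using b finite_subset[OF bdry_nodes_subset finite_nodes] by simp
  finally show ?thesis .
qed

lemma closed_patch: "closed (patch T a)"
  unfolding patch_def using finite_T T_compact by (intro closed_Union) (auto simp: compact_imp_closed)

text \<open>A patch lies in the closure of the domain, so its interior lies in the domain and
  contains no boundary vertex. Hence the datum at a boundary neighbour is among the
  \<open>patch_vals\<close>.\<close>

lemma bdry_nbr_in_frontier:
  assumes b: "b \<in> bdry_nbrs T \<Omega> a"
  shows "fst b \<in> frontier (patch T a) \<inter> frontier \<Omega>"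
proof -
  have fb: "fst b \<in> patch T a" "fst b \<in> frontier \<Omega>" using b by (auto simp: bdry_nbrs_def nbrs_def bdry_nodes_def)
  have "patch T a \<subseteq> closure \<Omega>" unfolding patch_def using Union_T by blast
  then have "interior (patch T a) \<subseteq> \<Omega>" using interior_mono interior_closure by blast
  then have "fst b \<notin> interior (patch T a)" using fb(2) open_\<Omega> by (auto simp: frontier_def interior_open)
  then show ?thesis using fb closed_patch by (simp add: frontier_def)
qed

lemma self_nbr: "a \<in> nodes T \<Longrightarrow> a \<in> nbrs T a"
  unfolding nbrs_def patch_def using nodeD by blast

lemma nbrs_subset: "nbrs T a \<subseteq> nodes T" by (auto simp: nbrs_def)

text \<open>Test with the basis function of \<open>a\<close>, then subtract
  \<open>node_val u a\<close> times the row-sum identity. This turns every coefficient into a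
  multiplier of a difference to the value at \<open>a\<close>, the form to which sign arguments
  apply.\<close>

lemma solution_row:
  assumes a: "a \<in> nodes T" and sol: "stabilized_solution \<Omega> T P \<beta> \<mu> h \<alpha> (\<lambda>x. 0) ubar u"
  defines "w \<equiv> bdry_interp \<Omega> T P ubar"
  shows "(\<Sum>b\<in>nbrs T a - {a}. (nu_off \<Omega> T P \<beta> \<mu> h \<alpha> u w a b - KF (basis P b) (basis P a)) * (node_val u a - node_val u b))
    + (\<Sum>b\<in>bdry_nbrs T \<Omega> a. (nu_bdry \<Omega> T P \<beta> \<mu> h \<alpha> u w a b + BF (basis P b) (basis P a)) * (node_val u a - ubar (fst b))) = 0"
proof -
  define v where "v = basis P a"
  define A B where "A = nbrs T a - {a}" and "B = bdry_nbrs T \<Omega> a"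
  define k l where "k b = KF (basis P b) v" and "l b = BF (basis P b) v" for b
  define no nb where "no b = nu_off \<Omega> T P \<beta> \<mu> h \<alpha> u w a b" and "nb b = nu_bdry \<Omega> T P \<beta> \<mu> h \<alpha> u w a b" for b
  define U where "U b = node_val u b" for b
  have uV: "u \<in> V_space T P" using sol by (simp add: stabilized_solution_def Let_def)
  \<comment> \<open>Membership includes the branches on the other elements, so the zero function has
    to lie in each local space.\<close>
  have vV: "v \<in> V_space T P" unfolding V_space_def
  proof (intro CollectI ballI)
    fix L assume L: "L \<in> T"
    show "v L \<in> P L"
    proof (cases "L = snd a")
      case True
      then show ?thesis using nodal_element.mem[OF element[OF L]] nodeD[OF a] by (simp add: v_def basis_self)
    next
      case False
      have z: "v L = (\<lambda>x. 0)" using False by (simp add: v_def basis_other)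
      consider "P L = P1 L" | \<Phi> where "P L = Q1 \<Phi>" using mesh L by (auto simp: fe_mesh_def)
      then show ?thesis
      proof cases
        case 1
        then show ?thesis unfolding z by (auto simp: P1_def intro!: exI[of _ 0])
      next
        case 2
        have "(\<lambda>x. 0) \<in> multilinear" by (auto simp: multilinear_def intro!: exI[of _ "\<lambda>_. 0"])
        then show ?thesis unfolding z 2 by (auto simp: Q1_def)
      qed
    qed
  qed
  have K: "snd a \<in> T" by (rule nodeD(1)[OF a])
  have finN: "finite (nbrs T a)" by (rule finite_subset[OF nbrs_subset finite_nodes])
  have B_sub: "B \<subseteq> bdry_nodes T \<Omega>" by (auto simp: B_def bdry_nbrs_def)
  have fin_bd: "finite (bdry_nodes T \<Omega>)" by (rule finite_subset[OF bdry_nodes_subset finite_nodes])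
  have nbrsA: "sum f (nbrs T a) = f a + sum f A" for f :: "_ \<Rightarrow> real"
    unfolding A_def by (rule sum.remove[OF finN self_nbr[OF a]])
  have k0: "k b = 0" if "b \<in> nodes T - nbrs T a" for b using K_form_not_nbr[OF a] that by (simp add: k_def v_def)
  have l0: "l b = 0" if "b \<in> bdry_nodes T \<Omega> - B" for b
    using B_form_not_nbr[OF a, of b] that bdry_nodes_subset by (auto simp: l_def v_def B_def bdry_nbrs_def)
  have KU: "KF u v = U a * k a + (\<Sum>b\<in>A. U b * k b)"
  proof -
    have "KF u v = (\<Sum>b\<in>nodes T. U b * k b)"
      using K_form_lincomb[OF K supported_basis reg_basis[OF a] lincomb_V[OF uV]] by (simp add: v_def k_def U_def)
    also have "\<dots> = (\<Sum>b\<in>nbrs T a. U b * k b)"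
      by (rule sum.mono_neutral_right[OF finite_nodes nbrs_subset]) (use k0 in auto)
    finally show ?thesis by (simp add: nbrsA)
  qed
  have BU: "BF w v = (\<Sum>b\<in>B. ubar (fst b) * l b)"
  proof -
    have "BF w v = (\<Sum>b\<in>bdry_nodes T \<Omega>. ubar (fst b) * l b)"
      using B_form_lincomb[OF K supported_basis reg_basis[OF a] lincomb_bdry] by (simp add: v_def l_def w_def)
    also have "\<dots> = (\<Sum>b\<in>B. ubar (fst b) * l b)"
      by (rule sum.mono_neutral_right[OF fin_bd B_sub]) (use l0 in auto)
    finally show ?thesis .
  qed
  have rs: "k a + (\<Sum>b\<in>A. k b) = (\<Sum>b\<in>B. l b)"
  proof -
    have "(\<Sum>b\<in>nodes T. k b) = (\<Sum>b\<in>nbrs T a. k b)"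
      by (rule sum.mono_neutral_right[OF finite_nodes nbrs_subset]) (use k0 in auto)
    moreover have "(\<Sum>b\<in>bdry_nodes T \<Omega>. l b) = (\<Sum>b\<in>B. l b)"
      by (rule sum.mono_neutral_right[OF fin_bd B_sub]) (use l0 in auto)
    ultimately show ?thesis using row_sum[OF a] by (simp add: k_def l_def v_def nbrsA)
  qed
  \<comment> \<open>Nodal values of a basis function are Kronecker deltas, so testing picks the row
    of \<open>a\<close> out of the viscosity sums.\<close>
  have select: "(\<Sum>c\<in>nodes T. \<Sum>b\<in>N c. f c b * node_val v c * g c b) = (\<Sum>b\<in>N a. f a b * g a b)" for f g and N :: "_ \<Rightarrow> 'b set"
  proof -
    have "(\<Sum>c\<in>nodes T. \<Sum>b\<in>N c. f c b * node_val v c * g c b) = (\<Sum>c\<in>nodes T. if c = a then (\<Sum>b\<in>N c. f c b * g c b) else 0)"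
      by (rule sum.cong) (auto simp: v_def node_val_basis[OF a])
    then show ?thesis using a finite_nodes by simp
  qed
  have "K_stab \<Omega> T P \<beta> \<mu> h \<alpha> u w u v = G_form T (\<lambda>x. 0) v + B_stab \<Omega> T P \<beta> \<mu> h \<alpha> u w w v"
    using sol vV by (simp add: stabilized_solution_def Let_def w_def)
  moreover have "G_form T (\<lambda>x. 0) v = 0" by (simp add: G_form_def set_lebesgue_integral_def)
  moreover have "K_stab \<Omega> T P \<beta> \<mu> h \<alpha> u w u v = KF u v + (\<Sum>b\<in>nbrs T a. nu \<Omega> T P \<beta> \<mu> h \<alpha> u w a b * (U b * ell a b))"
  proof -
    have "K_stab \<Omega> T P \<beta> \<mu> h \<alpha> u w u v = KF u v +
      (\<Sum>c\<in>nodes T. \<Sum>b\<in>nbrs T c. nu \<Omega> T P \<beta> \<mu> h \<alpha> u w c b * node_val v c * (U b * ell c b))"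
      by (simp add: K_stab_def U_def mult.assoc)
    then show ?thesis unfolding select .
  qed
  moreover have "(\<Sum>b\<in>nbrs T a. nu \<Omega> T P \<beta> \<mu> h \<alpha> u w a b * (U b * ell a b)) = (sum no A + sum nb B) * U a - (\<Sum>b\<in>A. no b * U b)"
  proof -
    have "(\<Sum>b\<in>A. nu \<Omega> T P \<beta> \<mu> h \<alpha> u w a b * (U b * ell a b)) = (\<Sum>b\<in>A. - (no b * U b))"
      by (rule sum.cong) (auto simp: A_def nu_def ell_def no_def)
    moreover have "nu \<Omega> T P \<beta> \<mu> h \<alpha> u w a a = sum no A + sum nb B" by (simp add: nu_def A_def B_def no_def nb_def)
    ultimately show ?thesis unfolding nbrsA by (simp add: ell_def sum_negf)
  qed
  moreover have "B_stab \<Omega> T P \<beta> \<mu> h \<alpha> u w w v = BF w v + (\<Sum>b\<in>B. nb b * ubar (fst b))"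
  proof -
    have "(\<Sum>b\<in>B. nb b * node_val w b) = (\<Sum>b\<in>B. nb b * ubar (fst b))"
      by (rule sum.cong) (use B_sub in \<open>auto simp: w_def node_val_bdry_interp subset_iff\<close>)
    then show ?thesis unfolding B_stab_def select by (simp add: B_def nb_def)
  qed
  ultimately have main: "U a * k a + (\<Sum>b\<in>A. U b * k b) + ((sum no A + sum nb B) * U a - (\<Sum>b\<in>A. no b * U b)) =
     (\<Sum>b\<in>B. ubar (fst b) * l b) + (\<Sum>b\<in>B. nb b * ubar (fst b))"
    using KU BU by simp
  \<comment> \<open>Here \<open>rs\<close> trades the diagonal entry \<open>k a\<close> for the
    other entries of the row, while the diagonal viscosity is by definition the sum of all
    off-diagonal and boundary viscosities.\<close>
  have "(\<Sum>b\<in>A. (no b - k b) * (U a - U b)) + (\<Sum>b\<in>B. (nb b + l b) * (U a - ubar (fst b))) =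
    (sum no A - sum k A + sum nb B + sum l B) * U a - (\<Sum>b\<in>A. no b * U b) + (\<Sum>b\<in>A. U b * k b)
     - (\<Sum>b\<in>B. nb b * ubar (fst b)) - (\<Sum>b\<in>B. ubar (fst b) * l b)"
    by (simp add: algebra_simps sum.distrib sum_subtractf sum_distrib_left)
  also have "\<dots> = 0" using main rs[symmetric] by (simp add: algebra_simps)
  finally show ?thesis by (simp add: A_def B_def k_def l_def no_def nb_def U_def v_def)
qed

lemma no_extreme_row:
  assumes nondeg: "\<And>a. \<mu> = 0 \<Longrightarrow> a \<in> nodes T \<Longrightarrow> \<exists>b\<in>nodes T. KF (basis P b) (basis P a) \<noteq> 0"
    and a: "a \<in> nodes T"
    and k: "\<And>b. b \<in> nbrs T a - {a} \<Longrightarrow> 0 \<le> KF (basis P b) (basis P a)"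
    and l: "\<And>b. b \<in> bdry_nbrs T \<Omega> a \<Longrightarrow> BF (basis P b) (basis P a) \<le> 0"
  shows False
proof -
  \<comment> \<open>The entries of the wrong sign found below belong to nodes not known to be
    neighbours. Entries of non-neighbours vanish, so the sign conditions extend to all
    nodes.\<close>
  have k': "0 \<le> KF (basis P b) (basis P a)" if "b \<in> nodes T" "b \<noteq> a" for b
    using k[of b] K_form_not_nbr[OF a that(1)] that(2) by (cases "b \<in> nbrs T a") auto
  have l': "BF (basis P b) (basis P a) \<le> 0" if "b \<in> bdry_nodes T \<Omega>" for b
    using l[of b] B_form_not_nbr[OF a, of b] that bdry_nodes_subset
    by (cases "b \<in> nbrs T a") (auto simp: bdry_nbrs_def)
  show False
  proof (cases "\<mu> = 0")
    case False
    then have \<mu>: "0 < \<mu>" using diffusion by simp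
    show False
    proof (cases "\<exists>F. F facet_of snd a \<and> F \<in> intF")
      case True
      then show False using interior_facet_neg_entry[OF \<mu> a] k' by (meson not_le)
    next
      case False
      then have "F \<in> bdF" if "F facet_of snd a" for F using facet_cases[OF nodeD(1)[OF a] that] that by blast
      then show False using isolated_element_pos_entry[OF \<mu> a] l' by (meson not_le)
    qed
  next
    case True
    have "BF (basis P b) (basis P a) = 0" if "b \<in> bdry_nodes T \<Omega>" for b
      using l'[OF that] inviscid_boundary_entry_nonneg[OF True a, of b] that bdry_nodes_subset by fastforce
    then have "(\<Sum>b\<in>nodes T. KF (basis P b) (basis P a)) = 0" using row_sum[OF a] by simp
    moreover have nn: "0 \<le> KF (basis P b) (basis P a)" if "b \<in> nodes T" for b
      using k'[OF that] diagonal_nonneg[OF True a] by (cases "b = a") auto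
    ultimately have "KF (basis P b) (basis P a) = 0" if "b \<in> nodes T" for b
      using sum_nonneg_0[of "nodes T" "\<lambda>b. KF (basis P b) (basis P a)" b] finite_nodes that by blast
    then show False using nondeg[OF True a] by blast
  qed
qed

text \<open>The sign \<open>s\<close> treats maxima and minima together.\<close>
lemma no_strict_extremum:
  assumes detector: "shock_detector \<Omega> T P \<alpha>"
    and nondeg: "\<And>a. \<mu> = 0 \<Longrightarrow> a \<in> nodes T \<Longrightarrow> \<exists>b\<in>nodes T. KF (basis P b) (basis P a) \<noteq> 0"
    and sol: "stabilized_solution \<Omega> T P \<beta> \<mu> h \<alpha> (\<lambda>x. 0) ubar u"
    and a: "a \<in> nodes T" and s: "s = 1 \<or> s = (-1::real)"
    and str: "\<And>r. r \<in> patch_vals \<Omega> T u (bdry_interp \<Omega> T P ubar) a \<Longrightarrow> s * r < s * node_val u a"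
  shows False
proof -
  define w where "w = bdry_interp \<Omega> T P ubar"
  have uV: "u \<in> V_space T P" using sol by (simp add: stabilized_solution_def Let_def)
  have un: "s * node_val u b < s * node_val u a" if "b \<in> nbrs T a - {a}" for b
    using str that by (auto simp: patch_vals_def)
  have ub: "s * ubar (fst b) < s * node_val u a" if b: "b \<in> bdry_nbrs T \<Omega> a" for b
  proof -
    have bb: "b \<in> bdry_nodes T \<Omega>" using b by (simp add: bdry_nbrs_def)
    then have "snd b \<in> T" "fst b \<in> snd b" using nodeD bdry_nodes_subset by blast+
    moreover have "ubar (fst b) = w (snd b) (fst b)" using node_val_bdry_interp[OF bb] by (simp add: node_val_def w_def)
    ultimately have "ubar (fst b) \<in> patch_vals \<Omega> T u w a"
      using bdry_nbr_in_frontier[OF b] unfolding patch_vals_def by blast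
    then show ?thesis using str by (simp add: w_def)
  qed
  \<comment> \<open>The detector requires the extremum on whole elements. The value at any point of
    an element around the vertex is a convex combination of nodal values of that element, all of
    which belong to neighbours.\<close>
  have elem: "s * u K x \<le> s * node_val u a" if K: "K \<in> T" "fst a \<in> K" and x: "x \<in> K" for K x
  proof -
    have "u K x = (\<Sum>b\<in>nodes T. node_val u b * basis P b K x)" using lincomb_V[OF uV] K x by (simp add: lincomb_def)
    then have su: "s * u K x = (\<Sum>b\<in>nodes T. s * node_val u b * basis P b K x)" by (simp add: sum_distrib_left mult.assoc)
    have one: "(\<Sum>b\<in>nodes T. basis P b K x) = 1" using lincomb_one K x by (simp add: lincomb_def)
    have sa: "s * node_val u a = (\<Sum>b\<in>nodes T. s * node_val u a * basis P b K x)"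
      unfolding sum_distrib_left[symmetric] one by simp
    have "(\<Sum>b\<in>nodes T. s * node_val u b * basis P b K x) \<le> (\<Sum>b\<in>nodes T. s * node_val u a * basis P b K x)"
    proof (rule sum_mono)
      fix b assume b: "b \<in> nodes T"
      show "s * node_val u b * basis P b K x \<le> s * node_val u a * basis P b K x"
      proof (cases "K = snd b")
        case True
        then have "b \<in> nbrs T a" using b K nodeD[OF b] by (auto simp: nbrs_def patch_def)
        then have "s * node_val u b \<le> s * node_val u a" using un[of b] by (cases "b = a") auto
        then show ?thesis by (rule mult_right_mono) (rule basis_nonneg[OF b K(1) x])
      qed (simp add: basis_other)
    qed
    then show ?thesis by (simp only: su sa[symmetric])
  qed
  \<comment> \<open>The detector sees the datum only through its interpolant, so the datum may be changed off the vertices.\<close>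
  define ubar' where "ubar' x = (if x \<in> fst ` bdry_nodes T \<Omega> then ubar x else node_val u a)" for x
  have w': "bdry_interp \<Omega> T P ubar' = w"
    unfolding w_def bdry_interp_def by (intro ext sum.cong) (auto simp: ubar'_def)
  have bd: "s * ubar' x \<le> s * node_val u a" if x: "x \<in> frontier (patch T a) \<inter> frontier \<Omega>" for x
  proof (cases "x \<in> fst ` bdry_nodes T \<Omega>")
    case True
    then obtain b where b: "b \<in> bdry_nodes T \<Omega>" "x = fst b" by blast
    have "x \<in> patch T a" using x closed_patch by (auto simp: frontier_def)
    then have "b \<in> bdry_nbrs T \<Omega> a" using b by (auto simp: bdry_nbrs_def nbrs_def bdry_nodes_def)
    then show ?thesis using ub[of b] b True by (simp add: ubar'_def)
  qed (simp add: ubar'_def)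
  have "local_discrete_max \<Omega> T u ubar' a \<or> local_discrete_min \<Omega> T u ubar' a"
    using s
  proof
    assume "s = 1"
    then show ?thesis using elem bd by (auto simp: local_discrete_max_def)
  next
    assume "s = -1"
    then show ?thesis using elem bd by (auto simp: local_discrete_min_def)
  qed
  then have "\<alpha> a u (bdry_interp \<Omega> T P ubar') = 1" using detector a uV unfolding shock_detector_def by blast
  then have \<alpha>1: "\<alpha> a u w = 1" by (simp only: w')
  define no nb where "no b = nu_off \<Omega> T P \<beta> \<mu> h \<alpha> u w a b" and "nb b = nu_bdry \<Omega> T P \<beta> \<mu> h \<alpha> u w a b" for b
  define k l where "k b = KF (basis P b) (basis P a)" and "l b = BF (basis P b) (basis P a)" for b
  \<comment> \<open>Only the detector value at \<open>a\<close> is known to be one; the term with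
    \<open>\<alpha> b\<close> can only enlarge the maximum.\<close>
  have no: "k b \<le> no b" "0 \<le> no b" for b by (simp_all add: no_def k_def nu_off_def \<alpha>1)
  have nb: "- l b \<le> nb b" "0 \<le> nb b" for b by (simp_all add: nb_def l_def nu_bdry_def \<alpha>1)
  have fin: "finite (nbrs T a - {a})" "finite (bdry_nbrs T \<Omega> a)"
    using finite_subset[OF nbrs_subset finite_nodes] by (auto simp: bdry_nbrs_def)
  have "s * ((\<Sum>b\<in>nbrs T a - {a}. (no b - k b) * (node_val u a - node_val u b)) +
      (\<Sum>b\<in>bdry_nbrs T \<Omega> a. (nb b + l b) * (node_val u a - ubar (fst b)))) = 0"
    using solution_row[OF a sol] by (simp add: no_def nb_def k_def l_def w_def)
  then have sum0: "(\<Sum>b\<in>nbrs T a - {a}. (no b - k b) * (s * node_val u a - s * node_val u b)) +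
      (\<Sum>b\<in>bdry_nbrs T \<Omega> a. (nb b + l b) * (s * node_val u a - s * ubar (fst b))) = 0"
    by (simp add: distrib_left sum_distrib_left mult.left_commute right_diff_distrib)
  have pA: "0 \<le> no b - k b \<and> 0 < s * node_val u a - s * node_val u b" if "b \<in> nbrs T a - {a}" for b
    using no(1)[of b] un[OF that] by simp
  have pB: "0 \<le> nb b + l b \<and> 0 < s * node_val u a - s * ubar (fst b)" if "b \<in> bdry_nbrs T \<Omega> a" for b
    using nb(1)[of b] ub[OF that] by simp
  have zA: "no b - k b = 0" if b: "b \<in> nbrs T a - {a}" for b
    by (rule weighted_sums_zero(1)[OF fin _ _ sum0 b]) (use pA pB in blast)+
  have zB: "nb b + l b = 0" if b: "b \<in> bdry_nbrs T \<Omega> a" for b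
    by (rule weighted_sums_zero(2)[OF fin _ _ sum0 b]) (use pA pB in blast)+
  show False
  proof (rule no_extreme_row[OF nondeg a])
    show "0 \<le> KF (basis P b) (basis P a)" if "b \<in> nbrs T a - {a}" for b
      using zA[OF that] no(2)[of b] by (simp add: k_def)
    show "BF (basis P b) (basis P a) \<le> 0" if "b \<in> bdry_nbrs T \<Omega> a" for b
      using zB[OF that] nb(2)[of b] by (simp add: l_def)
  qed
qed

text \<open>The real supremum and infimum bound their members only for bounded sets, and
  \<open>patch_vals\<close> contains whole boundary traces of the interpolant. These are continuous
  on finitely many compact elements.\<close>

lemma bounded_patch_vals: "bounded (patch_vals \<Omega> T u (bdry_interp \<Omega> T P ubar) a)"
proof -
  define w where "w = bdry_interp \<Omega> T P ubar"
  have "bounded (w K ` K)" if K: "K \<in> T" for K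
  proof -
    have l: "lincomb (bdry_nodes T \<Omega>) (\<lambda>b. ubar (fst b)) (basis P) w" unfolding w_def by (rule lincomb_bdry)
    have "C1_on K (w K)"
    proof (rule C1_on_linear[OF T_convex[OF K] T_int[OF K]])
      show "C1_on K (basis P b K)" if "b \<in> bdry_nodes T \<Omega>" for b using l K that by (simp add: lincomb_def reg_def)
      show "w K x = (\<Sum>b\<in>bdry_nodes T \<Omega>. ubar (fst b) * basis P b K x)" if "x \<in> K" for x
        using l K that by (simp add: lincomb_def)
    qed
    then have "continuous_on K (w K)" by (rule C1_onD(3)[OF T_convex[OF K] T_int[OF K]])
    then show ?thesis using compact_continuous_image T_compact[OF K] compact_imp_bounded by blast
  qed
  then have "bounded (\<Union>K\<in>T. w K ` K)" using finite_T by (intro bounded_Union) auto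
  moreover have "bounded (node_val u ` nodes T)" using finite_nodes by (simp add: finite_imp_bounded)
  ultimately have "bounded (node_val u ` nodes T \<union> (\<Union>K\<in>T. w K ` K))" by simp
  moreover have "patch_vals \<Omega> T u w a \<subseteq> node_val u ` nodes T \<union> (\<Union>K\<in>T. w K ` K)"
    unfolding patch_vals_def using nbrs_subset[of a] by blast
  ultimately show ?thesis unfolding w_def[symmetric] by (rule bounded_subset)
qed

end

theorem theorem4p5:
  fixes \<Omega> :: "(real^'n) set" and T :: "'n cell set"
    and P :: "'n cell \<Rightarrow> (real^'n \<Rightarrow> real) set"
    and \<beta> :: "real^'n \<Rightarrow> real^'n" and \<mu> :: real and h :: "(real^'n) set \<Rightarrow> real"
    and \<alpha> :: "'n node \<Rightarrow> 'n broken \<Rightarrow> 'n broken \<Rightarrow> real"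
    and ubar :: "real^'n \<Rightarrow> real" and u :: "'n broken"
  assumes domain: "lipschitz_domain \<Omega>"
    and mesh: "fe_mesh \<Omega> T P"
    and velocity: "solenoidal_on \<Omega> \<beta>"
    and diffusion: "0 \<le> \<mu>"
    and conforming: "conforming_boundary T \<Omega> \<beta>"
    and length: "\<And>F. F \<in> interior_facets T \<union> boundary_facets T \<Omega> \<Longrightarrow> 0 < h F"
    and detector: "shock_detector \<Omega> T P \<alpha>"
    and nondegenerate: "\<And>a. \<mu> = 0 \<Longrightarrow> a \<in> nodes T \<Longrightarrow>
      \<exists>b\<in>nodes T. K_form \<Omega> T \<beta> \<mu> h (basis P b) (basis P a) \<noteq> 0"
    and solution: "stabilized_solution \<Omega> T P \<beta> \<mu> h \<alpha> (\<lambda>x. 0) ubar u"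
  shows "satisfies_DMP \<Omega> T P ubar u"
proof -
  interpret dg_scheme \<Omega> T P \<beta> \<mu> h
    by unfold_locales (use assms in auto)
  note core = no_strict_extremum[OF detector nondegenerate solution]
  show ?thesis unfolding satisfies_DMP_def
  proof (intro ballI conjI)
    fix a assume a: "a \<in> nodes T"
    define S where "S = patch_vals \<Omega> T u (bdry_interp \<Omega> T P ubar) a"
    have bdd: "bdd_above S" "bdd_below S"
      unfolding S_def by (rule bounded_imp_bdd_above bounded_imp_bdd_below, rule bounded_patch_vals)+
    show "u_min \<Omega> T u (bdry_interp \<Omega> T P ubar) a \<le> node_val u a"
    proof (rule ccontr)
      assume "\<not> u_min \<Omega> T u (bdry_interp \<Omega> T P ubar) a \<le> node_val u a"
      then have lt: "node_val u a < Inf S" by (simp add: u_min_def S_def)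
      show False
      \<comment> \<open>If \<open>S\<close> were empty, the strict inequality would be required of
        no value and the contradiction would still follow, so the default value of
        \<open>Inf\<close> on the empty set does no harm.\<close>
      proof (rule core[OF _ _ a, of "-1"])
        show "- 1 * r < - 1 * node_val u a" if "r \<in> patch_vals \<Omega> T u (bdry_interp \<Omega> T P ubar) a" for r
          using cInf_lower[OF _ bdd(2), of r] that lt by (simp add: S_def)
      qed auto
    qed
    show "node_val u a \<le> u_max \<Omega> T u (bdry_interp \<Omega> T P ubar) a"
    proof (rule ccontr)
      assume "\<not> node_val u a \<le> u_max \<Omega> T u (bdry_interp \<Omega> T P ubar) a"
      then have lt: "Sup S < node_val u a" by (simp add: u_max_def S_def)
      show False
      proof (rule core[OF _ _ a, of "1"])
        show "1 * r < 1 * node_val u a" if "r \<in> patch_vals \<Omega> T u (bdry_interp \<Omega> T P ubar) a" for r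
          using cSup_upper[OF _ bdd(1), of r] that lt by (simp add: S_def)
      qed auto
    qed
  qed
qed


end
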